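(* Let $k\ge 2$, let $n_1,\ldots,n_k$ be integers larger than or equal to $2$, let $m=\prod_{i=1}^k n_i$ and $K=\{1,\dots,k\}$. Suppose $\phi: M_m\to M_m$ is a linear map. Then $$\operatorname{rank}(\phi(A_1\otimes\cdots\otimes A_k))=1\quad\text{whenever}\quad \operatorname{rank}(A_1\otimes\cdots\otimes A_k)=1,\qquad A_i\in M_{n_i},\ i=1,\dots,k,$$ if and only if there exist a partition $\{P_1,P_2,P_3,P_4\}$ of $K$ (some $P_\ell$ may be empty), an $m\times p_1p_2p_3^2$ matrix $M$ and an $m\times p_1p_2p_4^2$ matrix $N$, where $p_\ell=\prod_{i\in P_\ell}n_i$ (and $p_\ell=1$ if $P_\ell=\emptyset$) for $\ell=1,2,3,4$, satisfying the kernel condition $$\operatorname{Ker}(M)\cap \mathcal S\Big(\bigotimes_{i\in P_1\cup P_2}\mathbb C^{n_i}\otimes\bigotimes_{j\in P_3}(\mathbb C^{n_j}\otimes\mathbb C^{n_j})\Big)=\{0\} \quad\text{and}\quad \operatorname{Ker}(N)\cap \mathcal S\Big(\bigotimes_{i\in P_1\cup P_2}\mathbb C^{n_i}\otimes\bigotimes_{j\in P_4}(\mathbb C^{n_j}\otimes\mathbb C^{n_j})\Big)=\{0\},$$ such that $$\phi(A_1\otimes\cdots\otimes A_k)=M\Big(\bigotimes_{i\in P_1}A_i\otimes\bigotimes_{i\in P_2}A_i^T\otimes\bigotimes_{i\in P_3}\operatorname{vec}(A_i)\otimes\bigotimes_{i\in P_4}\operatorname{vec}^T(A_i)\Big)N^T\quad\text{for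 all }A_i\in M_{n_i},\ i=1,\dots,k.$$ Furthermore, for any given partition $\{P_1,P_2,P_3,P_4\}$ of $K$, with $p_\ell=\prod_{i\in P_\ell}n_i$ (and $p_\ell=1$ if $P_\ell=\emptyset$), there always exist some $m\times p_1p_2p_3^2$ matrix $M$ and some $m\times p_1p_2p_4^2$ matrix $N$ satisfying $$\operatorname{Ker}(M)\cap \mathcal S\Big(\bigotimes_{i\in P_1\cup P_2}\mathbb C^{n_i}\otimes\bigotimes_{j\in P_3}(\mathbb C^{n_j}\otimes\mathbb C^{n_j})\Big)=\{0\} \quad\text{and}\quad \operatorname{Ker}(N)\cap \mathcal S\Big(\bigotimes_{i\in P_1\cup P_2}\mathbb C^{n_i}\otimes\bigotimes_{j\in P_4}(\mathbb C^{n_j}\otimes\mathbb C^{n_j})\Big)=\{0\},$$ except in the case $k=2$, $K=\{1,2\}$, $2\in\{n_1,n_2\}$ and $(P_1,P_2,P_3,P_4)=(\emptyset,\emptyset,K,\emptyset)$ or $(\emptyset,\emptyset,\emptyset,K)$, in which no such pair $M,N$ exists.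
   Context: $M_n$ is the space of $n\times n$ complex matrices; $\otimes$ is the Kronecker product, $A\otimes B=[a_{ij}B]$, and $\mathbb C^{a}\otimes\mathbb C^{b}$ is identified with $\mathbb C^{ab}$ via the Kronecker product of column vectors. $\mathcal S(\mathbb C^{a_1}\otimes\cdots\otimes\mathbb C^{a_r})=\{x_1\otimes\cdots\otimes x_r: x_i\in\mathbb C^{a_i}\}$ is the set of decomposable vectors (including $0$). In $\mathcal S(\cdots\otimes\bigotimes_{j\in P}(\mathbb C^{n_j}\otimes\mathbb C^{n_j}))$ each of the two copies of $\mathbb C^{n_j}$ counts as a separate tensor factor. For $A=[a_{ij}]\in M_n$, $\operatorname{vec}(A)=[a_{11}\ a_{12}\cdots a_{1n}\ a_{21}\cdots a_{2n}\cdots a_{n1}\cdots a_{nn}]^T\in\mathbb C^{n^2}$ (row by row), so $\operatorname{vec}(xy^T)=x\otimes y$; $\operatorname{vec}^T(A)$ is the row vector $(\operatorname{vec}(A))^T$. A partition $\{P_1,\dots,P_r\}$ of a set $S$ is an (indexed) collection of pairwise disjoint, possibly empty, subsets with union $S$. Products $\bigotimes_{i\in P}$ are taken in increasing order of the indices in $P$, and are omitted if $P=\emptyset$ (an empty product of spaces is $\mathbb C$, an empty product of matrices is the scalar $1$). The product $\bigotimes_{i\in P_1\cup P_2}\mathbb C^{n_i}$ is ordered with the factors indexed by $P_1$ first, followed by those indexed by $P_2$, matching the order of the factors in the formula for $\phi$. *)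

theory Defs
  imports
    "Jordan_Normal_Form.DL_Rank"
    "Jordan_Normal_Form.Matrix_Kernel"
    "HOL-Library.Disjoint_Sets"
    Complex_Main
begin

definition kron :: "complex mat \<Rightarrow> complex mat \<Rightarrow> complex mat" (infixr "\<otimes>\<^sub>K" 70) where
  "A \<otimes>\<^sub>K B = mat (dim_row A * dim_row B) (dim_col A * dim_col B)
     (\<lambda>(i, j). A $$ (i div dim_row B, j div dim_col B) * B $$ (i mod dim_row B, j mod dim_col B))"

definition kron_vec :: "complex vec \<Rightarrow> complex vec \<Rightarrow> complex vec" (infixr "\<otimes>\<^sub>v" 70) where
  "x \<otimes>\<^sub>v y = vec (dim_vec x * dim_vec y) (\<lambda>i. x $ (i div dim_vec y) * y $ (i mod dim_vec y))"

text \<open>Products run over the index set in increasing order; the empty product is the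
  \<open>1 \<times> 1\<close> identity matrix, i.e. the scalar 1.\<close>

definition kron_prod :: "nat set \<Rightarrow> (nat \<Rightarrow> complex mat) \<Rightarrow> complex mat" where
  "kron_prod P F = foldr kron (map F (sorted_list_of_set P)) (1\<^sub>m 1)"

definition kron_vecs :: "complex vec list \<Rightarrow> complex vec" where
  "kron_vecs xs = foldr kron_vec xs (vec 1 (\<lambda>_. 1))"

text \<open>Row-by-row vectorization, as a matrix with one column.\<close>

definition vectorize :: "complex mat \<Rightarrow> complex mat" where
  "vectorize A = mat (dim_row A * dim_col A) 1 (\<lambda>(i, j). A $$ (i div dim_col A, i mod dim_col A))"

text \<open>The decomposable vectors of the tensor product of the spaces \<open>\<complex>\<^sup>a\<close>, for \<open>a\<close> in the list
  \<open>as\<close> of dimensions. The empty product of spaces is the field, which has the single factor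
  \<open>\<complex>\<^sup>1\<close>: all its elements are decomposable, not only the empty product 1.\<close>

definition decomposable_vecs :: "nat list \<Rightarrow> complex vec set" where
  "decomposable_vecs as = {kron_vecs xs | xs. map dim_vec xs = (if as = [] then [1] else as)}"

text \<open>A family \<open>P 1, \<dots>, P r\<close> of pairwise disjoint, possibly empty sets with union \<open>K\<close>.\<close>

definition indexed_partition :: "nat \<Rightarrow> nat set \<Rightarrow> (nat \<Rightarrow> nat set) \<Rightarrow> bool" where
  "indexed_partition r K P \<longleftrightarrow> disjoint_family_on P {1..r} \<and> (\<Union>l\<in>{1..r}. P l) = K"

text \<open>The list of dimensions of the tensor factors of the space on which \<open>M\<close> (for \<open>Q = P 3\<close>) and
  \<open>N\<close> (for \<open>Q = P 4\<close>) act; each index in \<open>Q\<close> contributes two factors.\<close>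

definition factor_dims :: "(nat \<Rightarrow> nat) \<Rightarrow> (nat \<Rightarrow> nat set) \<Rightarrow> nat set \<Rightarrow> nat list" where
  "factor_dims n P Q =
     map n (sorted_list_of_set (P 1)) @ map n (sorted_list_of_set (P 2)) @
     concat (map (\<lambda>j. [n j, n j]) (sorted_list_of_set Q))"

definition admissible_pair ::
  "nat \<Rightarrow> (nat \<Rightarrow> nat) \<Rightarrow> (nat \<Rightarrow> nat set) \<Rightarrow> complex mat \<Rightarrow> complex mat \<Rightarrow> bool" where
  "admissible_pair m n P M N \<longleftrightarrow>
     (let p = (\<lambda>l. \<Prod>i\<in>P l. n i) in
       M \<in> carrier_mat m (p 1 * p 2 * p 3 ^ 2) \<and>
       N \<in> carrier_mat m (p 1 * p 2 * p 4 ^ 2) \<and>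
       mat_kernel M \<inter> decomposable_vecs (factor_dims n P (P 3)) = {0\<^sub>v (p 1 * p 2 * p 3 ^ 2)} \<and>
       mat_kernel N \<inter> decomposable_vecs (factor_dims n P (P 4)) = {0\<^sub>v (p 1 * p 2 * p 4 ^ 2)})"

end

theory Submission
  imports Defs "HOL-Library.Poly_Mapping" "HOL-Library.Set_Algebras"
    "HOL-Computational_Algebra.Fundamental_Theorem_Algebra"
begin

text \<open>
  Writing \<open>A i = x i (y i)\<^sup>T\<close>, a preserver is a multilinear map of the \<open>2k\<close> vectors \<open>x i\<close>, \<open>y i\<close>
  whose values on nonzero vectors have rank one. When a single vector varies, the values form a linear
  space of matrices of rank at most one, hence share their column space or their row space, and which
  of the two happens cannot depend on the other vectors. So the map splits as \<open>G H\<^sup>T\<close>, where \<open>G\<close>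
  depends only on the vectors that move the column space and \<open>H\<close> on the others; the types of
  \<open>x i\<close> and \<open>y i\<close> put \<open>i\<close> into one of the four blocks.

  Admissible matrices are obtained from polynomial multiplication: a tensor product of nonzero
  coefficient vectors is mapped to a nonzero product of polynomials, of degree at most \<open>\<Sum>(a\<^sub>j - 1)\<close>. In the
  exceptional case one needs the converse, that \<open>m \<le> \<Sum>(a\<^sub>j - 1)\<close> multilinear forms have a common
  zero. The coordinate ring of the Segre variety grows too fast to be generated, in large degrees, by
  the forms; a maximal linear subspace \<open>U\<close> of the degree one part that still does not generate any
  graded piece has codimension one, because two elements \<open>g\<close>, \<open>h\<close> outside \<open>U\<close> would satisfy a
  homogeneous equation modulo \<open>U\<close>, which factors into members of the pencil of \<open>g\<close> and \<open>h\<close>, each of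
  them a non-zero-divisor modulo the saturated ideal. The functional with kernel \<open>U\<close> is the point.
\<close>

section \<open>A projective Nullstellensatz for graded subalgebras\<close>

text \<open>The number \<open>D = \<Sum>(a\<^sub>j - 1)\<close> is the dimension of the Segre
  variety and decides both existence questions. A product of polynomials of degrees at most
  \<open>a\<^sub>j - 1\<close> has \<open>D + 1\<close> coefficients, so \<open>D + 1\<close> rows
  are enough; at most \<open>D\<close> rows never are. The latter is a comparison of growth: in
  degree \<open>D * s\<close> there are at least \<open>(s + 1) ^ D\<close> independent monomials,
  whereas \<open>m\<close> forms that generate everything from some degree on leave room for
  \<open>O(s ^ (m - 1))\<close> only. For \<open>k = 2\<close> with both indices counted twice,
  \<open>m - (D + 1)\<close> is \<open>(n 1 - 2) * (n 2 - 2) - 1\<close>, negative exactly when some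
  dimension is 2; this is the exception.

  In the rank one part the obstacle is a scalar: matching column and row spaces only give that
  \<open>F v\<close> is a multiple of the dyad of \<open>G v\<close> and \<open>H v\<close>, with a
  factor that may depend on \<open>v\<close>. It is normalized at a base tuple, and since vectors
  are changed one at a time, linearity in the changed vector keeps it equal to 1. The kernel
  conditions then express that \<open>G\<close> and \<open>H\<close> do not vanish on tuples of
  nonzero vectors.\<close>

lemma set_power_insert:
  fixes a :: "'a::comm_monoid_mult"
  shows "insert a F ^ s \<subseteq> (\<Union>j\<le>s. (*) (a ^ (s - j)) ` (F ^ j))"
proof (induction s)
  case (Suc s)
  show ?case
  proof
    fix x assume "x \<in> insert a F ^ Suc s"
    then have "x \<in> insert a F * insert a F ^ s" by (simp only: power_Suc)
    then obtain b y where x: "x = b * y" "b \<in> insert a F" "y \<in> insert a F ^ s"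
      by (elim set_times_elim)
    obtain j z where y: "j \<le> s" "z \<in> F ^ j" "y = a ^ (s - j) * z" using x(3) Suc by blast
    show "x \<in> (\<Union>j\<le>Suc s. (*) (a ^ (Suc s - j)) ` (F ^ j))"
    proof (cases "b = a")
      case True
      then have "x = a ^ (Suc s - j) * z" using x y by (simp add: Suc_diff_le mult.assoc)
      then show ?thesis using y(1,2) by (intro UN_I[of j] image_eqI[of _ _ z]) auto
    next
      case False
      then have "b * z \<in> F ^ Suc j" using x y by (simp add: set_times_intro)
      moreover have "x = a ^ (Suc s - Suc j) * (b * z)" using x y by (simp add: mult_ac)
      ultimately show ?thesis using y(1) by (intro UN_I[of "Suc j"] image_eqI[of _ _ "b * z"]) auto
    qed
  qed
qed simp

lemma finite_set_power: "finite F \<Longrightarrow> finite (F ^ s)"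
  for F :: "'a::comm_monoid_mult set"
  by (induction s) (auto intro: finite_set_times)

text \<open>Splitting off the exponent \<open>s - j\<close> of one element leaves
  \<open>s + 1\<close> cases, each bounded by induction, so every element after the first costs one
  factor \<open>s + 1\<close>. The later comparison of growth depends on the exponent
  \<open>card F - 1\<close> and not on the sharp binomial count.\<close>

lemma card_set_power:
  fixes F :: "'a::comm_monoid_mult set"
  assumes "finite F" "F \<noteq> {}"
  shows "card (F ^ s) \<le> Suc s ^ (card F - 1)"
  using assms
proof (induction F arbitrary: s rule: finite_ne_induct)
  case (singleton a)
  have "{a} ^ s = {a ^ s}" by (induction s) (auto simp: set_times_def)
  then show ?case by simp
next
  case (insert a F)
  have "card (insert a F ^ s) \<le> card (\<Union>j\<le>s. (*) (a ^ (s - j)) ` (F ^ j))"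
    by (intro card_mono finite_UN_I finite_imageI finite_set_power insert set_power_insert) simp
  also have "\<dots> \<le> (\<Sum>j\<le>s. card ((*) (a ^ (s - j)) ` (F ^ j)))" by (intro card_UN_le) simp
  also have "\<dots> \<le> (\<Sum>j\<le>s. Suc s ^ (card F - 1))"
  proof (intro sum_mono)
    fix j assume "j \<in> {..s}"
    have "card ((*) (a ^ (s - j)) ` (F ^ j)) \<le> card (F ^ j)"
      by (intro card_image_le finite_set_power insert)
    also have "\<dots> \<le> Suc j ^ (card F - 1)" by (rule insert.IH)
    also have "\<dots> \<le> Suc s ^ (card F - 1)" using \<open>j \<in> _\<close> by (intro power_mono) auto
    finally show "card ((*) (a ^ (s - j)) ` (F ^ j)) \<le> Suc s ^ (card F - 1)" .
  qed
  also have "\<dots> = Suc s ^ Suc (card F - 1)" by simp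
  also have "Suc (card F - 1) = card (insert a F) - 1"
    using insert by (simp add: card_gt_0_iff)
  finally show ?case .
qed

text \<open>Degrees are pure bookkeeping: the ring carries no grading, and the part of degree
  \<open>t\<close> is represented by \<open>span (X ^ t)\<close>, where \<open>X ^ t\<close> is the
  set of \<open>t\<close>-fold products of elements of \<open>X\<close>.\<close>

locale complex_algebra = vector_space scale
  for scale :: "complex \<Rightarrow> 'a::comm_ring_1 \<Rightarrow> 'a" (infixr \<open>*s\<close> 75) +
  assumes scale_mult_left: "(c *s x) * y = c *s (x * y)"
begin

lemma scale_mult_right: "x * (c *s y) = c *s (x * y)"
  using scale_mult_left[of c y x] by (simp add: mult.commute)

section \<open>Spans of products, and calculation modulo an ideal\<close>

lemma subspace_mult_preimage: "subspace V \<Longrightarrow> subspace {y. a * y \<in> V}"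
  by (auto simp: subspace_def distrib_left scale_mult_right)

lemma span_times:
  assumes "a \<in> span A" "b \<in> span B"
  shows "a * b \<in> span (A * B)"
proof -
  have 1: "x * b \<in> span (A * B)" if "x \<in> A" for x
  proof -
    have "span B \<subseteq> {y. x * y \<in> span (A * B)}"
      using that by (intro span_minimal subspace_mult_preimage) (auto intro!: span_base)
    with assms show ?thesis by blast
  qed
  have "span A \<subseteq> {y. b * y \<in> span (A * B)}"
    using 1 by (intro span_minimal subspace_mult_preimage) (auto simp: mult.commute)
  with assms show ?thesis by (auto simp: mult.commute)
qed

lemma span_power: "g \<in> span X \<Longrightarrow> g ^ s \<in> span (X ^ s)"
  by (induction s) (auto intro: span_base span_times)

lemma span_times_power:
  assumes "a \<in> span (B * X ^ s)" "b \<in> span (X ^ r)"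
  shows "a * b \<in> span (B * X ^ (s + r))"
  using span_times[OF assms] by (simp add: power_add mult.assoc)

text \<open>The form in which reduction modulo \<open>span (B * Y)\<close> is used throughout: all
  multiples of \<open>g\<close> are collected into a single cofactor \<open>w\<close>.\<close>

lemma span_insert_times:
  assumes "v \<in> span (insert g B * Y)"
  shows "\<exists>w\<in>span Y. v - g * w \<in> span (B * Y)"
proof -
  let ?V = "{v. \<exists>w\<in>span Y. v - g * w \<in> span (B * Y)}"
  have "subspace ?V"
    unfolding subspace_def
  proof (intro conjI ballI allI)
    show "0 \<in> ?V" by (auto intro!: bexI[of _ 0] simp: span_zero)
  next
    fix x y assume "x \<in> ?V" "y \<in> ?V"
    then obtain w w' where w: "w \<in> span Y" "x - g * w \<in> span (B * Y)"
      "w' \<in> span Y" "y - g * w' \<in> span (B * Y)" by blast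
    have "(x + y) - g * (w + w') = (x - g * w) + (y - g * w')" by (simp add: algebra_simps)
    moreover have "(x - g * w) + (y - g * w') \<in> span (B * Y)" using w by (simp only: span_add)
    ultimately have "(x + y) - g * (w + w') \<in> span (B * Y)" by (simp only:)
    then show "x + y \<in> ?V" using span_add[OF w(1,3)] by blast
  next
    fix c x assume "x \<in> ?V"
    then obtain w where w: "w \<in> span Y" "x - g * w \<in> span (B * Y)" by blast
    have "c *s x - g * (c *s w) = c *s (x - g * w)"
      by (simp add: scale_mult_right scale_right_diff_distrib)
    then have "c *s x - g * (c *s w) \<in> span (B * Y)" using w by (simp only: span_scale)
    then show "c *s x \<in> ?V" using span_scale[OF w(1)] by blast
  qed
  moreover have "insert g B * Y \<subseteq> ?V"
  proof
    fix v assume "v \<in> insert g B * Y"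
    then obtain b y where b: "v = b * y" "b \<in> insert g B" "y \<in> Y" by (elim set_times_elim)
    show "v \<in> ?V"
    proof (cases "b \<in> B")
      case True
      then show ?thesis using b by (auto intro!: bexI[of _ 0] simp: span_zero span_base set_times_intro)
    next
      case False
      then show ?thesis using b by (auto intro!: bexI[of _ y] simp: span_zero span_base)
    qed
  qed
  ultimately show ?thesis using assms span_minimal by blast
qed

text \<open>An indexed form of linear dependence: a repetition \<open>w i = w j\<close> counts as a
  dependence, which the set-based notion would not see.\<close>

lemma dependent_family:
  assumes "finite W" "finite I" "card W < card I" "\<And>i. i \<in> I \<Longrightarrow> w i \<in> span W"
  shows "\<exists>c. (\<exists>i\<in>I. c i \<noteq> 0) \<and> (\<Sum>i\<in>I. c i *s w i) = 0"
proof (cases "inj_on w I")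
  case True
  have "w ` I \<subseteq> span W" "card (w ` I) = card I"
    using assms(4) True by (auto simp: card_image)
  then have "dependent (w ` I)"
    using independent_span_bound[OF assms(1)] assms(3) by fastforce
  then obtain u where u: "\<exists>v\<in>w ` I. u v \<noteq> 0" "(\<Sum>v\<in>w ` I. u v *s v) = 0"
    using dependent_finite[of "w ` I"] assms(2) by auto
  then show ?thesis
    using True by (intro exI[of _ "u \<circ> w"]) (auto simp: sum.reindex)
next
  case False
  then obtain i j where ij: "i \<in> I" "j \<in> I" "i \<noteq> j" "w i = w j" by (auto simp: inj_on_def)
  let ?c = "\<lambda>l. if l = i then 1 else if l = j then - 1 else (0::complex)"
  have "(\<Sum>l\<in>I. ?c l *s w l) = (\<Sum>l\<in>{i, j}. ?c l *s w l)"
    using ij assms(2) by (intro sum.mono_neutral_right) auto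
  also have "\<dots> = 0" using ij by simp
  finally show ?thesis using ij by (intro exI[of _ ?c]) auto
qed

text \<open>The degree \<open>s\<close> part of the saturation of the ideal generated by
  \<open>B\<close>: all products of some fixed positive length multiply \<open>x\<close> into the
  ideal. Both \<open>y * x\<close> and \<open>B * X ^ (j + s)\<close> have degree
  \<open>j + s + 1\<close>. For \<open>s = 0\<close> and \<open>x = 1\<close> the condition says
  that \<open>B\<close> generates a whole graded piece.\<close>

definition saturated :: "'a set \<Rightarrow> 'a set \<Rightarrow> nat \<Rightarrow> 'a \<Rightarrow> bool" where
  "saturated X B s x \<longleftrightarrow> (\<exists>j. \<forall>y\<in>X ^ Suc j. y * x \<in> span (B * X ^ (j + s)))"

text \<open>If \<open>B\<close> and \<open>p\<close> together generate degree \<open>T + 1\<close>,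
  then \<open>p\<close> is a non-zero-divisor modulo the saturation. A long multiplier splits as
  \<open>y1 * y2\<close>: \<open>y2\<close> is rewritten as \<open>p * w\<close> modulo
  \<open>B\<close>, and \<open>y1\<close> moves \<open>p * x\<close> into the ideal.\<close>

lemma saturated_cancel:
  assumes T: "X ^ Suc T \<subseteq> span (insert p B * X ^ T)"
    and x: "x \<in> span (X ^ s)" and sat: "saturated X B (Suc s) (p * x)"
  shows "saturated X B s x"
proof -
  obtain j where j: "\<And>y. y \<in> X ^ Suc j \<Longrightarrow> y * (p * x) \<in> span (B * X ^ (j + Suc s))"
    using sat by (auto simp: saturated_def)
  have "y * x \<in> span (B * X ^ ((j + Suc T) + s))" if "y \<in> X ^ Suc (j + Suc T)" for y
  proof -
    have "X ^ Suc (j + Suc T) = X ^ Suc j * X ^ Suc T" unfolding power_add[symmetric] by simp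
    then have "y \<in> X ^ Suc j * X ^ Suc T" using that by (simp only:)
    then obtain y1 y2 where y: "y = y1 * y2" "y1 \<in> X ^ Suc j" "y2 \<in> X ^ Suc T"
      by (elim set_times_elim)
    obtain w where w: "w \<in> span (X ^ T)" "y2 - p * w \<in> span (B * X ^ T)"
      using span_insert_times[of y2] T y(3) by blast
    have yx: "y1 * x \<in> span (X ^ (Suc j + s))"
      using span_times[OF span_base[OF y(2)] x] by (simp add: power_add mult.assoc)
    have "(y2 - p * w) * (y1 * x) \<in> span (B * X ^ (T + (Suc j + s)))"
      by (rule span_times_power[OF w(2) yx])
    moreover have "(y1 * (p * x)) * w \<in> span (B * X ^ ((j + Suc s) + T))"
      by (rule span_times_power[OF j[OF y(2)] w(1)])
    moreover have "y * x = (y2 - p * w) * (y1 * x) + (y1 * (p * x)) * w"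
      unfolding y by (simp add: algebra_simps)
    ultimately show ?thesis by (simp add: span_add add_ac)
  qed
  then show ?thesis unfolding saturated_def by blast
qed

text \<open>The binary form of formal degree \<open>s\<close> with dehomogenization
  \<open>q\<close>, evaluated at \<open>g\<close> and \<open>h\<close>. When \<open>degree q\<close>
  is smaller than \<open>s\<close>, the difference is the multiplicity of the root at infinity, that
  is, of the factor \<open>g\<close>.\<close>

definition homogenize :: "'a \<Rightarrow> 'a \<Rightarrow> nat \<Rightarrow> complex poly \<Rightarrow> 'a" where
  "homogenize g h s q = (\<Sum>i\<le>s. coeff q i *s (g ^ (s - i) * h ^ i))"

lemma homogenize_diff: "homogenize g h s (p - q) = homogenize g h s p - homogenize g h s q"
  by (simp add: homogenize_def scale_left_diff_distrib sum_subtractf)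

lemma homogenize_smult: "homogenize g h s (smult c q) = c *s homogenize g h s q"
  by (simp add: homogenize_def scale_sum_right)

lemma homogenize_in_span:
  assumes "g \<in> span X" "h \<in> span X"
  shows "homogenize g h s q \<in> span (X ^ s)"
  unfolding homogenize_def
proof (intro span_sum span_scale)
  fix i assume "i \<in> {..s}"
  then show "g ^ (s - i) * h ^ i \<in> span (X ^ s)"
    using span_times[OF span_power[OF assms(1), of "s - i"] span_power[OF assms(2), of i]]
    by (simp flip: power_add)
qed

lemma homogenize_Suc_degree_le:
  assumes "degree q \<le> s"
  shows "homogenize g h (Suc s) q = g * homogenize g h s q"
proof -
  have "coeff q (Suc s) = 0" using assms by (simp add: coeff_eq_0)
  then show ?thesis
    by (simp add: homogenize_def sum_distrib_left scale_mult_right Suc_diff_le mult.assoc)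
qed

lemma homogenize_Suc_linear_factor:
  assumes "degree q \<le> s"
  shows "homogenize g h (Suc s) ([:- z, 1:] * q) = (h - z *s g) * homogenize g h s q"
proof -
  have 1: "homogenize g h (Suc s) (pCons 0 q) = h * homogenize g h s q"
    by (simp add: homogenize_def sum.atMost_Suc_shift sum_distrib_left scale_mult_right mult_ac
        del: sum.atMost_Suc)
  have "[:- z, 1:] * q = pCons 0 q - smult z q" by simp
  then have "homogenize g h (Suc s) ([:- z, 1:] * q)
      = homogenize g h (Suc s) (pCons 0 q) - z *s homogenize g h (Suc s) q"
    by (simp only: homogenize_diff homogenize_smult)
  also have "\<dots> = (h - z *s g) * homogenize g h s q"
    by (simp add: 1 homogenize_Suc_degree_le[OF assms] left_diff_distrib scale_mult_left)
  finally show ?thesis .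
qed

text \<open>A complex binary form splits into linear factors: \<open>h - z *s g\<close> for a root
  \<open>z\<close>, or \<open>g\<close> when the degree drops. All of them are members of the pencil
  and can be cancelled, until a nonzero constant is left.\<close>

lemma saturated_homogenize_cancel:
  assumes bad: "\<And>\<alpha> \<beta>. (\<alpha>, \<beta>) \<noteq> (0, 0) \<Longrightarrow>
      \<exists>T. X ^ Suc T \<subseteq> span (insert (\<alpha> *s g + \<beta> *s h) B * X ^ T)"
    and gh: "g \<in> span X" "h \<in> span X"
    and "q \<noteq> 0" "degree q \<le> s" "saturated X B s (homogenize g h s q)"
  shows "saturated X B 0 1"
  using assms(4-6)
proof (induction s arbitrary: q)
  case 0
  then obtain c where c: "q = [:c:]" "c \<noteq> 0" by (metis degree_eq_zeroE le_zero_eq pCons_0_0)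
  obtain j where j: "\<And>y. y \<in> X ^ Suc j \<Longrightarrow> y * (c *s 1) \<in> span (B * X ^ j)"
    using 0(3) c by (auto simp: saturated_def homogenize_def)
  have "y * 1 \<in> span (B * X ^ (j + 0))" if "y \<in> X ^ Suc j" for y
    using span_scale[OF j[OF that], of "inverse c"] c by (simp add: scale_mult_right)
  then show ?case unfolding saturated_def by blast
next
  case (Suc s)
  show ?case
  proof (cases "degree q \<le> s")
    case True
    obtain T where "X ^ Suc T \<subseteq> span (insert g B * X ^ T)" using bad[of 1 0] by auto
    then have "saturated X B s (homogenize g h s q)"
      using Suc.prems(3) saturated_cancel homogenize_in_span[OF gh]
      by (simp add: homogenize_Suc_degree_le[OF True])
    then show ?thesis using Suc True by blast
  next
    case False
    then have deg: "degree q = Suc s" using Suc.prems by simp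
    then have "\<not> constant (poly q)" by (simp add: constant_degree)
    then obtain z where "poly q z = 0" using fundamental_theorem_of_algebra by blast
    then obtain r where r: "q = [:- z, 1:] * r" by (metis poly_eq_0_iff_dvd dvdE)
    then have "r \<noteq> 0" using Suc.prems by auto
    then have degr: "degree r \<le> s" using deg unfolding r by (subst (asm) degree_mult_eq) auto
    obtain T where "X ^ Suc T \<subseteq> span (insert (h - z *s g) B * X ^ T)"
      using bad[of "- z" 1] by auto
    then have "saturated X B s (homogenize g h s r)"
      using Suc.prems(3) saturated_cancel homogenize_in_span[OF gh]
      unfolding r homogenize_Suc_linear_factor[OF degr] by blast
    then show ?thesis using Suc.IH \<open>r \<noteq> 0\<close> degr by blast
  qed
qed

text \<open>Otherwise \<open>B\<close> with any member of the pencil generates some graded piece.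
  Modulo \<open>B\<close>, high degrees then consist of multiples of a power of \<open>g\<close>
  with cofactors in the finite-dimensional \<open>span (X ^ T)\<close>, which forces a linear
  relation between the monomials in \<open>g\<close> and \<open>h\<close>. Cancelling its linear
  factors puts 1 into the saturation, contrary to \<open>good\<close>.\<close>

lemma pencil_member:
  assumes X: "finite X" and B: "B \<subseteq> span X"
    and good: "\<And>t. \<not> X ^ Suc t \<subseteq> span (B * X ^ t)"
    and gh: "g \<in> span X" "h \<in> span X"
  shows "\<exists>\<alpha> \<beta>. (\<alpha>, \<beta>) \<noteq> (0, 0) \<and>
    (\<forall>t. \<not> X ^ Suc t \<subseteq> span (insert (\<alpha> *s g + \<beta> *s h) B * X ^ t))"
proof (rule ccontr)
  assume "\<not> ?thesis"
  then have bad: "\<And>\<alpha> \<beta>. (\<alpha>, \<beta>) \<noteq> (0, 0) \<Longrightarrow>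
      \<exists>T. X ^ Suc T \<subseteq> span (insert (\<alpha> *s g + \<beta> *s h) B * X ^ T)" by blast
  obtain T where T: "X ^ Suc T \<subseteq> span (insert g B * X ^ T)" using bad[of 1 0] by auto
  \<comment> \<open>Each further degree yields one more power of \<open>g\<close>: after
    multiplication by \<open>x\<close> the cofactor has degree \<open>T + 1\<close> and is reduced
    again to \<open>g\<close> times a cofactor of degree \<open>T\<close>.\<close>
  have red: "\<exists>w\<in>span (X ^ T). u - g ^ Suc s * w \<in> span (B * X ^ (T + s))"
    if "u \<in> span (X ^ (T + Suc s))" for u s
    using that
  proof (induction s arbitrary: u)
    case 0
    have "u \<in> span (X ^ Suc T)" using 0 by simp
    also have "\<dots> \<subseteq> span (insert g B * X ^ T)" by (rule span_minimal[OF T subspace_span])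
    finally show ?case using span_insert_times by auto
  next
    case (Suc s)
    have "X * X ^ (T + Suc s) \<subseteq> span (insert (g ^ Suc (Suc s)) (B * X ^ Suc s) * X ^ T)"
    proof
      fix v assume "v \<in> X * X ^ (T + Suc s)"
      then obtain x u where v: "v = x * u" "x \<in> X" "u \<in> X ^ (T + Suc s)" by (elim set_times_elim)
      then obtain w where w: "w \<in> span (X ^ T)" "u - g ^ Suc s * w \<in> span (B * X ^ (T + s))"
        using Suc.IH span_base by blast
      have "x * w \<in> span (X ^ Suc T)" using span_times[OF span_base[OF v(2)] w(1)] by simp
      also have "\<dots> \<subseteq> span (insert g B * X ^ T)" by (rule span_minimal[OF T subspace_span])
      finally obtain w' where w': "w' \<in> span (X ^ T)" "x * w - g * w' \<in> span (B * X ^ T)"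
        using span_insert_times by blast
      let ?H = "insert (g ^ Suc (Suc s)) (B * X ^ Suc s) * X ^ T"
      have "(x * w - g * w') * g ^ Suc s \<in> span (B * X ^ (T + Suc s))"
        by (rule span_times_power[OF w'(2) span_power[OF gh(1)]])
      also have "B * X ^ (T + Suc s) = B * X ^ Suc s * X ^ T" 
        by (simp add: power_add mult_ac)
      also have "span \<dots> \<subseteq> span ?H" by (intro span_mono set_times_mono2) auto
      finally have 1: "(x * w - g * w') * g ^ Suc s \<in> span ?H" .
      have "(u - g ^ Suc s * w) * x \<in> span (B * X ^ ((T + s) + 1))"
        by (rule span_times_power[OF w(2)]) (use v in \<open>simp only: power_one_right span_base\<close>)
      also have "B * X ^ ((T + s) + 1) = B * X ^ Suc s * X ^ T" 
        by (simp add: power_add mult_ac)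
      also have "span \<dots> \<subseteq> span ?H" by (intro span_mono set_times_mono2) auto
      finally have 2: "(u - g ^ Suc s * w) * x \<in> span ?H" .
      have "g ^ Suc (Suc s) * w' \<in> span ?H"
        by (intro span_times w'(1) span_base) auto
      with 1 2 have "(x * w - g * w') * g ^ Suc s + (u - g ^ Suc s * w) * x
          + g ^ Suc (Suc s) * w' \<in> span ?H" by (intro span_add)
      also have "(x * w - g * w') * g ^ Suc s + (u - g ^ Suc s * w) * x
          + g ^ Suc (Suc s) * w' = v" unfolding v by (simp add: algebra_simps)
      finally show "v \<in> span ?H" .
    qed
    then have "span (X * X ^ (T + Suc s)) \<subseteq> span (insert (g ^ Suc (Suc s)) (B * X ^ Suc s) * X ^ T)"
      by (rule span_minimal[OF _ subspace_span])
    then have "u \<in> span (insert (g ^ Suc (Suc s)) (B * X ^ Suc s) * X ^ T)"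
      using Suc.prems by auto
    from span_insert_times[OF this]
    show ?case by (simp add: power_add mult.assoc mult.commute[of "X ^ T"])
  qed
  \<comment> \<open>\<open>card (X ^ T)\<close> bounds the dimension of \<open>span (X ^ T)\<close>,
    so the \<open>n + 1\<close> cofactors of the monomials \<open>g ^ (n - i) * h ^ i\<close> are
    dependent.\<close>
  define s where "s = card (X ^ T)"
  define n where "n = T + Suc s"
  have fin: "finite (X ^ T)" by (rule finite_set_power[OF X])
  have gn: "g ^ (n - i) * h ^ i \<in> span (X ^ n)" if "i \<le> n" for i
    using that span_times[OF span_power[OF gh(1), of "n - i"] span_power[OF gh(2), of i]]
    by (simp flip: power_add)
  have "\<forall>i\<in>{..n}. \<exists>w\<in>span (X ^ T).
      g ^ (n - i) * h ^ i - g ^ Suc s * w \<in> span (B * X ^ (T + s))"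
    using red gn unfolding n_def by blast
  from bchoice[OF this[unfolded Bex_def]] obtain w where
    "\<forall>i\<in>{..n}. w i \<in> span (X ^ T) \<and>
      g ^ (n - i) * h ^ i - g ^ Suc s * w i \<in> span (B * X ^ (T + s))" ..
  then have w: "\<And>i. i \<le> n \<Longrightarrow> w i \<in> span (X ^ T)"
    "\<And>i. i \<le> n \<Longrightarrow> g ^ (n - i) * h ^ i - g ^ Suc s * w i \<in> span (B * X ^ (T + s))"
    by blast+
  have "card (X ^ T) < card {..n}" by (simp add: n_def s_def)
  then obtain c where c: "\<exists>i\<in>{..n}. c i \<noteq> 0" "(\<Sum>i\<le>n. c i *s w i) = 0"
    using dependent_family[OF fin finite_atMost, of n w] w(1) by auto
  define q where "q = (\<Sum>i\<le>n. monom (c i) i)"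
  have cq: "coeff q i = (if i \<le> n then c i else 0)" for i
    by (simp add: q_def coeff_sum)
  obtain i where "i \<le> n" "c i \<noteq> 0" using c(1) by auto
  with cq[of i] have "q \<noteq> 0" by auto
  have "degree q \<le> n" by (intro degree_le) (simp add: cq)
  have "homogenize g h n q = (\<Sum>i\<le>n. c i *s (g ^ (n - i) * h ^ i)) - g ^ Suc s * (\<Sum>i\<le>n. c i *s w i)"
    by (simp add: homogenize_def cq c(2))
  also have "\<dots> = (\<Sum>i\<le>n. c i *s (g ^ (n - i) * h ^ i - g ^ Suc s * w i))"
    by (simp add: sum_distrib_left scale_mult_right scale_right_diff_distrib sum_subtractf)
  also have "\<dots> \<in> span (B * X ^ (T + s))" by (intro span_sum span_scale w(2)) simp
  finally have hq: "homogenize g h n q \<in> span (B * X ^ (T + s))" .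
  have "saturated X B n (homogenize g h n q)"
    unfolding saturated_def
  proof (intro exI[of _ 0] ballI)
    fix y assume "y \<in> X ^ Suc 0"
    then show "y * homogenize g h n q \<in> span (B * X ^ (0 + n))"
      using span_times_power[OF hq span_base[of y "X ^ 1"]] by (simp add: n_def mult.commute)
  qed
  then have "saturated X B 0 1"
    using saturated_homogenize_cancel[OF bad gh \<open>q \<noteq> 0\<close> \<open>degree q \<le> n\<close>] by blast
  then show False using good by (auto simp: saturated_def)
qed

text \<open>Generation in degree \<open>T + 1\<close> is applied \<open>s\<close> times, each time
  trading one element of \<open>X\<close> for one of \<open>F\<close>.\<close>

lemma power_subset_span_power:
  assumes "X ^ Suc T \<subseteq> span (F * X ^ T)"
  shows "X ^ (T + s) \<subseteq> span (F ^ s * X ^ T)"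
proof (induction s)
  case (Suc s)
  have "X ^ (T + Suc s) = X * X ^ (T + s)" by simp
  also have "\<dots> \<subseteq> span (F ^ s * X ^ Suc T)"
  proof
    fix u assume "u \<in> X * X ^ (T + s)"
    then obtain x y where u: "u = x * y" "x \<in> X" "y \<in> X ^ (T + s)" by (elim set_times_elim)
    then have "u \<in> span (X * (F ^ s * X ^ T))" using Suc by (auto intro: span_times span_base)
    then show "u \<in> span (F ^ s * X ^ Suc T)" by (simp only: power_Suc mult.left_commute)
  qed
  also have "\<dots> \<subseteq> span (F ^ s * (F * X ^ T))"
    using span_times[OF span_base] assms by (intro span_minimal subspace_span) (blast elim: set_times_elim)
  also have "F ^ s * (F * X ^ T) = F ^ Suc s * X ^ T" by (simp only: power_Suc mult_ac)
  finally show ?case .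
next
  case 0
  then show ?case by (simp only: power_0 mult_1_left add_0_right span_superset)
qed

text \<open>A Hilbert function bound: if \<open>F\<close> generates degree \<open>T + 1\<close>,
  then degree \<open>T + s\<close> is spanned by \<open>F ^ s * X ^ T\<close>, and only the first
  factor grows with \<open>s\<close>.\<close>

lemma independent_power_card_le:
  assumes "finite X" "finite F" "F \<noteq> {}" and T: "X ^ Suc T \<subseteq> span (F * X ^ T)"
    and S: "independent S" "S \<subseteq> X ^ (T + s)"
  shows "card S \<le> Suc s ^ (card F - 1) * card (X ^ T)"
proof -
  have fin: "finite (F ^ s * X ^ T)" by (intro finite_set_times finite_set_power assms)
  have "S \<subseteq> span (F ^ s * X ^ T)" using S(2) power_subset_span_power[OF T] by blast
  then have "card S \<le> card (F ^ s * X ^ T)" using independent_span_bound[OF fin S(1)] by blast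
  also have "F ^ s * X ^ T = (\<lambda>(a, b). a * b) ` ((F ^ s) \<times> (X ^ T))"
    by (auto simp: set_times_def image_def)
  also have "card \<dots> \<le> card ((F ^ s) \<times> (X ^ T))"
    by (intro card_image_le finite_cartesian_product finite_set_power assms)
  also have "\<dots> \<le> Suc s ^ (card F - 1) * card (X ^ T)"
    using card_set_power[OF assms(2,3)] by (simp add: card_cartesian_product)
  finally show ?thesis .
qed

text \<open>\<open>\<chi>\<close> holds the homogeneous coordinates of a common zero of the forms in
  \<open>F\<close>. The conclusion records just the binomial quadratic relations between generators,
  because these characterize decomposable vectors.\<close>

lemma projective_zero:
  assumes X: "finite X" and F: "F \<subseteq> span X"
    and good: "\<And>t. \<not> X ^ Suc t \<subseteq> span (F * X ^ t)"
  shows "\<exists>\<chi>. (\<exists>x\<in>X. \<chi> x \<noteq> 0) \<and>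
    (\<forall>a\<in>X. \<forall>b\<in>X. \<forall>c\<in>X. \<forall>d\<in>X. a * b = c * d \<longrightarrow> \<chi> a * \<chi> b = \<chi> c * \<chi> d) \<and>
    (\<forall>\<alpha>. (\<Sum>x\<in>X. \<alpha> x *s x) \<in> F \<longrightarrow> (\<Sum>x\<in>X. \<alpha> x * \<chi> x) = 0)"
proof -
  \<comment> \<open>Independence bounds \<open>card B\<close> by \<open>card X\<close>, so that a
    set of largest cardinality exists. \<open>F\<close> is only required to lie in the span, which
    lets \<open>B\<close> start as a basis taken from \<open>F\<close>.\<close>
  define Q where "Q B \<longleftrightarrow> independent B \<and> B \<subseteq> span X \<and> F \<subseteq> span B \<and>
    (\<forall>t. \<not> X ^ Suc t \<subseteq> span (B * X ^ t))" for B
  obtain B0 where B0: "B0 \<subseteq> F" "independent B0" "F \<subseteq> span B0"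
    using maximal_independent_subset by blast
  have "span (B0 * X ^ t) \<subseteq> span (F * X ^ t)" for t
    by (intro span_mono set_times_mono2 B0 order_refl)
  then have "Q B0" using B0 F good unfolding Q_def by blast
  moreover have "\<forall>B. Q B \<longrightarrow> card B \<le> card X"
    using independent_span_bound[OF X] by (auto simp: Q_def)
  ultimately obtain B where QB: "Q B" and max: "\<And>B'. Q B' \<Longrightarrow> card B' \<le> card B"
    using ex_has_greatest_nat[of Q B0 card "Suc (card X)"] by (auto simp: less_Suc_eq_le)
  have B: "independent B" "B \<subseteq> span X" "F \<subseteq> span B"
    and goodB: "\<And>t. \<not> X ^ Suc t \<subseteq> span (B * X ^ t)"
    using QB by (auto simp: Q_def)
  have finB: "finite B" using independent_span_bound[OF X] B by blast
  have memB: "v \<in> span B" if v: "v \<in> span X" "\<And>t. \<not> X ^ Suc t \<subseteq> span (insert v B * X ^ t)" for v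
  proof (rule ccontr)
    assume nv: "v \<notin> span B"
    then have "Q (insert v B)"
      using B(2) v independent_insertI[OF nv B(1)] order_trans[OF B(3) span_mono[OF subset_insertI]]
      unfolding Q_def by simp
    from max[OF this] show False using nv span_base[of v B] finB by (auto simp: card_insert_if split: if_splits)
  qed
  obtain g where g: "g \<in> X" "g \<notin> span B"
    using goodB[of 0] by (simp only: power_Suc power_0 mult_1_right) blast
  have gX: "g \<in> span X" using g by (simp add: span_base)
  have "\<exists>c. x - c *s g \<in> span B" if x: "x \<in> X" for x
  proof -
    obtain \<alpha> \<beta> where ab: "(\<alpha>, \<beta>) \<noteq> (0, 0)"
      "\<And>t. \<not> X ^ Suc t \<subseteq> span (insert (\<alpha> *s g + \<beta> *s x) B * X ^ t)"
      using pencil_member[OF X B(2) goodB gX span_base[OF x]] by blast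
    have mem: "\<alpha> *s g + \<beta> *s x \<in> span B"
      by (rule memB[OF span_add[OF span_scale[OF gX] span_scale[OF span_base[OF x]]] ab(2)])
    have "\<beta> \<noteq> 0"
    proof
      assume "\<beta> = 0"
      then have "\<alpha> \<noteq> 0" "\<alpha> *s g \<in> span B" using ab mem by auto
      then show False using g span_scale[of "\<alpha> *s g" B "inverse \<alpha>"] by simp
    qed
    then have "x - (- \<alpha> / \<beta>) *s g = inverse \<beta> *s (\<alpha> *s g + \<beta> *s x)"
      by (simp add: scale_right_distrib divide_inverse mult.commute)
    then have "x - (- \<alpha> / \<beta>) *s g \<in> span B" using span_scale[OF mem] by simp
    then show ?thesis by blast
  qed
  then obtain \<chi> where \<chi>: "\<And>x. x \<in> X \<Longrightarrow> x - \<chi> x *s g \<in> span B"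
    using bchoice[of X "\<lambda>x c. x - c *s g \<in> span B"] by blast
  \<comment> \<open>Both factors are replaced by their components along \<open>g\<close>; modulo
    \<open>span (B * X)\<close>, multiplication becomes multiplication of coordinates.\<close>
  have prod: "a * b - (\<chi> a * \<chi> b) *s (g * g) \<in> span (B * X)" if "a \<in> X" "b \<in> X" for a b
  proof -
    have "(a - \<chi> a *s g) * b + (b - \<chi> b *s g) * (\<chi> a *s g) \<in> span (B * X)"
      by (intro span_add span_times \<chi> that span_scale gX span_base[OF that(2)])
    also have "(a - \<chi> a *s g) * b + (b - \<chi> b *s g) * (\<chi> a *s g) = a * b - (\<chi> a * \<chi> b) *s (g * g)"
      by (simp add: algebra_simps scale_mult_left scale_mult_right)
    finally show ?thesis .
  qed
  \<comment> \<open>Goodness in degree 2, beyond that in degree 1, is what makes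
    \<open>\<chi>\<close> compatible with products.\<close>
  have gg: "g * g \<notin> span (B * X)"
  proof
    assume gg: "g * g \<in> span (B * X)"
    have "a * b \<in> span (B * X)" if "a \<in> X" "b \<in> X" for a b
      using span_add[OF prod[OF that] span_scale[OF gg, of "\<chi> a * \<chi> b"]] by simp
    then have "X * X \<subseteq> span (B * X)" by (blast elim: set_times_elim)
    then have "X ^ Suc 1 \<subseteq> span (B * X ^ 1)" by (simp only: power_Suc power_one_right)
    then show False using goodB by blast
  qed
  have "\<chi> a * \<chi> b = \<chi> c * \<chi> d" if "a \<in> X" "b \<in> X" "c \<in> X" "d \<in> X" "a * b = c * d" for a b c d
  proof (rule ccontr)
    define e where "e = \<chi> a * \<chi> b - \<chi> c * \<chi> d"
    assume "\<chi> a * \<chi> b \<noteq> \<chi> c * \<chi> d"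
    then have "e \<noteq> 0" by (simp add: e_def)
    have "e *s (g * g) = (c * d - (\<chi> c * \<chi> d) *s (g * g)) - (a * b - (\<chi> a * \<chi> b) *s (g * g))"
      using that by (simp add: e_def scale_left_diff_distrib)
    also have "\<dots> \<in> span (B * X)" by (intro span_diff prod that)
    finally show False using span_scale[of "e *s (g * g)" _ "inverse e"] \<open>e \<noteq> 0\<close> gg by auto
  qed
  moreover have "(\<Sum>x\<in>X. \<alpha> x * \<chi> x) = 0" if "(\<Sum>x\<in>X. \<alpha> x *s x) \<in> F" for \<alpha>
  proof (rule ccontr)
    define e where "e = (\<Sum>x\<in>X. \<alpha> x * \<chi> x)"
    assume "(\<Sum>x\<in>X. \<alpha> x * \<chi> x) \<noteq> 0"
    then have "e \<noteq> 0" by (simp add: e_def)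
    have "e *s g = (\<Sum>x\<in>X. \<alpha> x *s x) - (\<Sum>x\<in>X. \<alpha> x *s (x - \<chi> x *s g))"
      by (simp add: e_def scale_sum_left scale_right_diff_distrib sum_subtractf)
    also have "\<dots> \<in> span B"
      using that B(3) span_sum[of X "\<lambda>x. \<alpha> x *s (x - \<chi> x *s g)" B, OF span_scale[OF \<chi>]]
      by (intro span_diff) auto
    finally show False using span_scale[of "e *s g" _ "inverse e"] \<open>e \<noteq> 0\<close> g(2) by auto
  qed
  moreover have "\<chi> g \<noteq> 0" using \<chi>[OF g(1)] g(2) by auto
  ultimately show ?thesis using g(1) by blast
qed

end

section \<open>Kronecker products of vectors\<close>

lemma nonzero_vec_index:
  assumes "x \<in> carrier_vec n" "x \<noteq> 0\<^sub>v n"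
  shows "\<exists>i<n. x $ i \<noteq> 0"
proof (rule ccontr)
  assume "\<not> ?thesis"
  then have "x = 0\<^sub>v n" using assms(1) by (intro eq_vecI) auto
  then show False using assms(2) by simp
qed

lemma dim_kron_vec [simp]: "dim_vec (x \<otimes>\<^sub>v y) = dim_vec x * dim_vec y"
  by (simp add: kron_vec_def)

lemma index_kron_vec:
  "i < dim_vec x * dim_vec y \<Longrightarrow> (x \<otimes>\<^sub>v y) $ i = x $ (i div dim_vec y) * y $ (i mod dim_vec y)"
  by (simp add: kron_vec_def)

definition one_vec :: "complex vec" where
  "one_vec = vec 1 (\<lambda>_. 1)"

lemma one_vec_simps [simp]: "dim_vec one_vec = 1" "one_vec $ 0 = 1"
  by (simp_all add: one_vec_def)

lemma kron_vecs_Nil [simp]: "kron_vecs [] = one_vec"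
  and kron_vecs_Cons [simp]: "kron_vecs (x # xs) = x \<otimes>\<^sub>v kron_vecs xs"
  by (simp_all add: kron_vecs_def one_vec_def)

lemma dim_kron_vecs [simp]: "dim_vec (kron_vecs xs) = prod_list (map dim_vec xs)"
  by (induction xs) auto

lemma div_less_prod: "c < a * b \<Longrightarrow> c div b < a" for a b c :: nat
  by (simp add: less_mult_imp_div_less)

lemma mod_less_prod: "c < a * b \<Longrightarrow> c mod b < b" for a b c :: nat
  by (cases "b = 0") auto

lemma mult_add_less: "i < a \<Longrightarrow> c < b \<Longrightarrow> i * b + c < a * b" for a b c i :: nat
proof -
  assume "i < a" "c < b"
  then have "Suc i * b \<le> a * b" by (intro mult_right_mono) auto
  then show ?thesis using \<open>c < b\<close> by simp
qed

lemma mult_add_div: "c < b \<Longrightarrow> (i * b + c) div b = i" for b c i :: nat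
  by (metis add_0_right div_less div_mult_self3 less_nat_zero_code)

text \<open>The mixed-radix digits of \<open>c\<close>, most significant digit first.\<close>

fun digits :: "nat list \<Rightarrow> nat \<Rightarrow> nat list" where
  "digits [] c = []"
| "digits (a # as) c = c div prod_list as # digits as (c mod prod_list as)"

lemma length_digits [simp]: "length (digits as c) = length as"
  by (induction as arbitrary: c) auto

lemma nth_digits_less:
  "c < prod_list as \<Longrightarrow> j < length as \<Longrightarrow> digits as c ! j < as ! j"
proof (induction as arbitrary: c j)
  case (Cons a as)
  then have "c mod prod_list as < prod_list as" by (auto intro: mod_less_prod)
  with Cons show ?case by (cases j) (auto simp: div_less_prod)
qed simp

lemma digits_surj:
  assumes "length is = length as" "\<And>j. j < length as \<Longrightarrow> is ! j < as ! j"
  shows "\<exists>c<prod_list as. digits as c = is"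
  using assms
proof (induction as arbitrary: "is")
  case (Cons a as)
  then obtain i js where i: "is = i # js" by (cases "is") auto
  have "\<exists>c<prod_list as. digits as c = js"
    using Cons.prems unfolding i by (intro Cons.IH) fastforce+
  then obtain c where c: "c < prod_list as" "digits as c = js" by blast
  have "i < a" using Cons.prems(2)[of 0] i by simp
  then have "i * prod_list as + c < a * prod_list as" using c(1) by (rule mult_add_less)
  then show ?case using c i by (intro exI[of _ "i * prod_list as + c"]) (simp add: mult_add_div)
qed simp

lemma digits_inj:
  "c < prod_list as \<Longrightarrow> d < prod_list as \<Longrightarrow> digits as c = digits as d \<Longrightarrow> c = d"
proof (induction as arbitrary: c d)
  case (Cons a as)
  then have "c mod prod_list as = d mod prod_list as"
    by (intro Cons.IH) (auto intro: mod_less_prod)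
  then show ?case using Cons.prems by (metis digits.simps(2) list.inject div_mult_mod_eq)
qed simp

lemma index_kron_vecs:
  "c < prod_list (map dim_vec xs) \<Longrightarrow>
    kron_vecs xs $ c = (\<Prod>j<length xs. xs ! j $ (digits (map dim_vec xs) c ! j))"
proof (induction xs arbitrary: c)
  case (Cons x xs)
  then have "c mod prod_list (map dim_vec xs) < prod_list (map dim_vec xs)"
    by (auto intro: mod_less_prod)
  from Cons.IH[OF this] Cons.prems show ?case
    by (simp add: index_kron_vec prod.lessThan_Suc_shift del: prod.lessThan_Suc)
qed simp

section \<open>Decomposable vectors in the kernel of a matrix\<close>

text \<open>The monoid algebra of \<open>'k\<close>. For multisets it is a polynomial ring, and the
  Segre ring is the subalgebra generated by the elements \<open>segre_coord I\<close>.\<close>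

interpretation poly_mapping: complex_algebra
  "\<lambda>c (p :: 'k::comm_monoid_add \<Rightarrow>\<^sub>0 complex). Poly_Mapping.single 0 c * p"
  by unfold_locales
    (simp_all add: algebra_simps single_add mult_single flip: mult.assoc)

lemma single_one_eq_iff: "Poly_Mapping.single k (1 :: complex) = Poly_Mapping.single l 1 \<longleftrightarrow> k = l"
  by (metis lookup_single_eq lookup_single_not_eq zero_neq_one)

lemma independent_single:
  fixes S :: "'k::comm_monoid_add set"
  assumes "finite S"
  shows "poly_mapping.independent ((\<lambda>k. Poly_Mapping.single k 1) ` S)"
proof
  let ?f = "\<lambda>k::'k. Poly_Mapping.single k (1 :: complex)"
  have inj: "inj_on ?f S"
    by (rule inj_onI) (simp add: single_one_eq_iff)
  assume "poly_mapping.dependent (?f ` S)"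
  then obtain u where u: "\<exists>v\<in>?f ` S. u v \<noteq> 0"
    "(\<Sum>v\<in>?f ` S. Poly_Mapping.single 0 (u v) * v) = 0"
    using poly_mapping.dependent_finite[of "?f ` S"] assms by auto
  have "(\<Sum>k\<in>S. Poly_Mapping.single k (u (?f k))) = 0"
    using u(2) inj by (simp add: sum.reindex mult_single)
  then have "Poly_Mapping.lookup (\<Sum>k\<in>S. Poly_Mapping.single k (u (?f k))) l = 0" for l by simp
  then have "(\<Sum>k\<in>S. u (?f k) when k = l) = 0" for l
    by (simp add: lookup_sum lookup_single)
  moreover have "(\<Sum>k\<in>S. u (?f k) when k = l) = u (?f l)" if "l \<in> S" for l
    using assms that by (simp add: when_def sum.delta' sum.delta)
  ultimately show False using u(1) by auto
qed

section \<open>Monomials in the coordinate ring of the Segre variety\<close>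

type_synonym mono = "(nat \<times> nat) multiset"

text \<open>The pair \<open>(j, i)\<close> is the variable for the \<open>i\<close>-th coordinate of
  the \<open>j\<close>-th tensor factor; \<open>E j\<close> collects the variables of that factor
  with multiplicity.\<close>

definition segre_monomial :: "nat \<Rightarrow> (nat \<Rightarrow> nat multiset) \<Rightarrow> mono \<Rightarrow>\<^sub>0 complex" where
  "segre_monomial r E = Poly_Mapping.single (\<Sum>j<r. image_mset (Pair j) (E j)) 1"

lemma count_sum_Pair:
  fixes j r :: nat
  assumes "j < r"
  shows "count (\<Sum>j<r. image_mset (Pair j) (E j)) (j, i) = count (E j) i"
proof -
  have "count (image_mset (Pair l) (E l)) (j, i) = (if l = j then count (E j) i else 0)" for l
  proof -
    have "count (image_mset (Pair l) A) (j, i) = (if l = j then count A i else 0)" for A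
      by (induction A) auto
    then show ?thesis by auto
  qed
  then show ?thesis using assms by (simp add: count_sum)
qed

lemma segre_monomial_eqD:
  "segre_monomial r E = segre_monomial r E' \<Longrightarrow> j < r \<Longrightarrow> E j = E' j"
proof (rule multiset_eqI)
  fix i assume "segre_monomial r E = segre_monomial r E'" "j < r"
  then have "(\<Sum>j<r. image_mset (Pair j) (E j)) = (\<Sum>j<r. image_mset (Pair j) (E' j))"
    unfolding segre_monomial_def by (simp add: single_one_eq_iff)
  then have "count (\<Sum>j<r. image_mset (Pair j) (E j)) (j, i)
      = count (\<Sum>j<r. image_mset (Pair j) (E' j)) (j, i)" by (simp only:)
  then show "count (E j) i = count (E' j) i" by (simp only: count_sum_Pair[OF \<open>j < r\<close>])
qed

lemma segre_monomial_mult: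
  "segre_monomial r E * segre_monomial r E' = segre_monomial r (\<lambda>j. E j + E' j)"
  by (simp add: segre_monomial_def mult_single sum.distrib)

lemma segre_monomial_cong:
  "(\<And>j. j < r \<Longrightarrow> E j = E' j) \<Longrightarrow> segre_monomial r E = segre_monomial r E'"
  unfolding segre_monomial_def by (intro arg_cong2[of _ _ _ _ Poly_Mapping.single] sum.cong) auto

abbreviation segre_coord :: "nat list \<Rightarrow> mono \<Rightarrow>\<^sub>0 complex" where
  "segre_coord I \<equiv> segre_monomial (length I) (\<lambda>j. {#I ! j#})"

definition index_tuples :: "nat list \<Rightarrow> nat list set" where
  "index_tuples as = {I. length I = length as \<and> (\<forall>j<length as. I ! j < as ! j)}"

lemma index_tuples_eq: "index_tuples as = digits as ` {..<prod_list as}"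
  using digits_surj[of _ as] nth_digits_less[of _ as]
  by (force simp: index_tuples_def image_iff)

text \<open>Removing one variable from every factor splits off one Segre coordinate, which is
  possible \<open>t\<close> times because all factors have the same degree \<open>t\<close>.\<close>

lemma segre_monomial_in_power:
  assumes "\<And>j. j < length as \<Longrightarrow> size (E j) = t \<and> set_mset (E j) \<subseteq> {..<as ! j}"
  shows "segre_monomial (length as) E \<in> (segre_coord ` index_tuples as) ^ t"
  using assms
proof (induction t arbitrary: E)
  case 0
  then have "segre_monomial (length as) E = 1" by (simp add: segre_monomial_def)
  then show ?case by simp
next
  case (Suc t)
  have "\<exists>i E'. j < length as \<longrightarrow> E j = add_mset i E'" for j
    using Suc.prems[of j] by (metis size_eq_Suc_imp_eq_union)
  then have "\<forall>j. \<exists>p. j < length as \<longrightarrow> E j = add_mset (fst p) (snd p)" by simp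
  from choice[OF this] obtain p where "\<forall>j. j < length as \<longrightarrow> E j = add_mset (fst (p j)) (snd (p j))" ..
  then obtain f E' where E: "\<And>j. j < length as \<Longrightarrow> E j = add_mset (f j) (E' j)"
    by (intro that[of "fst \<circ> p" "snd \<circ> p"]) simp
  let ?I = "map f [0..<length as]"
  have "segre_monomial (length as) E' \<in> (segre_coord ` index_tuples as) ^ t"
    using Suc.prems E by (intro Suc.IH) auto
  moreover have "?I \<in> index_tuples as"
    using Suc.prems E by (auto simp: index_tuples_def)
  ultimately have "segre_coord ?I * segre_monomial (length as) E'
      \<in> (segre_coord ` index_tuples as) ^ Suc t"
    unfolding power_Suc by (intro set_times_intro imageI)
  also have "segre_coord ?I * segre_monomial (length as) E' = segre_monomial (length as) E"
    by (simp add: segre_monomial_mult) (rule segre_monomial_cong, simp add: E)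
  finally show ?case .
qed

text \<open>There are \<open>D\<close> variables with coordinate index at least 1. Their exponents
  are chosen freely in \<open>{..s}\<close>, and the variable with index 0 fills each factor up to
  degree \<open>D * s\<close>. This degree is large enough for all factors, as the free exponents of
  factor \<open>j\<close> sum to at most \<open>(as ! j - 1) * s\<close>.\<close>

lemma many_independent_monomials:
  fixes as :: "nat list"
  assumes "\<forall>a\<in>set as. 0 < a"
  defines "D \<equiv> (\<Sum>j<length as. as ! j - 1)"
  shows "\<exists>S \<subseteq> (segre_coord ` index_tuples as) ^ (D * s).
    poly_mapping.independent S \<and> card S = Suc s ^ D"
proof -
  define r where "r = length as"
  define V where "V = (SIGMA j:{..<r}. {1..<as ! j})"
  have V: "finite V" "card V = D" by (simp_all add: V_def D_def r_def)
  define E where "E e j = (\<Sum>i\<in>{1..<as ! j}. replicate_mset (e (j, i)) i) +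
    replicate_mset (D * s - (\<Sum>i\<in>{1..<as ! j}. e (j, i))) 0" for e :: "nat \<times> nat \<Rightarrow> nat" and j
  let ?P = "PiE V (\<lambda>_. {..s})"
  let ?m = "\<lambda>e. segre_monomial r (E e)"
  have cE: "count (E e j) i = e (j, i)" if "(j, i) \<in> V" for e j i
  proof -
    have "(\<Sum>l = Suc 0..<as ! j. if i = l then e (j, l) else 0) = e (j, i)"
      using that by (auto simp: V_def)
    then show ?thesis using that by (simp add: E_def count_sum V_def)
  qed
  have inj: "inj_on (\<lambda>e. (\<Sum>j<r. image_mset (Pair j) (E e j))) ?P"
  proof (rule inj_onI)
    fix e e' assume e: "e \<in> ?P" "e' \<in> ?P"
      "(\<Sum>j<r. image_mset (Pair j) (E e j)) = (\<Sum>j<r. image_mset (Pair j) (E e' j))"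
    have "e (j, i) = e' (j, i)" if "(j, i) \<in> V" for j i
    proof -
      have "j < r" using that by (simp add: V_def)
      have "count (E e j) i = count (E e' j) i"
        using e(3) by (simp flip: count_sum_Pair[OF \<open>j < r\<close>])
      then show ?thesis using cE[OF that] by simp
    qed
    then show "e = e'" using e(1,2) by (intro PiE_ext) auto
  qed
  define S where "S = ?m ` ?P"
  have S_alt: "S = (\<lambda>k. Poly_Mapping.single k 1) ` (\<lambda>e. (\<Sum>j<r. image_mset (Pair j) (E e j))) ` ?P"
    by (simp add: S_def segre_monomial_def image_image)
  have finP: "finite ?P" using V by (intro finite_PiE) auto
  have "poly_mapping.independent S"
    unfolding S_alt using finP by (intro independent_single finite_imageI)
  moreover have "card S = Suc s ^ D"
  proof -
    have "inj (\<lambda>k::mono. Poly_Mapping.single k (1::complex))"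
      by (rule injI) (simp add: single_one_eq_iff)
    then have "card S = card ?P"
      unfolding S_alt by (simp add: card_image inj_on_subset[of _ UNIV] inj)
    also have "\<dots> = Suc s ^ D" using V by (simp add: card_PiE)
    finally show ?thesis .
  qed
  moreover have "S \<subseteq> (segre_coord ` index_tuples as) ^ (D * s)"
  proof
    fix x assume "x \<in> S"
    then obtain e where e: "e \<in> ?P" "x = ?m e" by (auto simp: S_def)
    show "x \<in> (segre_coord ` index_tuples as) ^ (D * s)"
      unfolding e(2) r_def
    proof (intro segre_monomial_in_power conjI)
      fix j assume j: "j < length as"
      have "(\<Sum>i\<in>{1..<as ! j}. e (j, i)) \<le> (\<Sum>i\<in>{1..<as ! j}. s)"
        using e(1) j by (intro sum_mono) (auto simp: PiE_def Pi_def V_def r_def)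
      also have "\<dots> \<le> D * s"
        using j by (auto simp: D_def intro!: mult_right_mono member_le_sum)
      finally show "size (E e j) = D * s" by (simp add: E_def size_multiset_sum)
      show "set_mset (E e j) \<subseteq> {..<as ! j}"
        using assms(1) j nth_mem[OF j] by (auto simp: E_def set_mset_sum split: if_splits)
    qed
  qed
  ultimately show ?thesis by blast
qed

lemma segre_coord_exchange:
  assumes "length I = r" "length J = r" "length I' = r" "length J' = r"
    and "\<And>j. j < r \<Longrightarrow> {#I ! j#} + {#J ! j#} = {#I' ! j#} + {#J' ! j#}"
  shows "segre_coord I * segre_coord J = segre_coord I' * segre_coord J'"
  using assms(5) by (simp add: assms(1-4) segre_monomial_mult) (rule segre_monomial_cong, simp)

text \<open>Swapping the entries of two index tuples at one position does not change the product of
  their coordinates. Passing from \<open>I0\<close> to \<open>I\<close> one position at a time, each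
  step therefore contributes a ratio that depends on this position alone, so \<open>\<psi>\<close>
  is a multiple of a decomposable vector.\<close>

lemma segre_point:
  assumes exch: "\<And>I J I' J'. \<lbrakk>I \<in> index_tuples as; J \<in> index_tuples as; I' \<in> index_tuples as;
      J' \<in> index_tuples as; segre_coord I * segre_coord J = segre_coord I' * segre_coord J'\<rbrakk>
      \<Longrightarrow> \<psi> I * \<psi> J = \<psi> I' * (\<psi> J' :: complex)"
    and I0: "I0 \<in> index_tuples as" "\<psi> I0 \<noteq> 0" and I: "I \<in> index_tuples as"
  shows "\<psi> I = \<psi> I0 * (\<Prod>j<length as. \<psi> (I0[j := I ! j]) / \<psi> I0)"
proof -
  have len: "length I = length as" "length I0 = length as"
    using I I0 by (auto simp: index_tuples_def)
  have "\<psi> (take l I @ drop l I0) = \<psi> I0 * (\<Prod>j<l. \<psi> (I0[j := I ! j]) / \<psi> I0)" if "l \<le> length as" for l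
    using that
  proof (induction l)
    case (Suc l)
    have "\<psi> (take (Suc l) I @ drop (Suc l) I0) * \<psi> I0 = \<psi> (take l I @ drop l I0) * \<psi> (I0[l := I ! l])"
    proof (rule exch)
      show "segre_coord (take (Suc l) I @ drop (Suc l) I0) * segre_coord I0 =
          segre_coord (take l I @ drop l I0) * segre_coord (I0[l := I ! l])"
        using Suc.prems len
        by (intro segre_coord_exchange[of _ "length as"])
          (auto simp: nth_append nth_list_update less_Suc_eq add_mset_commute)
    qed (use I I0 Suc.prems len in \<open>auto simp: index_tuples_def nth_append nth_list_update\<close>)
    with Suc I0(2) show ?case by (simp add: field_simps)
  qed simp
  from this[of "length as"] show ?thesis by (simp add: len)
qed

text \<open>The rows of \<open>M\<close> are read as linear forms in the Segre coordinates; their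
  common zero comes from \<open>projective_zero\<close> and is decomposable by
  \<open>segre_point\<close>.\<close>

theorem decomposable_kernel_vector:
  assumes pos: "\<forall>a\<in>set as. 0 < a" and M: "M \<in> carrier_mat m (prod_list as)"
    and m: "0 < m" "m \<le> (\<Sum>j<length as. as ! j - 1)"
  shows "\<exists>xs. map dim_vec xs = as \<and> kron_vecs xs \<noteq> 0\<^sub>v (prod_list as) \<and> M *\<^sub>v kron_vecs xs = 0\<^sub>v m"
proof -
  define L where "L = prod_list as"
  define D where "D = (\<Sum>j<length as. as ! j - 1)"
  define X where "X = segre_coord ` index_tuples as"
  let ?x = "\<lambda>c. segre_coord (digits as c)"
  define f where "f q = (\<Sum>c<L. Poly_Mapping.single 0 (M $$ (q, c)) * ?x c)" for q
  define F where "F = f ` {..<m}"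
  have X_alt: "X = ?x ` {..<L}" by (simp add: X_def index_tuples_eq image_image L_def)
  have inj: "inj_on ?x {..<L}"
  proof (rule inj_onI)
    fix c d assume cd: "c \<in> {..<L}" "d \<in> {..<L}" "?x c = ?x d"
    have "digits as c ! j = digits as d ! j" if "j < length as" for j
      using segre_monomial_eqD[of "length as" "\<lambda>j. {#digits as c ! j#}" "\<lambda>j. {#digits as d ! j#}" j] cd(3) that
      by simp
    then show "c = d" using cd by (intro digits_inj[of c as d] nth_equalityI) (auto simp: L_def)
  qed
  have finX: "finite X" by (simp add: X_alt)
  have F: "finite F" "F \<noteq> {}" "card F \<le> m"
    using m card_image_le[of "{..<m}" f] by (auto simp: F_def)
  have FX: "F \<subseteq> poly_mapping.span X"
    unfolding F_def f_def X_alt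
    by (auto intro!: poly_mapping.span_sum poly_mapping.span_scale intro: poly_mapping.span_base)
  have good: "\<not> X ^ Suc T \<subseteq> poly_mapping.span (F * X ^ T)" for T
  proof
    assume T: "X ^ Suc T \<subseteq> poly_mapping.span (F * X ^ T)"
    \<comment> \<open>The two growth estimates give \<open>Suc s \<le> C\<close> as soon as
      \<open>T \<le> D * s\<close>. The choice \<open>s = T + C\<close> meets this condition and
      contradicts the estimate.\<close>
    define C where "C = D ^ (m - 1) * card (X ^ T)"
    define s where "s = T + C"
    have D: "0 < D" "m \<le> D" using m by (simp_all add: D_def)
    have "s \<le> D * s" using D by simp
    moreover have "T \<le> s" by (simp add: s_def)
    ultimately have "T \<le> D * s" by (rule order_trans[rotated])
    obtain S where S: "S \<subseteq> X ^ (D * s)" "poly_mapping.independent S" "card S = Suc s ^ D"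
      using many_independent_monomials[OF pos, of s] unfolding X_def D_def by blast
    have "Suc s ^ (m - 1) * Suc s = Suc s ^ m" using m by (metis Suc_pred' power_Suc2)
    also have "\<dots> \<le> Suc s ^ D" using D by (intro power_increasing) auto
    also have "\<dots> \<le> Suc (D * s - T) ^ (card F - 1) * card (X ^ T)"
      using poly_mapping.independent_power_card_le[OF finX F(1,2) T S(2), of "D * s - T"] S \<open>T \<le> D * s\<close>
      by simp
    also have "\<dots> \<le> (D * Suc s) ^ (m - 1) * card (X ^ T)"
    proof (intro mult_right_mono)
      have "Suc (D * s - T) ^ (card F - 1) \<le> Suc (D * s - T) ^ (m - 1)"
        using F by (intro power_increasing) auto
      also have "\<dots> \<le> (D * Suc s) ^ (m - 1)" using D by (intro power_mono) auto
      finally show "Suc (D * s - T) ^ (card F - 1) \<le> (D * Suc s) ^ (m - 1)" .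
    qed simp
    also have "\<dots> = Suc s ^ (m - 1) * C" unfolding C_def power_mult_distrib by (simp only: mult_ac)
    finally have "Suc s \<le> C" by (simp only: mult_le_cancel1) simp
    then show False by (simp add: s_def)
  qed
  obtain \<chi> where \<chi>: "\<exists>x\<in>X. \<chi> x \<noteq> 0"
    "\<And>a b c d. \<lbrakk>a \<in> X; b \<in> X; c \<in> X; d \<in> X; a * b = c * d\<rbrakk> \<Longrightarrow> \<chi> a * \<chi> b = \<chi> c * (\<chi> d :: complex)"
    "\<And>\<alpha>. (\<Sum>x\<in>X. Poly_Mapping.single 0 (\<alpha> x) * x) \<in> F \<Longrightarrow> (\<Sum>x\<in>X. \<alpha> x * \<chi> x) = 0"
    using poly_mapping.projective_zero[OF finX FX good] by blast
  define \<psi> where "\<psi> = \<chi> \<circ> segre_coord"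
  obtain I0 where I0: "I0 \<in> index_tuples as" "\<psi> I0 \<noteq> 0"
    using \<chi>(1) by (auto simp: X_def \<psi>_def)
  define v where "v j = vec (as ! j) (\<lambda>i. \<psi> (I0[j := i]) / \<psi> I0)" for j
  define xs where "xs = map v [0..<length as]"
  have dims: "map dim_vec xs = as" by (intro nth_equalityI) (auto simp: xs_def v_def)
  have len: "length xs = length as" by (simp add: xs_def)
  have \<psi>: "\<psi> (digits as c) = \<psi> I0 * kron_vecs xs $ c" if c: "c < L" for c
  proof -
    have "digits as c \<in> index_tuples as" using c by (simp add: index_tuples_eq L_def)
    then have "\<psi> (digits as c) = \<psi> I0 * (\<Prod>j<length as. \<psi> (I0[j := digits as c ! j]) / \<psi> I0)"
      using \<chi>(2) I0 by (intro segre_point) (auto simp: \<psi>_def X_def)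
    also have "(\<Prod>j<length as. \<psi> (I0[j := digits as c ! j]) / \<psi> I0)
        = (\<Prod>j<length as. xs ! j $ (digits as c ! j))"
      using c by (intro prod.cong) (auto simp: xs_def v_def nth_digits_less L_def)
    also have "\<dots> = kron_vecs xs $ c" using c by (simp add: index_kron_vecs dims len L_def)
    finally show ?thesis .
  qed
  have "M *\<^sub>v kron_vecs xs = 0\<^sub>v m"
  proof (rule eq_vecI)
    fix q assume "q < dim_vec (0\<^sub>v m)"
    then have q: "q < m" by simp
    \<comment> \<open>\<open>projective_zero\<close> takes coefficients indexed by ring elements;
      since the coordinates are pairwise distinct, the column can be recovered from the
      element.\<close>
    define \<alpha> where "\<alpha> x = M $$ (q, inv_into {..<L} ?x x)" for x
    have \<alpha>: "\<alpha> (?x c) = M $$ (q, c)" if "c < L" for c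
      using that inv_into_f_f[OF inj, of c] by (simp add: \<alpha>_def)
    have "(\<Sum>x\<in>X. Poly_Mapping.single 0 (\<alpha> x) * x) = f q"
      unfolding X_alt sum.reindex[OF inj] f_def by (intro sum.cong) (simp_all add: \<alpha>[simplified])
    then have "(\<Sum>x\<in>X. \<alpha> x * \<chi> x) = 0" using q by (intro \<chi>(3)) (simp add: F_def)
    then have "(\<Sum>c<L. M $$ (q, c) * \<psi> (digits as c)) = 0"
      unfolding X_alt sum.reindex[OF inj] by (simp add: \<alpha>[simplified] \<psi>_def)
    then have "\<psi> I0 * (\<Sum>c<L. M $$ (q, c) * kron_vecs xs $ c) = 0"
      by (simp add: \<psi> sum_distrib_left mult_ac)
    then have "(\<Sum>c<L. M $$ (q, c) * kron_vecs xs $ c) = 0" using I0 by simp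
    then show "(M *\<^sub>v kron_vecs xs) $ q = 0\<^sub>v m $ q"
      using q M by (simp add: scalar_prod_def dims L_def atLeast0LessThan)
  qed (use M in simp)
  moreover have "kron_vecs xs \<noteq> 0\<^sub>v (prod_list as)"
  proof -
    obtain c where c: "c < L" "digits as c = I0"
      using I0(1) by (auto simp: index_tuples_eq L_def)
    then have "kron_vecs xs $ c = 1" using \<psi>[OF c(1)] I0(2) by simp
    then show ?thesis using c by (auto simp: L_def)
  qed
  ultimately show ?thesis using dims by blast
qed

section \<open>Multilinear maps into the matrices of rank one\<close>

text \<open>Equality of the column directions, and of the row directions, of two matrices of rank at most
  one, in the form of an identity between entries.\<close>

definition same_cols :: "('p \<Rightarrow> 'q \<Rightarrow> complex) \<Rightarrow> ('p \<Rightarrow> 'q \<Rightarrow> complex) \<Rightarrow> bool" where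
  "same_cols A B \<longleftrightarrow> (\<forall>p q p' q'. A p q * B p' q' = A p' q * B p q')"

definition same_rows :: "('p \<Rightarrow> 'q \<Rightarrow> complex) \<Rightarrow> ('p \<Rightarrow> 'q \<Rightarrow> complex) \<Rightarrow> bool" where
  "same_rows A B \<longleftrightarrow> (\<forall>p q p' q'. A p q * B p' q' = A p q' * B p' q)"

text \<open>\<open>same_cols A A\<close> is the vanishing of all 2-by-2 minors. Indices range over
  whole types, so that no dimensions have to be carried along.\<close>

definition rank_one :: "('p \<Rightarrow> 'q \<Rightarrow> complex) \<Rightarrow> bool" where
  "rank_one A \<longleftrightarrow> same_cols A A \<and> (\<exists>p q. A p q \<noteq> 0)"

lemma rank_one_dyad:
  "rank_one A \<longleftrightarrow> (\<exists>g h. (\<exists>p. g p \<noteq> 0) \<and> (\<exists>q. h q \<noteq> 0) \<and> A = (\<lambda>p q. g p * h q))"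
proof
  assume "rank_one A"
  then obtain p0 q0 where 0: "A p0 q0 \<noteq> 0" and m: "\<And>p q p' q'. A p q * A p' q' = A p' q * A p q'"
    unfolding rank_one_def same_cols_def by blast
  have "A = (\<lambda>p q. A p q0 * (A p0 q / A p0 q0))"
  proof (intro ext)
    fix p q
    show "A p q = A p q0 * (A p0 q / A p0 q0)"
      using 0 m[of p q p0 q0] by (simp add: nonzero_eq_divide_eq mult.commute)
  qed
  then show "\<exists>g h. (\<exists>p. g p \<noteq> 0) \<and> (\<exists>q. h q \<noteq> 0) \<and> A = (\<lambda>p q. g p * h q)"
    using 0 by (intro exI[of _ "\<lambda>p. A p q0"] exI[of _ "\<lambda>q. A p0 q / A p0 q0"]) auto
qed (auto simp: rank_one_def same_cols_def)

lemma same_cols_dyad: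
  assumes "h q0 \<noteq> 0" "h' q1 \<noteq> 0"
  shows "same_cols (\<lambda>p q. g p * h q) (\<lambda>p q. g' p * h' q) \<longleftrightarrow> (\<forall>p p'. g p * g' p' = g p' * g' p)"
proof
  assume *: "same_cols (\<lambda>p q. g p * h q) (\<lambda>p q. g' p * h' q)"
  show "\<forall>p p'. g p * g' p' = g p' * g' p"
  proof (intro allI)
    fix p p'
    have "(g p * h q0) * (g' p' * h' q1) = (g p' * h q0) * (g' p * h' q1)"
      using * unfolding same_cols_def by blast
    then have "(h q0 * h' q1) * (g p * g' p') = (h q0 * h' q1) * (g p' * g' p)"
      by (simp add: mult_ac)
    then show "g p * g' p' = g p' * g' p" using assms by simp
  qed
next
  assume *: "\<forall>p p'. g p * g' p' = g p' * g' p"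
  have "(g p * h q) * (g' p' * h' q') = (g p' * h q) * (g' p * h' q')" for p q p' q'
  proof -
    have "(g p * h q) * (g' p' * h' q') = (g p * g' p') * (h q * h' q')" by (simp add: mult_ac)
    also have "\<dots> = (g p' * g' p) * (h q * h' q')" using *[rule_format, of p p'] by simp
    finally show ?thesis by (simp add: mult_ac)
  qed
  then show "same_cols (\<lambda>p q. g p * h q) (\<lambda>p q. g' p * h' q)" unfolding same_cols_def by blast
qed

lemma same_rows_transpose: "same_rows A B \<longleftrightarrow> same_cols (\<lambda>q p. A p q) (\<lambda>q p. B p q)"
  unfolding same_rows_def same_cols_def by blast

lemma rank_one_transpose: "rank_one (\<lambda>q p. A p q) \<longleftrightarrow> rank_one A"
proof -
  have "same_cols (\<lambda>q p. A p q) (\<lambda>q p. A p q) \<longleftrightarrow> same_cols A A"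
  proof
    assume *: "same_cols (\<lambda>q p. A p q) (\<lambda>q p. A p q)"
    show "same_cols A A" unfolding same_cols_def
    proof (intro allI)
      fix p q p' q'
      have "A p q * A p' q' = A p q' * A p' q" using * unfolding same_cols_def by blast
      then show "A p q * A p' q' = A p' q * A p q'" by (simp only: mult.commute)
    qed
  next
    assume *: "same_cols A A"
    show "same_cols (\<lambda>q p. A p q) (\<lambda>q p. A p q)" unfolding same_cols_def
    proof (intro allI)
      fix p q p' q'
      have "A p q * A p' q' = A p' q * A p q'" using * unfolding same_cols_def by blast
      then show "A p q * A p' q' = A p q' * A p' q" by (simp only: mult.commute)
    qed
  qed
  then show ?thesis unfolding rank_one_def by blast
qed

lemma same_cols_sym: "same_cols A B \<Longrightarrow> same_cols B A"
  unfolding same_cols_def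
proof (intro allI)
  fix p q p' q'
  assume "\<forall>p q p' q'. A p q * B p' q' = A p' q * B p q'"
  then have "A p' q' * B p q = A p q' * B p' q" by blast
  then show "B p q * A p' q' = B p' q * A p q'" by (simp only: mult.commute)
qed

lemma same_rows_sym: "same_rows A B \<Longrightarrow> same_rows B A"
  by (simp add: same_rows_transpose same_cols_sym)

text \<open>Proportionality is not transitive through the zero vector; the nonzero entry
  \<open>b r\<close> is what gets cancelled.\<close>

lemma proportional_trans:
  fixes a b c :: "'p \<Rightarrow> complex"
  assumes "\<And>p p'. a p * b p' = a p' * b p" "\<And>p p'. b p * c p' = b p' * c p" "b r \<noteq> 0"
  shows "a p * c p' = a p' * c p"
proof -
  have "b r * b r * (a p * c p') = (a p * b r) * (b r * c p')" by (simp add: mult_ac)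
  also have "\<dots> = (a r * b p) * (b p' * c r)" by (simp only: assms(1)[of p r] assms(2)[of r p'])
  also have "\<dots> = (a r * b p') * (b p * c r)" by (simp add: mult_ac)
  also have "\<dots> = (a p' * b r) * (b r * c p)" by (simp only: assms(1)[of p' r] assms(2)[of r p])
  also have "\<dots> = b r * b r * (a p' * c p)" by (simp add: mult_ac)
  finally show ?thesis using assms(3) by simp
qed

lemma same_cols_trans:
  assumes "same_cols A B" "same_cols B C" "rank_one A" "rank_one B" "rank_one C"
  shows "same_cols A C"
proof -
  obtain a a' qa where a: "A = (\<lambda>p q. a p * a' q)" "a' qa \<noteq> 0"
    using assms(3) unfolding rank_one_dyad by blast
  obtain b b' qb pb where b: "B = (\<lambda>p q. b p * b' q)" "b' qb \<noteq> 0" "b pb \<noteq> 0"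
    using assms(4) unfolding rank_one_dyad by blast
  obtain c c' qc where c: "C = (\<lambda>p q. c p * c' q)" "c' qc \<noteq> 0"
    using assms(5) unfolding rank_one_dyad by blast
  have "\<forall>p p'. a p * b p' = a p' * b p" "\<forall>p p'. b p * c p' = b p' * c p"
    using assms(1,2) unfolding a(1) b(1) c(1)
    using same_cols_dyad[of a' qa b' qb a b, OF a(2) b(2)]
      same_cols_dyad[of b' qb c' qc b c, OF b(2) c(2)] by blast+
  then have "\<forall>p p'. a p * c p' = a p' * c p"
    using proportional_trans[of a b c pb] b(3) by blast
  then show ?thesis
    unfolding a(1) c(1) using same_cols_dyad[of a' qa c' qc a c, OF a(2) c(2)] by blast
qed

lemma same_rows_trans:
  assumes "same_rows A B" "same_rows B C" "rank_one A" "rank_one B" "rank_one C"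
  shows "same_rows A C"
  using same_cols_trans[of "\<lambda>q p. A p q" "\<lambda>q p. B p q" "\<lambda>q p. C p q"] assms
  by (simp only: same_rows_transpose rank_one_transpose[of A] rank_one_transpose[of B]
      rank_one_transpose[of C])

text \<open>Every 2-by-2 minor of \<open>g h\<^sup>T + g' h'\<^sup>T\<close> is a 2-by-2 minor of \<open>[g g']\<close> times one
  of \<open>[h h']\<close>.\<close>

lemma same_cols_or_same_rows:
  assumes A: "rank_one A" and B: "rank_one B" and AB: "same_cols (\<lambda>p q. A p q + B p q) (\<lambda>p q. A p q + B p q)"
  shows "same_cols A B \<or> same_rows A B"
proof (rule disjCI)
  obtain a a' where a: "A = (\<lambda>p q. a p * a' q)" using A unfolding rank_one_dyad by blast
  obtain b b' where b: "B = (\<lambda>p q. b p * b' q)" using B unfolding rank_one_dyad by blast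
  assume "\<not> same_rows A B"
  then obtain p q p' q' where "A p q * B p' q' \<noteq> A p q' * B p' q" unfolding same_rows_def by blast
  then have "(a p * b p') * (a' q * b' q' - a' q' * b' q) \<noteq> 0"
    unfolding a b by (simp add: algebra_simps)
  then have ne: "a' q * b' q' - a' q' * b' q \<noteq> 0" by simp
  have "a r * b r' = a r' * b r" for r r'
  proof -
    have "(A r q + B r q) * (A r' q' + B r' q') = (A r' q + B r' q) * (A r q' + B r q')"
      using AB unfolding same_cols_def by blast
    then have "(a r * b r' - a r' * b r) * (a' q * b' q' - a' q' * b' q) = 0"
      unfolding a b by (simp add: algebra_simps)
    then show ?thesis using ne by simp
  qed
  note prp = this
  show "same_cols A B"
    unfolding same_cols_def a b
  proof (intro allI)
    fix p q p' q'
    have "a p * a' q * (b p' * b' q') = (a p * b p') * (a' q * b' q')" by (simp add: mult_ac)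
    also have "\<dots> = (a p' * b p) * (a' q * b' q')" by (simp only: prp[of p p'])
    also have "\<dots> = a p' * a' q * (b p * b' q')" by (simp add: mult_ac)
    finally show "a p * a' q * (b p' * b' q') = a p' * a' q * (b p * b' q')" .
  qed
qed

lemma same_cols_and_same_rows:
  assumes "rank_one A" "rank_one B" "same_cols A B" "same_rows A B"
  shows "\<exists>c. \<forall>p q. A p q = c * B p q"
proof -
  obtain p0 q0 where 0: "B p0 q0 \<noteq> 0" using assms(2) unfolding rank_one_def by blast
  have "A p q * B p0 q0 = A p0 q0 * B p q" for p q
  proof -
    have "A p q * B p0 q0 = A p0 q * B p q0" using assms(3) unfolding same_cols_def by blast
    also have "\<dots> = A p0 q0 * B p q" using assms(4) unfolding same_rows_def by blast
    finally show ?thesis .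
  qed
  then show ?thesis using 0 by (intro exI[of _ "A p0 q0 / B p0 q0"]) (simp add: field_simps)
qed

section \<open>Independent pairs of vectors and pointwise proportional linear maps\<close>

definition vec_independent :: "complex vec \<Rightarrow> complex vec \<Rightarrow> bool" where
  "vec_independent x y \<longleftrightarrow>
    (\<forall>\<alpha> \<beta>. \<alpha> \<cdot>\<^sub>v x + \<beta> \<cdot>\<^sub>v y = 0\<^sub>v (dim_vec x) \<longrightarrow> \<alpha> = 0 \<and> \<beta> = 0)"

lemma not_vec_independentD:
  assumes "\<not> vec_independent x y" "x \<in> carrier_vec n" "y \<in> carrier_vec n" "x \<noteq> 0\<^sub>v n"
  shows "\<exists>c. y = c \<cdot>\<^sub>v x"
proof -
  obtain \<alpha> \<beta> where ab: "\<alpha> \<cdot>\<^sub>v x + \<beta> \<cdot>\<^sub>v y = 0\<^sub>v n" "\<alpha> \<noteq> 0 \<or> \<beta> \<noteq> 0"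
    using assms(1,2) unfolding vec_independent_def by auto
  have idx: "\<alpha> * x $ i + \<beta> * y $ i = 0" if "i < n" for i
    using arg_cong[OF ab(1), of "\<lambda>v. v $ i"] that assms by simp
  have "\<beta> \<noteq> 0"
  proof
    assume "\<beta> = 0"
    then have "x $ i = 0" if "i < n" for i using idx[OF that] ab(2) by simp
    then show False using assms by (auto intro: eq_vecI)
  qed
  then have "y = (- \<alpha> / \<beta>) \<cdot>\<^sub>v x"
    using assms idx by (intro eq_vecI) (auto simp: field_simps eq_neg_iff_add_eq_0)
  then show ?thesis ..
qed

text \<open>Comparing the factors at \<open>a\<close>, \<open>b\<close> and \<open>a + b\<close>
  shows that a linear map pointwise proportional to an injective one is a constant multiple of it;
  the value at \<open>a\<close> makes the constant 1.\<close>

lemma proportional_linear_maps_eq: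
  fixes f g :: "complex vec \<Rightarrow> 'p \<Rightarrow> complex"
  assumes f: "\<And>x y p. x \<in> carrier_vec n \<Longrightarrow> y \<in> carrier_vec n \<Longrightarrow> f (x + y) p = f x p + f y p"
      "\<And>c x p. x \<in> carrier_vec n \<Longrightarrow> f (c \<cdot>\<^sub>v x) p = c * f x p"
    and g: "\<And>x y p. x \<in> carrier_vec n \<Longrightarrow> y \<in> carrier_vec n \<Longrightarrow> g (x + y) p = g x p + g y p"
      "\<And>c x p. x \<in> carrier_vec n \<Longrightarrow> g (c \<cdot>\<^sub>v x) p = c * g x p"
    and inj: "\<And>x. x \<in> carrier_vec n \<Longrightarrow> x \<noteq> 0\<^sub>v n \<Longrightarrow> \<exists>p. g x p \<noteq> 0"
    and prp: "\<And>x. x \<in> carrier_vec n \<Longrightarrow> x \<noteq> 0\<^sub>v n \<Longrightarrow> \<exists>c. \<forall>p. f x p = c * g x p"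
    and a: "a \<in> carrier_vec n" "a \<noteq> 0\<^sub>v n" "\<And>p. f a p = g a p"
    and b: "b \<in> carrier_vec n" "b \<noteq> 0\<^sub>v n"
  shows "f b p = g b p"
proof (cases "vec_independent a b")
  case False
  then obtain c where "b = c \<cdot>\<^sub>v a" using not_vec_independentD a b by blast
  then show ?thesis using a f g by simp
next
  case True
  have ab: "a + b \<in> carrier_vec n" using a b by simp
  have "a + b \<noteq> 0\<^sub>v n" using True a b unfolding vec_independent_def
    by (metis carrier_vecD one_neq_zero one_smult_vec)
  then obtain c where c: "\<And>p. f (a + b) p = c * g (a + b) p" using prp ab by blast
  obtain c' where c': "\<And>p. f b p = c' * g b p" using prp b by blast
  let ?z = "(1 - c) \<cdot>\<^sub>v a + (c' - c) \<cdot>\<^sub>v b"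
  have "g ?z p = 0" for p
    using c[of p] c'[of p] a b by (simp add: f g algebra_simps)
  then have "?z = 0\<^sub>v n" using inj[of ?z] a b by fastforce
  then have "c = 1" "c' = c" using True a b unfolding vec_independent_def by fastforce+
  then show ?thesis using c' by simp
qed

text \<open>The induction step of \<open>factorization\<close>. The factor in \<open>scal\<close>
  may depend on \<open>x\<close>, but in a column \<open>q1\<close> with
  \<open>h q1 \<noteq> 0\<close> both sides are linear in \<open>x\<close>, so
  \<open>proportional_linear_maps_eq\<close> fixes it.\<close>

lemma factor_unchanged:
  fixes F :: "complex vec \<Rightarrow> 'p \<Rightarrow> 'q \<Rightarrow> complex"
  assumes F: "\<And>x y p q. x \<in> carrier_vec n \<Longrightarrow> y \<in> carrier_vec n \<Longrightarrow> F (x + y) p q = F x p q + F y p q"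
      "\<And>c x p q. x \<in> carrier_vec n \<Longrightarrow> F (c \<cdot>\<^sub>v x) p q = c * F x p q"
    and g: "\<And>x y p. x \<in> carrier_vec n \<Longrightarrow> y \<in> carrier_vec n \<Longrightarrow> g (x + y) p = g x p + g y p"
      "\<And>c x p. x \<in> carrier_vec n \<Longrightarrow> g (c \<cdot>\<^sub>v x) p = c * g x p"
    and inj: "\<And>x. x \<in> carrier_vec n \<and> x \<noteq> 0\<^sub>v n \<Longrightarrow> \<exists>p. g x p \<noteq> 0"
    and h: "\<exists>q. h q \<noteq> 0"
    and scal: "\<And>x. x \<in> carrier_vec n \<and> x \<noteq> 0\<^sub>v n \<Longrightarrow> \<exists>c. \<forall>p q. F x p q = c * (g x p * h q)"
    and a: "a \<in> carrier_vec n \<and> a \<noteq> 0\<^sub>v n" "\<And>p q. F a p q = g a p * h q"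
    and b: "b \<in> carrier_vec n \<and> b \<noteq> 0\<^sub>v n"
  shows "F b p q = g b p * h q"
proof -
  obtain q1 where q1: "h q1 \<noteq> 0" using h by blast
  have eq: "F b p q1 / h q1 = g b p" for p
  proof (rule proportional_linear_maps_eq[where n = n and a = a and f = "\<lambda>x p. F x p q1 / h q1"])
    show "\<exists>c. \<forall>p. F x p q1 / h q1 = c * g x p" if x: "x \<in> carrier_vec n" "x \<noteq> 0\<^sub>v n" for x
    proof -
      obtain c where "\<forall>p q. F x p q = c * (g x p * h q)" using scal x by blast
      then have "\<forall>p. F x p q1 / h q1 = c * g x p" using q1 by simp
      then show ?thesis ..
    qed
  qed (use a b inj q1 in \<open>simp_all add: F g add_divide_distrib\<close>)
  obtain c where c: "\<forall>p q. F b p q = c * (g b p * h q)" using scal[OF b] by blast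
  obtain p1 where p1: "g b p1 \<noteq> 0" using inj[OF b] by blast
  have "c = 1" using eq[of p1] c[rule_format, of p1 q1] p1 q1 by simp
  then show ?thesis using c by simp
qed

text \<open>Three pairwise independent vectors, enough for a pigeonhole argument with two types.
  Dimension at least 2 enters here.\<close>

lemma independent_unit_vecs:
  assumes "2 \<le> n"
  defines "x \<equiv> unit_vec n 0" and "y \<equiv> unit_vec n 1"
  shows "vec_independent x y" "vec_independent x (x + y)" "vec_independent y (x + y)"
proof -
  have *: "\<alpha> = 0 \<and> \<beta> = 0" if "\<alpha> \<cdot>\<^sub>v x + \<beta> \<cdot>\<^sub>v y = 0\<^sub>v n" for \<alpha> \<beta> :: complex
    using arg_cong[OF that, of "\<lambda>v. v $ 0"] arg_cong[OF that, of "\<lambda>v. v $ 1"] assms by simp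
  show "vec_independent x y" using * by (simp add: vec_independent_def x_def)
  show "vec_independent x (x + y)"
    unfolding vec_independent_def
  proof (intro allI impI)
    fix \<alpha> \<beta> :: complex assume "\<alpha> \<cdot>\<^sub>v x + \<beta> \<cdot>\<^sub>v (x + y) = 0\<^sub>v (dim_vec x)"
    then have h: "\<alpha> \<cdot>\<^sub>v x + \<beta> \<cdot>\<^sub>v (x + y) = 0\<^sub>v n" by (simp add: x_def)
    show "\<alpha> = 0 \<and> \<beta> = 0"
      using arg_cong[OF h, of "\<lambda>v. v $ 0"] arg_cong[OF h, of "\<lambda>v. v $ 1"] assms by simp
  qed
  show "vec_independent y (x + y)"
    unfolding vec_independent_def
  proof (intro allI impI)
    fix \<alpha> \<beta> :: complex assume "\<alpha> \<cdot>\<^sub>v y + \<beta> \<cdot>\<^sub>v (x + y) = 0\<^sub>v (dim_vec y)"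
    then have h: "\<alpha> \<cdot>\<^sub>v y + \<beta> \<cdot>\<^sub>v (x + y) = 0\<^sub>v n" by (simp add: y_def)
    show "\<alpha> = 0 \<and> \<beta> = 0"
      using arg_cong[OF h, of "\<lambda>v. v $ 0"] arg_cong[OF h, of "\<lambda>v. v $ 1"] assms by simp
  qed
qed


text \<open>\<open>J\<close> contains the variables whose dimensions are prescribed,
  \<open>T\<close> those on which \<open>G\<close> depends. This lets two factors with different
  dependence share the same tuples.\<close>

definition multilinear :: "'i set \<Rightarrow> 'i set \<Rightarrow> ('i \<Rightarrow> nat) \<Rightarrow> (('i \<Rightarrow> complex vec) \<Rightarrow> 'p \<Rightarrow> complex) \<Rightarrow> bool" where
  "multilinear J T d G \<longleftrightarrow>
    (\<forall>v. (\<forall>j\<in>J. v j \<in> carrier_vec (d j)) \<longrightarrow> (\<forall>j\<in>T. \<forall>x\<in>carrier_vec (d j).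
      (\<forall>y\<in>carrier_vec (d j). \<forall>p. G (v(j := x + y)) p = G (v(j := x)) p + G (v(j := y)) p) \<and>
      (\<forall>c p. G (v(j := c \<cdot>\<^sub>v x)) p = c * G (v(j := x)) p))) \<and>
    (\<forall>v w. (\<forall>j\<in>T. v j = w j) \<longrightarrow> G v = G w)"

lemma multilinear_add:
  "\<lbrakk>multilinear J T d G; \<And>i. i \<in> J \<Longrightarrow> v i \<in> carrier_vec (d i); j \<in> T; x \<in> carrier_vec (d j);
    y \<in> carrier_vec (d j)\<rbrakk> \<Longrightarrow> G (v(j := x + y)) p = G (v(j := x)) p + G (v(j := y)) p"
  unfolding multilinear_def by blast

lemma multilinear_smult:
  "\<lbrakk>multilinear J T d G; \<And>i. i \<in> J \<Longrightarrow> v i \<in> carrier_vec (d i); j \<in> T; x \<in> carrier_vec (d j)\<rbrakk>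
    \<Longrightarrow> G (v(j := c \<cdot>\<^sub>v x)) p = c * G (v(j := x)) p"
  unfolding multilinear_def by blast

lemma multilinear_cong: "multilinear J T d G \<Longrightarrow> (\<And>j. j \<in> T \<Longrightarrow> v j = w j) \<Longrightarrow> G v = G w"
  unfolding multilinear_def by blast

lemma multilinear_zero:
  assumes "multilinear J T d G" "\<And>i. i \<in> J \<Longrightarrow> v i \<in> carrier_vec (d i)" "j \<in> T" "v j = 0\<^sub>v (d j)"
  shows "G v p = 0"
proof -
  have "G (v(j := 0 \<cdot>\<^sub>v v j)) p = 0 * G (v(j := v j)) p"
    using assms(4) by (intro multilinear_smult[OF assms(1-3)]) auto
  moreover have "v(j := 0 \<cdot>\<^sub>v v j) = v"
    using assms(4) by (intro fun_upd_idem) (auto intro!: eq_vecI)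
  ultimately show ?thesis by simp
qed

text \<open>\<open>minors\<close> includes tuples with zero vectors because it is applied to
  \<open>v(j := x + y)\<close>, where the sum may vanish.\<close>

locale rank_one_multilinear =
  fixes J :: "'i set" and d :: "'i \<Rightarrow> nat" and F :: "('i \<Rightarrow> complex vec) \<Rightarrow> 'p \<Rightarrow> 'q \<Rightarrow> complex"
  assumes finJ: "finite J" and dim2: "\<And>j. j \<in> J \<Longrightarrow> 2 \<le> d j"
    and multi: "\<And>q. multilinear J J d (\<lambda>v p. F v p q)"
    and minors: "\<And>v. (\<And>j. j \<in> J \<Longrightarrow> v j \<in> carrier_vec (d j)) \<Longrightarrow> same_cols (F v) (F v)"
    and nonzero: "\<And>v. (\<And>j. j \<in> J \<Longrightarrow> v j \<in> carrier_vec (d j) \<and> v j \<noteq> 0\<^sub>v (d j)) \<Longrightarrow> \<exists>p q. F v p q \<noteq> 0"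
begin

section \<open>Variables that move the column space and variables that move the row space\<close>

definition tuples :: "('i \<Rightarrow> complex vec) set" where
  "tuples = {v. \<forall>j\<in>J. v j \<in> carrier_vec (d j)}"

definition pure_tuples :: "('i \<Rightarrow> complex vec) set" where
  "pure_tuples = {v. \<forall>j\<in>J. v j \<in> carrier_vec (d j) \<and> v j \<noteq> 0\<^sub>v (d j)}"

abbreviation nz :: "'i \<Rightarrow> complex vec \<Rightarrow> bool" where
  "nz j x \<equiv> x \<in> carrier_vec (d j) \<and> x \<noteq> 0\<^sub>v (d j)"

lemma pure_subset: "v \<in> pure_tuples \<Longrightarrow> v \<in> tuples"
  by (simp add: tuples_def pure_tuples_def)

lemma pure_upd: "v \<in> pure_tuples \<Longrightarrow> nz j x \<Longrightarrow> v(j := x) \<in> pure_tuples"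
  by (auto simp: pure_tuples_def)

lemma F_add: "\<lbrakk>v \<in> tuples; j \<in> J; x \<in> carrier_vec (d j); y \<in> carrier_vec (d j)\<rbrakk> \<Longrightarrow>
    F (v(j := x + y)) p q = F (v(j := x)) p q + F (v(j := y)) p q"
  using multilinear_add[OF multi, of v j x y p q] by (simp add: tuples_def)

lemma F_smult: "\<lbrakk>v \<in> tuples; j \<in> J; x \<in> carrier_vec (d j)\<rbrakk> \<Longrightarrow>
    F (v(j := c \<cdot>\<^sub>v x)) p q = c * F (v(j := x)) p q"
  using multilinear_smult[OF multi, of v j x c p q] by (simp add: tuples_def)

lemma F_cong: "(\<And>j. j \<in> J \<Longrightarrow> v j = w j) \<Longrightarrow> F v = F w"
  using multilinear_cong[OF multi, of v w] by (auto simp: fun_eq_iff)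

lemma F_rank_one: "v \<in> pure_tuples \<Longrightarrow> rank_one (F v)"
  using minors[of v] nonzero[of v] by (auto simp: rank_one_def pure_tuples_def)

lemma F_dichotomy:
  assumes v: "v \<in> pure_tuples" and j: "j \<in> J" and x: "nz j x" and y: "nz j y"
  shows "same_cols (F (v(j := x))) (F (v(j := y))) \<or> same_rows (F (v(j := x))) (F (v(j := y)))"
proof (rule same_cols_or_same_rows)
  have "F (v(j := x + y)) = (\<lambda>p q. F (v(j := x)) p q + F (v(j := y)) p q)"
    using v j x y by (intro ext F_add pure_subset) auto
  moreover have "same_cols (F (v(j := x + y))) (F (v(j := x + y)))"
    using v x y by (intro minors) (auto simp: pure_tuples_def)
  ultimately show "same_cols (\<lambda>p q. F (v(j := x)) p q + F (v(j := y)) p q)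
      (\<lambda>p q. F (v(j := x)) p q + F (v(j := y)) p q)" by simp
qed (use assms in \<open>auto intro: F_rank_one pure_upd\<close>)

text \<open>If both directions agreed, the two values would be proportional, and a nonzero vector
  \<open>x - c y\<close> would be sent to zero.\<close>

lemma F_exclusive:
  assumes v: "v \<in> pure_tuples" and j: "j \<in> J" and x: "nz j x" and y: "nz j y"
    and ind: "vec_independent x y"
    and sc: "same_cols (F (v(j := x))) (F (v(j := y)))" and sr: "same_rows (F (v(j := x))) (F (v(j := y)))"
  shows False
proof -
  have "rank_one (F (v(j := x)))" "rank_one (F (v(j := y)))"
    using assms by (auto intro: F_rank_one pure_upd)
  from same_cols_and_same_rows[OF this sc sr]
  obtain c where c: "\<And>p q. F (v(j := x)) p q = c * F (v(j := y)) p q" by blast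
  let ?z = "x + (- c) \<cdot>\<^sub>v y"
  have "F (v(j := ?z)) p q = F (v(j := x)) p q + F (v(j := (- c) \<cdot>\<^sub>v y)) p q" for p q
    using v j x y by (intro F_add pure_subset) auto
  also have "\<dots> p q = 0" for p q
    using F_smult[of v j y "- c" p q] v j y by (simp add: c pure_subset)
  finally have "F (v(j := ?z)) p q = 0" for p q .
  moreover have "?z \<noteq> 0\<^sub>v (d j)"
  proof
    assume "?z = 0\<^sub>v (d j)"
    then have "1 \<cdot>\<^sub>v x + (- c) \<cdot>\<^sub>v y = 0\<^sub>v (dim_vec x)" using x carrier_vecD[of x "d j"] by auto
    from ind[unfolded vec_independent_def, rule_format, OF this] show False by simp
  qed
  then have "v(j := ?z) \<in> pure_tuples" using v x y by (intro pure_upd) auto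
  ultimately show False using F_rank_one unfolding rank_one_def by blast
qed

definition cols_fixed :: "('i \<Rightarrow> complex vec) \<Rightarrow> 'i \<Rightarrow> bool" where
  "cols_fixed v j \<longleftrightarrow> (\<forall>x y. nz j x \<longrightarrow> nz j y \<longrightarrow> same_cols (F (v(j := x))) (F (v(j := y))))"

definition rows_fixed :: "('i \<Rightarrow> complex vec) \<Rightarrow> 'i \<Rightarrow> bool" where
  "rows_fixed v j \<longleftrightarrow> (\<forall>x y. nz j x \<longrightarrow> nz j y \<longrightarrow> same_rows (F (v(j := x))) (F (v(j := y))))"

text \<open>A pair \<open>x0\<close>, \<open>y0\<close> with different rows serves as reference: no
  \<open>z\<close> shares its rows with both, so each \<open>z\<close> shares its columns with one
  of them and hence with both.\<close>

lemma cols_or_rows_fixed: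
  assumes v: "v \<in> pure_tuples" and j: "j \<in> J"
  shows "cols_fixed v j \<or> rows_fixed v j"
proof (rule disjCI)
  note r1 = F_rank_one[OF pure_upd[OF v]]
  assume "\<not> rows_fixed v j"
  then obtain x0 y0 where 0: "nz j x0" "nz j y0" "\<not> same_rows (F (v(j := x0))) (F (v(j := y0)))"
    unfolding rows_fixed_def by blast
  then have sc: "same_cols (F (v(j := x0))) (F (v(j := y0)))" using F_dichotomy[OF v j] by blast
  have x0: "same_cols (F (v(j := z))) (F (v(j := x0)))" if z: "nz j z" for z
  proof (cases "same_rows (F (v(j := z))) (F (v(j := x0)))")
    case False
    then show ?thesis using F_dichotomy[OF v j z 0(1)] by blast
  next
    case True
    have "\<not> same_rows (F (v(j := z))) (F (v(j := y0)))"
      using same_rows_trans[OF same_rows_sym[OF True] _ r1[OF 0(1)] r1[OF z] r1[OF 0(2)]] 0(3) by blast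
    then have "same_cols (F (v(j := z))) (F (v(j := y0)))" using F_dichotomy[OF v j z 0(2)] by blast
    then show ?thesis
      using same_cols_trans[OF _ same_cols_sym[OF sc] r1[OF z] r1[OF 0(2)] r1[OF 0(1)]] by blast
  qed
  show "cols_fixed v j"
    unfolding cols_fixed_def
  proof (intro allI impI)
    fix x y assume x: "nz j x" and y: "nz j y"
    show "same_cols (F (v(j := x))) (F (v(j := y)))"
      using same_cols_trans[OF x0[OF x] same_cols_sym[OF x0[OF y]] r1[OF x] r1[OF 0(1)] r1[OF y]] .
  qed
qed

text \<open>Of three pairwise independent values of the \<open>j\<close>-th vector, two would behave in the same way
  under the change of the \<open>i\<close>-th vector, and this would transfer the type of \<open>j\<close>.\<close>

lemma not_cols_fixed_and_rows_fixed:
  assumes v: "v \<in> pure_tuples" and i: "i \<in> J" and j: "j \<in> J" and b: "nz i b"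
    and cf: "cols_fixed v j" and rf: "rows_fixed (v(i := b)) j"
  shows False
proof (cases "i = j")
  \<comment> \<open>\<open>rows_fixed\<close> overwrites the \<open>j\<close>-th vector, so a change
    at \<open>i = j\<close> is invisible and two independent vectors already give the
    contradiction.\<close>
  case True
  have nz: "nz j (unit_vec (d j) 0)" "nz j (unit_vec (d j) 1)"
    using dim2[OF j] by (auto dest: arg_cong[of _ _ "\<lambda>v. v $ 0"] arg_cong[of _ _ "\<lambda>v. v $ 1"])
  have "rows_fixed v j" using rf True by (simp add: rows_fixed_def)
  then show False
    using F_exclusive[OF v j nz independent_unit_vecs(1)[OF dim2[OF j]]] cf nz
    unfolding cols_fixed_def rows_fixed_def by blast
next
  case False
  let ?A = "\<lambda>u. F (v(j := u))" and ?B = "\<lambda>u. F (v(i := b, j := u))"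
  have vb: "v(i := b) \<in> pure_tuples" using v b by (rule pure_upd)
  note rA = F_rank_one[OF pure_upd[OF v]] and rB = F_rank_one[OF pure_upd[OF vb]]
  have cA: "same_cols (?A x) (?A y)" if "nz j x" "nz j y" for x y
    using cf that unfolding cols_fixed_def by blast
  have rfB: "same_rows (?B x) (?B y)" if "nz j x" "nz j y" for x y
    using rf that unfolding rows_fixed_def by blast
  have AB: "same_cols (?A u) (?B u) \<or> same_rows (?A u) (?B u)" if u: "nz j u" for u
  proof -
    have "v(j := u) \<in> pure_tuples" using v u by (rule pure_upd)
    then have "same_cols (F (v(j := u, i := v i))) (F (v(j := u, i := b))) \<or>
        same_rows (F (v(j := u, i := v i))) (F (v(j := u, i := b)))"
      using v b i by (intro F_dichotomy) (auto simp: pure_tuples_def)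
    moreover have "v(j := u, i := v i) = v(j := u)" "v(j := u, i := b) = v(i := b, j := u)"
      using False by (auto simp: fun_eq_iff)
    ultimately show ?thesis by simp
  qed
  \<comment> \<open>If the change at \<open>i\<close> kept the columns at both \<open>x\<close> and
    \<open>y\<close>, the columns common to \<open>?A x\<close> and \<open>?A y\<close> would carry
    over to \<open>?B x\<close> and \<open>?B y\<close>, which share their rows as well.
    \<open>noR\<close> is the mirror image.\<close>
  have noC: False if u: "nz j x" "nz j y" "vec_independent x y"
    and c: "same_cols (?A x) (?B x)" "same_cols (?A y) (?B y)" for x y
  proof -
    have "same_cols (?B x) (?A y)"
      using same_cols_trans[OF same_cols_sym[OF c(1)] cA[OF u(1,2)] rB[OF u(1)] rA[OF u(1)] rA[OF u(2)]] .
    then have "same_cols (?B x) (?B y)"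
      using same_cols_trans[OF _ c(2) rB[OF u(1)] rA[OF u(2)] rB[OF u(2)]] by blast
    then show False using F_exclusive[OF vb j u] rfB[OF u(1,2)] by blast
  qed
  have noR: False if u: "nz j x" "nz j y" "vec_independent x y"
    and c: "same_rows (?A x) (?B x)" "same_rows (?A y) (?B y)" for x y
  proof -
    have "same_rows (?A x) (?B y)"
      using same_rows_trans[OF c(1) rfB[OF u(1,2)] rA[OF u(1)] rB[OF u(1)] rB[OF u(2)]] .
    then have "same_rows (?A x) (?A y)"
      using same_rows_trans[OF _ same_rows_sym[OF c(2)] rA[OF u(1)] rB[OF u(2)] rA[OF u(2)]] by blast
    then show False using F_exclusive[OF v j u] cA[OF u(1,2)] by blast
  qed
  define x :: "complex vec" where "x = unit_vec (d j) 0"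
  define y :: "complex vec" where "y = unit_vec (d j) 1"
  have nz: "nz j x" "nz j y" "nz j (x + y)"
    using dim2[OF j] unfolding x_def y_def
    by (auto dest: arg_cong[of _ _ "\<lambda>v. v $ 0"] arg_cong[of _ _ "\<lambda>v. v $ 1"])
  note ind = independent_unit_vecs[OF dim2[OF j], folded x_def y_def]
  show False
    using AB[OF nz(1)] AB[OF nz(2)] AB[OF nz(3)]
      noC[OF nz(1,2) ind(1)] noC[OF nz(1,3) ind(2)] noC[OF nz(2,3) ind(3)]
      noR[OF nz(1,2) ind(1)] noR[OF nz(1,3) ind(2)] noR[OF nz(2,3) ind(3)] by blast
qed


text \<open>Two tuples are compared through hybrids that take over one vector of \<open>w\<close> at
  a time. \<open>cong\<close> is needed at the end, because \<open>v\<close> and \<open>w\<close>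
  are unrelated outside \<open>J\<close>.\<close>

lemma pure_tuple_induct:
  assumes v: "v \<in> pure_tuples" and w: "w \<in> pure_tuples" and S: "S \<subseteq> J" "\<And>j. j \<in> J - S \<Longrightarrow> v j = w j"
    and P: "P v"
    and step: "\<And>u i b. u \<in> pure_tuples \<Longrightarrow> P u \<Longrightarrow> i \<in> S \<Longrightarrow> nz i b \<Longrightarrow> P (u(i := b))"
    and cong: "\<And>u u'. P u \<Longrightarrow> (\<And>j. j \<in> J \<Longrightarrow> u j = u' j) \<Longrightarrow> P u'"
  shows "P w"
proof -
  define hyb where "hyb R i = (if i \<in> R then w i else v i)" for R i
  have hyb: "hyb R \<in> pure_tuples" for R
    using v w by (auto simp: pure_tuples_def hyb_def)
  have "finite S" using S finJ finite_subset by blast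
  then have "P (hyb S)"
    using \<open>S \<subseteq> J\<close> 
  proof (induction "S" rule: finite_subset_induct[OF _ subset_refl, consumes 1, case_names empty insert])
    case empty
    then show ?case using P by (simp add: hyb_def[abs_def])
  next
    case (insert i R)
    have "nz i (w i)" using w insert S by (auto simp: pure_tuples_def)
    then have "P ((hyb R)(i := w i))" using insert hyb by (intro step) auto
    moreover have "(hyb R)(i := w i) = hyb (insert i R)" by (auto simp: hyb_def fun_eq_iff)
    ultimately show ?case by simp
  qed
  then show ?thesis using S(2) by (elim cong) (auto simp: hyb_def)
qed

lemma rows_fixed_cong: "(\<And>i. i \<in> J \<Longrightarrow> v i = w i) \<Longrightarrow> rows_fixed v j \<longleftrightarrow> rows_fixed w j"
  unfolding rows_fixed_def by (intro all_cong1 imp_cong refl arg_cong2[of _ _ _ _ same_rows] F_cong) auto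

text \<open>\<open>not_cols_fixed_and_rows_fixed\<close> forbids a switch from columns to rows; the
  opposite switch becomes a forbidden one when the update at \<open>i\<close> is undone.\<close>

lemma rows_fixed_all:
  assumes v: "v \<in> pure_tuples" and w: "w \<in> pure_tuples" and j: "j \<in> J" and rf: "rows_fixed v j"
  shows "rows_fixed w j"
proof (rule pure_tuple_induct[OF v w subset_refl, of "\<lambda>u. rows_fixed u j"])
  show "rows_fixed v j" by (rule rf)
next
  fix u i b assume u: "u \<in> pure_tuples" "rows_fixed u j" "i \<in> J" "nz i b"
  show "rows_fixed (u(i := b)) j"
  proof (rule ccontr)
    assume "\<not> rows_fixed (u(i := b)) j"
    then have cf: "cols_fixed (u(i := b)) j" using cols_or_rows_fixed[OF pure_upd] u j by blast
    have "nz i (u i)" using u by (auto simp: pure_tuples_def)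
    moreover have "rows_fixed (u(i := b, i := u i)) j" using u by simp
    ultimately show False
      using not_cols_fixed_and_rows_fixed[OF pure_upd[OF u(1,4)] u(3) j _ cf, of "u i"] by blast
  qed
next
  fix u u' assume u: "rows_fixed u j" and eq: "\<And>i. i \<in> J \<Longrightarrow> u i = u' i"
  show "rows_fixed u' j" using u rows_fixed_cong[of u u' j, OF eq] by simp
qed simp

definition base :: "'i \<Rightarrow> complex vec" where
  "base i = unit_vec (d i) 0"

lemma base_pure: "base \<in> pure_tuples"
  unfolding pure_tuples_def base_def
proof (intro CollectI ballI conjI)
  fix j assume "j \<in> J"
  then have "0 < d j" using dim2 by force
  then show "unit_vec (d j) 0 \<noteq> (0\<^sub>v (d j) :: complex vec)" by (rule unit_vec_nonzero)
qed simp

text \<open>The variables that keep the row space and therefore move the column space. By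
  \<open>rows_fixed_all\<close> the choice of \<open>base\<close> does not matter.\<close>

definition T :: "'i set" where
  "T = {j \<in> J. rows_fixed base j}"

lemma rows_fixed_T: "v \<in> pure_tuples \<Longrightarrow> j \<in> T \<Longrightarrow> rows_fixed v j"
  using rows_fixed_all[OF base_pure] by (auto simp: T_def)

lemma cols_fixed_not_T: "v \<in> pure_tuples \<Longrightarrow> j \<in> J - T \<Longrightarrow> cols_fixed v j"
  using rows_fixed_all[OF _ base_pure] cols_or_rows_fixed by (auto simp: T_def)

lemma same_cols_if_eq_on_T:
  assumes v: "v \<in> pure_tuples" and w: "w \<in> pure_tuples" and eq: "\<And>j. j \<in> T \<Longrightarrow> v j = w j"
  shows "same_cols (F v) (F w)"
proof (rule pure_tuple_induct[OF v w, of "J - T"])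
  show "same_cols (F v) (F v)" using v by (intro minors) (auto simp: pure_tuples_def)
next
  fix u i b assume u: "u \<in> pure_tuples" "same_cols (F v) (F u)" "i \<in> J - T" "nz i b"
  have "nz i (u i)" using u by (auto simp: pure_tuples_def)
  then have "same_cols (F (u(i := u i))) (F (u(i := b)))"
    using cols_fixed_not_T[OF u(1,3)] u(4) unfolding cols_fixed_def by blast
  then show "same_cols (F v) (F (u(i := b)))"
    using same_cols_trans[OF u(2) _ F_rank_one[OF v] F_rank_one[OF u(1)] F_rank_one[OF pure_upd[OF u(1,4)]]]
    by simp
next
  fix u u' assume "same_cols (F v) (F u)" "\<And>j. j \<in> J \<Longrightarrow> u j = u' j"
  then show "same_cols (F v) (F u')" using F_cong[of u u'] by simp
qed (use eq in auto)

lemma same_rows_if_eq_off_T: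
  assumes v: "v \<in> pure_tuples" and w: "w \<in> pure_tuples" and eq: "\<And>j. j \<in> J - T \<Longrightarrow> v j = w j"
  shows "same_rows (F v) (F w)"
proof (rule pure_tuple_induct[OF v w, of T])
  show "same_rows (F v) (F v)"
    using F_rank_one[OF v] rank_one_transpose[of "F v"]
    unfolding same_rows_transpose rank_one_def by blast
next
  fix u i b assume u: "u \<in> pure_tuples" "same_rows (F v) (F u)" "i \<in> T" "nz i b"
  have "nz i (u i)" using u by (auto simp: pure_tuples_def T_def)
  then have "same_rows (F (u(i := u i))) (F (u(i := b)))"
    using rows_fixed_T[OF u(1,3)] u(4) unfolding rows_fixed_def by blast
  then show "same_rows (F v) (F (u(i := b)))"
    using same_rows_trans[OF u(2) _ F_rank_one[OF v] F_rank_one[OF u(1)] F_rank_one[OF pure_upd[OF u(1,4)]]]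
    by simp
next
  fix u u' assume "same_rows (F v) (F u)" "\<And>j. j \<in> J \<Longrightarrow> u j = u' j"
  then show "same_rows (F v) (F u')" using F_cong[of u u'] by simp
qed (use eq in \<open>auto simp: T_def\<close>)

theorem factorization:
  "\<exists>T G H. T \<subseteq> J \<and> multilinear J T d G \<and> multilinear J (J - T) d H \<and>
    (\<forall>v\<in>tuples. \<forall>p q. F v p q = G v p * H v q) \<and>
    (\<forall>v\<in>pure_tuples. (\<exists>p. G v p \<noteq> 0) \<and> (\<exists>q. H v q \<noteq> 0))"
proof -
  obtain p0 q0 where 0: "F base p0 q0 \<noteq> 0" using F_rank_one[OF base_pure] by (auto simp: rank_one_def)
  define mT where "mT v i = (if i \<in> T then v i else base i)" for v :: "'i \<Rightarrow> complex vec" and i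
  define mR where "mR v i = (if i \<in> T then base i else v i)" for v :: "'i \<Rightarrow> complex vec" and i
  \<comment> \<open>\<open>G\<close> is column \<open>q0\<close> after the variables outside
    \<open>T\<close> are reset to \<open>base\<close>, and \<open>H\<close> is row \<open>p0\<close>
    after those in \<open>T\<close> are reset. The division makes the factorization exact at
    \<open>base\<close>.\<close>
  define G where "G v p = F (mT v) p q0" for v p
  define H where "H v q = F (mR v) p0 q / F base p0 q0" for v q
  have TJ: "T \<subseteq> J" by (auto simp: T_def)
  have bt: "base i \<in> carrier_vec (d i)" for i by (simp add: base_def)
  have mT: "mT v \<in> tuples" "mR v \<in> tuples" if "v \<in> tuples" for v
    using that bt by (auto simp: tuples_def mT_def mR_def)
  have mTp: "mT v \<in> pure_tuples" "mR v \<in> pure_tuples" if "v \<in> pure_tuples" for v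
    using that base_pure by (auto simp: pure_tuples_def mT_def mR_def)
  have mTu: "mT (v(j := x)) = (mT v)(j := x)" "mR (v(j := x)) j = base j" if "j \<in> T" for v j x
    using that by (auto simp: mT_def mR_def)
  have mRu: "mR (v(j := x)) = (mR v)(j := x)" if "j \<notin> T" for v j x
    using that by (auto simp: mR_def)
  have tup: "v \<in> tuples" if "\<forall>j\<in>J. v j \<in> carrier_vec (d j)" for v
    using that by (simp add: tuples_def)
  have mG: "multilinear J T d G"
    unfolding multilinear_def
  proof (intro conjI allI impI ballI)
    fix v w :: "'i \<Rightarrow> complex vec" assume "\<forall>j\<in>T. v j = w j"
    then have "mT v = mT w" by (auto simp: mT_def)
    then show "G v = G w" by (simp add: G_def[abs_def])
  next
    fix v :: "'i \<Rightarrow> complex vec" and j and x y :: "complex vec" and p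
    assume "\<forall>j\<in>J. v j \<in> carrier_vec (d j)" "j \<in> T" "x \<in> carrier_vec (d j)" "y \<in> carrier_vec (d j)"
    then show "G (v(j := x + y)) p = G (v(j := x)) p + G (v(j := y)) p"
      using TJ by (simp add: G_def mTu F_add mT tup subset_iff)
  next
    fix v :: "'i \<Rightarrow> complex vec" and j and x :: "complex vec" and c p
    assume "\<forall>j\<in>J. v j \<in> carrier_vec (d j)" "j \<in> T" "x \<in> carrier_vec (d j)"
    then show "G (v(j := c \<cdot>\<^sub>v x)) p = c * G (v(j := x)) p"
      using TJ by (simp add: G_def mTu F_smult mT tup subset_iff)
  qed
  have mH: "multilinear J (J - T) d H"
    unfolding multilinear_def
  proof (intro conjI allI impI ballI)
    fix v w :: "'i \<Rightarrow> complex vec" assume "\<forall>j\<in>J - T. v j = w j"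
    then have "F (mR v) = F (mR w)" by (intro F_cong) (auto simp: mR_def)
    then show "H v = H w" by (simp add: H_def[abs_def])
  next
    fix v :: "'i \<Rightarrow> complex vec" and j and x y :: "complex vec" and p
    assume "\<forall>j\<in>J. v j \<in> carrier_vec (d j)" "j \<in> J - T" "x \<in> carrier_vec (d j)" "y \<in> carrier_vec (d j)"
    then show "H (v(j := x + y)) p = H (v(j := x)) p + H (v(j := y)) p"
      by (simp add: H_def mRu F_add mT tup add_divide_distrib)
  next
    fix v :: "'i \<Rightarrow> complex vec" and j and x :: "complex vec" and c p
    assume "\<forall>j\<in>J. v j \<in> carrier_vec (d j)" "j \<in> J - T" "x \<in> carrier_vec (d j)"
    then show "H (v(j := c \<cdot>\<^sub>v x)) p = c * H (v(j := x)) p"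
      by (simp add: H_def mRu F_smult mT tup)
  qed
  have nG: "\<exists>p. G v p \<noteq> 0" if v: "v \<in> pure_tuples" for v
  proof -
    obtain p q where pq: "F (mT v) p q \<noteq> 0" using F_rank_one[OF mTp(1)[OF v]] by (auto simp: rank_one_def)
    have "same_rows (F (mT v)) (F base)"
      using v by (intro same_rows_if_eq_off_T mTp base_pure) (auto simp: mT_def)
    then have "F (mT v) p q * F base p0 q0 = F (mT v) p q0 * F base p0 q"
      unfolding same_rows_def by blast
    then have "F (mT v) p q0 \<noteq> 0" using pq 0 by (metis mult_eq_0_iff)
    then show ?thesis by (auto simp: G_def)
  qed
  have nH: "\<exists>q. H v q \<noteq> 0" if v: "v \<in> pure_tuples" for v
  proof -
    obtain p q where pq: "F (mR v) p q \<noteq> 0" using F_rank_one[OF mTp(2)[OF v]] by (auto simp: rank_one_def)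
    have "same_cols (F (mR v)) (F base)"
      using v by (intro same_cols_if_eq_on_T mTp base_pure) (auto simp: mR_def)
    then have "F (mR v) p q * F base p0 q0 = F (mR v) p0 q * F base p q0"
      unfolding same_cols_def by blast
    then have "F (mR v) p0 q \<noteq> 0" using pq 0 by (metis mult_eq_0_iff)
    then show ?thesis using 0 by (auto simp: H_def)
  qed
  \<comment> \<open>\<open>mT v\<close> keeps the column direction of \<open>F v\<close> and
    \<open>mR v\<close> its row direction, so \<open>F v\<close> is a multiple of the dyad of
    \<open>G v\<close> and \<open>H v\<close>, with a factor still depending on
    \<open>v\<close>.\<close>
  have scal: "\<exists>c. \<forall>p q. F v p q = c * (G v p * H v q)" if v: "v \<in> pure_tuples" for v
  proof -
    obtain p' q' where pq': "G v p' \<noteq> 0" "H v q' \<noteq> 0" using nG nH v by blast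
    have "same_cols (F v) (F (mT v))" "same_rows (F v) (F (mR v))"
      using v mTp by (auto intro!: same_cols_if_eq_on_T same_rows_if_eq_off_T simp: mT_def mR_def)
    then have 1: "F v p q * G v p' = F v p' q * G v p" "F v p q * H v q' = F v p q' * H v q" for p q p' q'
      unfolding same_cols_def same_rows_def G_def H_def by auto
    have "F v p q * (G v p' * H v q') = F v p' q' * (G v p * H v q)" for p q
    proof -
      have "F v p q * (G v p' * H v q') = (F v p q * G v p') * H v q'" by simp
      also have "\<dots> = (F v p' q * H v q') * G v p" by (simp add: 1(1)[of p q p'])
      also have "\<dots> = F v p' q' * (G v p * H v q)" by (simp add: 1(2)[of p' q q'])
      finally show ?thesis .
    qed
    then show ?thesis
      using pq' by (intro exI[of _ "F v p' q' / (G v p' * H v q')"]) (simp add: field_simps)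
  qed
  \<comment> \<open>The factor is 1 at \<open>base\<close>. When one vector changes, one of
    \<open>G\<close> and \<open>H\<close> stays fixed and the other is linear in that vector, so
    \<open>factor_unchanged\<close> applies.\<close>
  have pure: "\<forall>p q. F v p q = G v p * H v q" if v: "v \<in> pure_tuples" for v
  proof (rule pure_tuple_induct[OF base_pure v subset_refl, of "\<lambda>v. \<forall>p q. F v p q = G v p * H v q"])
    have "mT base = base" "mR base = base" by (auto simp: mT_def mR_def)
    moreover have "F base p q * F base p0 q0 = F base p0 q * F base p q0" for p q
      using F_rank_one[OF base_pure] unfolding rank_one_def same_cols_def by blast
    ultimately show "\<forall>p q. F base p q = G base p * H base q"
      using 0 by (simp add: G_def H_def field_simps)
  next
    fix u i b assume u: "u \<in> pure_tuples" "\<forall>p q. F u p q = G u p * H u q" "i \<in> J" "nz i b"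
    have ut: "u \<in> tuples" using u pure_subset by blast
    then have uc: "\<And>j. j \<in> J \<Longrightarrow> u j \<in> carrier_vec (d j)" by (simp add: tuples_def)
    have ui: "nz i (u i)" using u by (auto simp: pure_tuples_def)
    have upd: "u(i := x) \<in> pure_tuples" if "nz i x" for x using u(1) that by (rule pure_upd)
    show "\<forall>p q. F (u(i := b)) p q = G (u(i := b)) p * H (u(i := b)) q"
    proof (cases "i \<in> T")
      case True
      have H: "H (u(i := x)) = H u" for x using True by (intro multilinear_cong[OF mH]) auto
      have "F (u(i := b)) p q = G (u(i := b)) p * H u q" for p q
      proof (rule factor_unchanged[where n = "d i" and a = "u i" and F = "\<lambda>x. F (u(i := x))"
          and g = "\<lambda>x. G (u(i := x))" and h = "H u", OF F_add[OF ut u(3)] F_smult[OF ut u(3)]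
          multilinear_add[OF mG uc True] multilinear_smult[OF mG uc True]])
        show "\<exists>q. H u q \<noteq> 0" by (rule nH[OF u(1)])
        show "\<exists>c. \<forall>p q. F (u(i := x)) p q = c * (G (u(i := x)) p * H u q)" if "nz i x" for x
          using scal[OF upd[OF that]] H by simp
      qed (use nG[OF upd] ui u(2,4) in auto)
      then show ?thesis using H by simp
    next
      case False
      have G: "G (u(i := x)) = G u" for x using False by (intro multilinear_cong[OF mG]) auto
      have iT: "i \<in> J - T" using False u(3) by simp
      have "F (u(i := b)) p q = H (u(i := b)) q * G u p" for p q
      proof (rule factor_unchanged[where n = "d i" and a = "u i" and F = "\<lambda>x q p. F (u(i := x)) p q"
          and g = "\<lambda>x. H (u(i := x))" and h = "G u", OF F_add[OF ut u(3)] F_smult[OF ut u(3)]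
          multilinear_add[OF mH uc iT] multilinear_smult[OF mH uc iT]])
        show "\<exists>p. G u p \<noteq> 0" by (rule nG[OF u(1)])
        show "\<exists>c. \<forall>q p. F (u(i := x)) p q = c * (H (u(i := x)) q * G u p)" if "nz i x" for x
          using scal[OF upd[OF that]] G by (simp add: mult.commute) blast
      qed (use nH[OF upd] ui u(2,4) in \<open>auto simp: mult.commute\<close>)
      then show ?thesis using G by (simp add: mult.commute)
    qed
  next
    fix u u' assume u: "\<forall>p q. F u p q = G u p * H u q" and eq: "\<And>j. j \<in> J \<Longrightarrow> u j = u' j"
    have "F u = F u'" "G u = G u'" "H u = H u'"
      using eq TJ by (auto intro!: F_cong multilinear_cong[OF mG] multilinear_cong[OF mH])
    then show "\<forall>p q. F u' p q = G u' p * H u' q" using u by simp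
  qed auto
  have "F v p q = G v p * H v q" if v: "v \<in> tuples" for v p q
  proof (cases "v \<in> pure_tuples")
    \<comment> \<open>With a zero vector in the tuple both sides vanish, as each variable belongs to
      \<open>G\<close> or to \<open>H\<close>.\<close>
    case False
    then obtain j where j: "j \<in> J" "v j = 0\<^sub>v (d j)" using v by (auto simp: tuples_def pure_tuples_def)
    have vc: "\<And>j. j \<in> J \<Longrightarrow> v j \<in> carrier_vec (d j)" using v by (simp add: tuples_def)
    have "F v p q = 0" using multilinear_zero[OF multi[of q], of v j p] vc j by blast
    moreover have "G v p = 0 \<or> H v q = 0"
    proof (cases "j \<in> T")
      case True
      have "G v p = 0" by (rule multilinear_zero[OF mG vc True j(2)])
      then show ?thesis ..
    next
      case False
      then have "j \<in> J - T" using j(1) by simp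
      have "H v q = 0" by (rule multilinear_zero[OF mH vc \<open>j \<in> J - T\<close> j(2)])
      then show ?thesis ..
    qed
    ultimately show ?thesis by auto
  qed (use pure in blast)
  then show ?thesis
    using TJ mG mH nG nH by (intro exI[of _ T] exI[of _ G] exI[of _ H] conjI ballI allI)
qed

end

section \<open>The universal property of the Kronecker product\<close>

lemma linear_expand:
  fixes g :: "complex vec \<Rightarrow> complex"
  assumes add: "\<And>x y. x \<in> carrier_vec a \<Longrightarrow> y \<in> carrier_vec a \<Longrightarrow> g (x + y) = g x + g y"
    and smult: "\<And>c x. x \<in> carrier_vec a \<Longrightarrow> g (c \<cdot>\<^sub>v x) = c * g x"
    and x: "x \<in> carrier_vec a"
  shows "g x = (\<Sum>i<a. x $ i * g (unit_vec a i))"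
proof -
  \<comment> \<open>The truncation of \<open>x\<close> to its first \<open>k\<close> entries; each
    further entry is one application of \<open>add\<close> and \<open>smult\<close>, so no finite
    sum of vectors has to be formed.\<close>
  define t where "t k = vec a (\<lambda>i. if i < k then x $ i else 0)" for k
  have "g (t k) = (\<Sum>i<k. x $ i * g (unit_vec a i))" if "k \<le> a" for k
    using that
  proof (induction k)
    case 0
    have "t 0 = 0 \<cdot>\<^sub>v x" using x by (intro eq_vecI) (auto simp: t_def)
    then show ?case using smult[OF x, of 0] by simp
  next
    case (Suc k)
    have "t (Suc k) = t k + x $ k \<cdot>\<^sub>v unit_vec a k"
      using Suc.prems by (intro eq_vecI) (auto simp: t_def less_Suc_eq)
    then have "g (t (Suc k)) = g (t k) + x $ k * g (unit_vec a k)"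
      using add[of "t k" "x $ k \<cdot>\<^sub>v unit_vec a k"] smult[of "unit_vec a k" "x $ k"]
      by (simp add: t_def)
    then show ?case using Suc by simp
  qed
  moreover have "t a = x" using x by (intro eq_vecI) (auto simp: t_def)
  ultimately show ?thesis by force
qed

lemma sum_div_mod: "(\<Sum>k<a * b. f (k div b) (k mod b)) = (\<Sum>i<a. \<Sum>c<b. f i c)"
  for a b :: nat
proof -
  have "(\<Sum>k<a * b. f (k div b) (k mod b)) = (\<Sum>(i, c)\<in>{..<a} \<times> {..<b}. f i c)"
    by (rule sum.reindex_bij_witness[of _ "\<lambda>(i, c). i * b + c" "\<lambda>k. (k div b, k mod b)"])
      (auto simp: mult_add_less mult_add_div intro: div_less_prod mod_less_prod)
  then show ?thesis by (simp add: sum.cartesian_product)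
qed

definition multilinear_list :: "nat list \<Rightarrow> (complex vec list \<Rightarrow> complex) \<Rightarrow> bool" where
  "multilinear_list as G \<longleftrightarrow> (\<forall>ys zs x y c. map dim_vec (ys @ x # zs) = as \<longrightarrow> dim_vec y = dim_vec x \<longrightarrow>
     G (ys @ (x + y) # zs) = G (ys @ x # zs) + G (ys @ y # zs) \<and>
     G (ys @ (c \<cdot>\<^sub>v x) # zs) = c * G (ys @ x # zs))"

lemma multilinear_list_Cons:
  "multilinear_list (a # as) G \<Longrightarrow> dim_vec u = a \<Longrightarrow> multilinear_list as (\<lambda>zs. G (u # zs))"
  unfolding multilinear_list_def
proof (intro allI impI)
  fix ys zs :: "complex vec list" and x y :: "complex vec" and c
  assume G: "\<forall>ys zs x y c. map dim_vec (ys @ x # zs) = a # as \<longrightarrow> dim_vec y = dim_vec x \<longrightarrow>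
      G (ys @ (x + y) # zs) = G (ys @ x # zs) + G (ys @ y # zs) \<and>
      G (ys @ (c \<cdot>\<^sub>v x) # zs) = c * G (ys @ x # zs)"
    and u: "dim_vec u = a" and d: "map dim_vec (ys @ x # zs) = as" "dim_vec y = dim_vec x"
  show "G (u # ys @ (x + y) # zs) = G (u # ys @ x # zs) + G (u # ys @ y # zs) \<and>
      G (u # ys @ (c \<cdot>\<^sub>v x) # zs) = c * G (u # ys @ x # zs)"
    using G[rule_format, of "u # ys" x zs y c] u d by simp
qed

lemma multilinear_list_expand:
  assumes "multilinear_list as G" "map dim_vec xs = as"
  shows "G xs = (\<Sum>c<prod_list as. kron_vecs xs $ c * G (map2 unit_vec as (digits as c)))"
  using assms
proof (induction as arbitrary: G xs)
  case (Cons a as)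
  then obtain x xs' where xs: "xs = x # xs'" "dim_vec x = a" "map dim_vec xs' = as"
    by (cases xs) auto
  let ?P = "prod_list as"
  let ?u = "\<lambda>c. map2 unit_vec as (digits as c)"
  have "G (x # xs') = (\<Sum>i<a. x $ i * G (unit_vec a i # xs'))"
  proof (rule linear_expand[where g = "\<lambda>x. G (x # xs')"])
    show "G ((x + y) # xs') = G (x # xs') + G (y # xs')" if "x \<in> carrier_vec a" "y \<in> carrier_vec a" for x y
      using Cons.prems(1) xs that unfolding multilinear_list_def
      by (metis append_Nil carrier_vecD list.simps(9))
    show "G ((c \<cdot>\<^sub>v x) # xs') = c * G (x # xs')" if "x \<in> carrier_vec a" for c x
      using Cons.prems(1) xs that unfolding multilinear_list_def
      by (metis append_Nil carrier_vecD list.simps(9))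
  qed (use xs in auto)
  also have "\<dots> = (\<Sum>i<a. \<Sum>c<?P. x $ i * kron_vecs xs' $ c * G (unit_vec a i # ?u c))"
  proof (rule sum.cong)
    fix i
    have "G (unit_vec a i # xs') = (\<Sum>c<?P. kron_vecs xs' $ c * G (unit_vec a i # ?u c))"
      using Cons.prems xs by (intro Cons.IH multilinear_list_Cons) auto
    then show "x $ i * G (unit_vec a i # xs') = (\<Sum>c<?P. x $ i * kron_vecs xs' $ c * G (unit_vec a i # ?u c))"
      by (simp add: sum_distrib_left mult.assoc)
  qed simp
  also have "\<dots> = (\<Sum>k<a * ?P. x $ (k div ?P) * kron_vecs xs' $ (k mod ?P) *
      G (unit_vec a (k div ?P) # ?u (k mod ?P)))"
    by (rule sum_div_mod[symmetric])
  also have "\<dots> = (\<Sum>k<prod_list (a # as). kron_vecs xs $ k * G (map2 unit_vec (a # as) (digits (a # as) k)))"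
    using xs by (intro sum.cong) (auto simp: index_kron_vec)
  finally show ?case by (simp add: xs)
qed simp

text \<open>Column \<open>c\<close> of the matrix is the value of \<open>G\<close> at the unit
  vectors selected by the digits of \<open>c\<close>.\<close>

theorem kron_vecs_universal:
  assumes "\<And>p. p < m \<Longrightarrow> multilinear_list as (\<lambda>xs. G xs p)"
  shows "\<exists>M\<in>carrier_mat m (prod_list as). \<forall>xs. map dim_vec xs = as \<longrightarrow> M *\<^sub>v kron_vecs xs = vec m (G xs)"
proof (intro bexI allI impI)
  let ?M = "mat m (prod_list as) (\<lambda>(p, c). G (map2 unit_vec as (digits as c)) p)"
  show "?M \<in> carrier_mat m (prod_list as)" by simp
  fix xs :: "complex vec list"
  assume xs: "map dim_vec xs = as"
  show "?M *\<^sub>v kron_vecs xs = vec m (G xs)"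
  proof (rule eq_vecI)
    fix p assume "p < dim_vec (vec m (G xs))"
    then have p: "p < m" by simp
    have "G xs p = (\<Sum>c<prod_list as. kron_vecs xs $ c * G (map2 unit_vec as (digits as c)) p)"
      by (rule multilinear_list_expand[OF assms[OF p] xs])
    then show "(?M *\<^sub>v kron_vecs xs) $ p = vec m (G xs) $ p"
      using p by (simp add: scalar_prod_def xs atLeast0LessThan mult.commute)
  qed simp
qed

section \<open>Associativity, zeros and linearity of Kronecker products of vectors\<close>

lemma kron_vec_assoc: "(x \<otimes>\<^sub>v y) \<otimes>\<^sub>v z = x \<otimes>\<^sub>v (y \<otimes>\<^sub>v z)"
proof (rule eq_vecI)
  fix i assume "i < dim_vec (x \<otimes>\<^sub>v (y \<otimes>\<^sub>v z))"
  then have i: "i < dim_vec x * dim_vec y * dim_vec z" by (simp add: mult.assoc)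
  then have "i div dim_vec z < dim_vec x * dim_vec y" by (rule div_less_prod)
  moreover have "i mod (dim_vec y * dim_vec z) < dim_vec y * dim_vec z"
    using i by (intro mod_less_prod[of _ "dim_vec x"]) (simp add: mult.assoc)
  moreover have "i div dim_vec z div dim_vec y = i div (dim_vec y * dim_vec z)"
    by (simp add: div_mult2_eq mult.commute[of "dim_vec y"])
  moreover have "i mod (dim_vec y * dim_vec z) div dim_vec z = i div dim_vec z mod dim_vec y"
    using mod_mult2_eq[of i "dim_vec z" "dim_vec y"] i by (cases "dim_vec z = 0") (auto simp: mult.commute)
  moreover have "i mod (dim_vec y * dim_vec z) mod dim_vec z = i mod dim_vec z"
    by (simp add: mod_mod_cancel)
  ultimately show "((x \<otimes>\<^sub>v y) \<otimes>\<^sub>v z) $ i = (x \<otimes>\<^sub>v (y \<otimes>\<^sub>v z)) $ i"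
    using i by (simp add: index_kron_vec mult.assoc)
qed (simp add: mult.assoc)

lemma kron_vec_one [simp]: "one_vec \<otimes>\<^sub>v x = x" "x \<otimes>\<^sub>v one_vec = x"
  by (auto intro!: eq_vecI simp: index_kron_vec)

lemma kron_vecs_append: "kron_vecs (xs @ ys) = kron_vecs xs \<otimes>\<^sub>v kron_vecs ys"
  by (induction xs) (auto simp: kron_vec_assoc)

lemma kron_vecs_concat_pairs:
  "kron_vecs (concat (map (\<lambda>j. [x j, y j]) l)) = kron_vecs (map (\<lambda>j. x j \<otimes>\<^sub>v y j) l)"
  by (induction l) (auto simp: kron_vec_assoc)

lemma kron_vecs_const_one: "kron_vecs (map (\<lambda>_. one_vec) l) = one_vec"
  by (induction l) auto

lemma kron_vec_nonzero:
  assumes "x \<noteq> 0\<^sub>v (dim_vec x)" "y \<noteq> 0\<^sub>v (dim_vec y)"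
  shows "x \<otimes>\<^sub>v y \<noteq> 0\<^sub>v (dim_vec x * dim_vec y)"
proof -
  obtain i where i: "i < dim_vec x" "x $ i \<noteq> 0" using nonzero_vec_index[OF carrier_vec_dim_vec assms(1)] by blast
  obtain j where j: "j < dim_vec y" "y $ j \<noteq> 0" using nonzero_vec_index[OF carrier_vec_dim_vec assms(2)] by blast
  have lt: "i * dim_vec y + j < dim_vec x * dim_vec y" by (rule mult_add_less[OF i(1) j(1)])
  moreover have "(i * dim_vec y + j) div dim_vec y = i" "(i * dim_vec y + j) mod dim_vec y = j"
    using j by (simp_all add: mult_add_div)
  ultimately have "(x \<otimes>\<^sub>v y) $ (i * dim_vec y + j) = x $ i * y $ j" by (simp add: index_kron_vec)
  then show ?thesis using i j lt by auto
qed

lemma kron_vec_zero: "0\<^sub>v a \<otimes>\<^sub>v y = 0\<^sub>v (a * dim_vec y)" "x \<otimes>\<^sub>v 0\<^sub>v b = 0\<^sub>v (dim_vec x * b)"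
  by (auto intro!: eq_vecI simp: index_kron_vec div_less_prod mod_less_prod)

lemma kron_vecs_nonzero:
  "(\<And>x. x \<in> set xs \<Longrightarrow> x \<noteq> 0\<^sub>v (dim_vec x)) \<Longrightarrow> kron_vecs xs \<noteq> 0\<^sub>v (prod_list (map dim_vec xs))"
proof (induction xs)
  case Nil
  then show ?case by (auto dest: arg_cong[of _ _ "\<lambda>v. v $ 0"])
next
  case (Cons x xs)
  then show ?case using kron_vec_nonzero[of x "kron_vecs xs"] by simp
qed

lemma kron_vecs_zero:
  "x \<in> set xs \<Longrightarrow> x = 0\<^sub>v (dim_vec x) \<Longrightarrow> kron_vecs xs = 0\<^sub>v (prod_list (map dim_vec xs))"
proof (induction xs)
  case (Cons z xs)
  show ?case
  proof (cases "x = z")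
    case True
    then have "z \<otimes>\<^sub>v kron_vecs xs = 0\<^sub>v (dim_vec z) \<otimes>\<^sub>v kron_vecs xs" using Cons by simp
    then show ?thesis by (simp add: kron_vec_zero)
  next
    case False
    then show ?thesis using Cons by (simp add: kron_vec_zero)
  qed
qed simp

lemma kron_vec_add:
  "dim_vec x = dim_vec x' \<Longrightarrow> (x + x') \<otimes>\<^sub>v y = x \<otimes>\<^sub>v y + x' \<otimes>\<^sub>v y"
  "dim_vec y = dim_vec y' \<Longrightarrow> x \<otimes>\<^sub>v (y + y') = x \<otimes>\<^sub>v y + x \<otimes>\<^sub>v y'"
  by (auto intro!: eq_vecI simp: index_kron_vec div_less_prod mod_less_prod algebra_simps)

lemma kron_vec_smult:
  "(c \<cdot>\<^sub>v x) \<otimes>\<^sub>v y = c \<cdot>\<^sub>v (x \<otimes>\<^sub>v y)" "x \<otimes>\<^sub>v (c \<cdot>\<^sub>v y) = c \<cdot>\<^sub>v (x \<otimes>\<^sub>v y)"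
  by (auto intro!: eq_vecI simp: index_kron_vec div_less_prod mod_less_prod algebra_simps)

lemma kron_vecs_upd_notin: "i \<notin> set l \<Longrightarrow> kron_vecs (map (f(i := x)) l) = kron_vecs (map f l)"
  by (simp add: map_fun_upd)

lemma kron_vecs_upd_add:
  assumes "distinct l" "i \<in> set l" "dim_vec x = dim_vec y"
  shows "kron_vecs (map (f(i := x + y)) l) = kron_vecs (map (f(i := x)) l) + kron_vecs (map (f(i := y)) l)"
  using assms
proof (induction l)
  case (Cons a l)
  show ?case
  proof (cases "a = i")
    case True
    then have "i \<notin> set l" using Cons.prems by simp
    from kron_vecs_upd_notin[OF this, of f] show ?thesis
      using True Cons.prems by (simp add: kron_vec_add del: fun_upd_apply) (simp add: kron_vec_add)
  next
    case False
    have "map dim_vec (map (f(i := x)) l) = map dim_vec (map (f(i := y)) l)"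
      using Cons.prems by auto
    then have "dim_vec (kron_vecs (map (f(i := x)) l)) = dim_vec (kron_vecs (map (f(i := y)) l))"
      by (simp only: dim_kron_vecs)
    have ih: "kron_vecs (map (f(i := x + y)) l) = kron_vecs (map (f(i := x)) l) + kron_vecs (map (f(i := y)) l)"
      by (rule Cons.IH) (use Cons.prems False in auto)
    from kron_vec_add(2)[OF \<open>dim_vec (kron_vecs _) = _\<close>, of "f a"]
    have "f a \<otimes>\<^sub>v kron_vecs (map (f(i := x + y)) l)
        = f a \<otimes>\<^sub>v kron_vecs (map (f(i := x)) l) + f a \<otimes>\<^sub>v kron_vecs (map (f(i := y)) l)"
      unfolding ih .
    moreover have "kron_vecs (map (f(i := z)) (a # l)) = f a \<otimes>\<^sub>v kron_vecs (map (f(i := z)) l)" for z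
      using False by simp
    ultimately show ?thesis by (simp only:)
  qed
qed simp

lemma kron_vecs_upd_smult:
  assumes "distinct l" "i \<in> set l"
  shows "kron_vecs (map (f(i := c \<cdot>\<^sub>v x)) l) = c \<cdot>\<^sub>v kron_vecs (map (f(i := x)) l)"
  using assms
proof (induction l)
  case (Cons a l)
  show ?case
  proof (cases "a = i")
    case True
    then have "i \<notin> set l" using Cons.prems by simp
    from kron_vecs_upd_notin[OF this, of f] show ?thesis
      using True by (simp add: kron_vec_smult del: fun_upd_apply) (simp add: kron_vec_smult)
  next
    case False
    then show ?thesis using Cons by (simp add: kron_vec_smult)
  qed
qed simp

section \<open>Matrices of rank one\<close>

definition outer :: "complex vec \<Rightarrow> complex vec \<Rightarrow> complex mat" where
  "outer u v = mat (dim_vec u) (dim_vec v) (\<lambda>(i, j). u $ i * v $ j)"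

lemma outer_simps [simp]:
  "dim_row (outer u v) = dim_vec u" "dim_col (outer u v) = dim_vec v"
  "outer u v \<in> carrier_mat (dim_vec u) (dim_vec v)"
  by (simp_all add: outer_def)

lemma index_outer [simp]: "i < dim_vec u \<Longrightarrow> j < dim_vec v \<Longrightarrow> outer u v $$ (i, j) = u $ i * v $ j"
  by (simp add: outer_def)

context vec_space
begin

lemma lin_indpt_singleton:
  assumes "c \<in> carrier_vec n" "c \<noteq> 0\<^sub>v n"
  shows "lin_indpt {c}"
proof
  assume "lin_dep {c}"
  then obtain a v where a: "lincomb a {c} = 0\<^sub>v n" "v \<in> {c}" "a v \<noteq> 0"
    using finite_lin_dep[of "{c}"] assms by auto
  have "a c * c $ i = 0" if "i < n" for i
    using lincomb_index[OF that, of "{c}" a] assms a(1) that by simp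
  then have "c = 0\<^sub>v n" using assms a by (intro eq_vecI) auto
  then show False using assms by simp
qed

text \<open>The rank is the size of a maximal independent set of columns; being a singleton
  \<open>{c}\<close>, it makes every column a multiple of \<open>c\<close>. That \<open>c\<close> is
  itself a column later excludes that all multiples are zero.\<close>

lemma rank_one_imp_outer:
  assumes A: "A \<in> carrier_mat n nc" and "rank A = 1"
  shows "\<exists>c. c \<in> carrier_vec n \<and> c \<noteq> 0\<^sub>v n \<and> c \<in> set (cols A) \<and> (\<forall>j<nc. \<exists>b. col A j = b \<cdot>\<^sub>v c)"
proof -
  have cols: "set (cols A) \<subseteq> carrier_vec n" using cols_dim A by blast
  have "lin_indpt {}" using span_empty by (metis (no_types) empty_subsetI fin_dim finite_basis_exists subset_li_is_li vectorspace.basis_def vec_vs)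
  then obtain S where S: "maximal S (\<lambda>T. T \<subseteq> set (cols A) \<and> lin_indpt T)"
    using maximal_exists_superset[of "set (cols A)" "\<lambda>T. T \<subseteq> set (cols A) \<and> lin_indpt T" "{}"] by auto
  then have "card S = 1" using rank_card_indpt[OF A] assms by simp
  then obtain c where c: "S = {c}" by (auto simp: card_1_singleton_iff)
  then have cS: "c \<in> set (cols A)" "lin_indpt {c}" using S by (auto simp: maximal_def)
  then have cc: "c \<in> carrier_vec n" using cols by blast
  have c0: "c \<noteq> 0\<^sub>v n"
  proof
    assume "c = 0\<^sub>v n"
    then have "lincomb (\<lambda>_. 1) {c} = 0\<^sub>v n"
      using cc by (intro eq_vecI) (auto simp: lincomb_index lincomb_dim)
    then have "lin_dep {c}"
      using lin_dep_crit[where A = "{c}" and S = "{c}" and a = "\<lambda>_. 1" and v = c] by simp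
    then show False using cS(2) by simp
  qed
  have "\<exists>b. col A j = b \<cdot>\<^sub>v c" if j: "j < nc" for j
  proof (cases "col A j = c")
    case True
    then show ?thesis by (intro exI[of _ 1]) simp
  next
    case False
    have colj: "col A j \<in> set (cols A)" using A j by (metis carrier_matD(2) cols_length cols_nth nth_mem)
    have cj: "col A j \<in> carrier_vec n" using colj cols by blast
    have "\<not> lin_indpt {c, col A j}"
    proof
      assume "lin_indpt {c, col A j}"
      then have "{c, col A j} = {c}" using S cS colj unfolding c maximal_def by auto
      then show False using False by auto
    qed
    then obtain a v where a: "lincomb a {c, col A j} = 0\<^sub>v n" "v \<in> {c, col A j}" "a v \<noteq> 0"
      using finite_lin_dep[of "{c, col A j}"] cc cj by auto
    have idx: "a c * c $ i + a (col A j) * col A j $ i = 0" if "i < n" for i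
      using lincomb_index[OF that, of "{c, col A j}" a] a(1) cc cj that False by auto
    have "a (col A j) \<noteq> 0"
    proof
      assume 0: "a (col A j) = 0"
      then have "a c \<noteq> 0" using a by auto
      then have "c $ i = 0" if "i < n" for i using idx[OF that] 0 by simp
      then show False using c0 cc by (auto intro: eq_vecI)
    qed
    then have "col A j = (- a c / a (col A j)) \<cdot>\<^sub>v c"
      using idx cc A by (intro eq_vecI) (auto simp: field_simps eq_neg_iff_add_eq_0)
    then show ?thesis ..
  qed
  then show ?thesis using cc c0 cS by blast
qed

end

lemma rank_eq_1_iff_outer:
  assumes A: "A \<in> carrier_mat n nc"
  shows "vec_space.rank n A = 1 \<longleftrightarrow>
    (\<exists>u v. u \<in> carrier_vec n \<and> v \<in> carrier_vec nc \<and> u \<noteq> 0\<^sub>v n \<and> v \<noteq> 0\<^sub>v nc \<and> A = outer u v)"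
proof
  interpret vec_space "TYPE(complex)" n .
  assume "rank A = 1"
  then obtain c where c: "c \<in> carrier_vec n" "c \<noteq> 0\<^sub>v n" "c \<in> set (cols A)"
    "\<forall>j<nc. \<exists>b. col A j = b \<cdot>\<^sub>v c" using rank_one_imp_outer[OF A] by blast
  then obtain b where b: "\<And>j. j < nc \<Longrightarrow> col A j = b j \<cdot>\<^sub>v c" by metis
  have "A $$ (i, j) = c $ i * b j" if "i < n" "j < nc" for i j
    using arg_cong[OF b[OF that(2)], of "\<lambda>v. v $ i"] that A c(1) by (simp add: mult.commute)
  then have "A = outer c (vec nc b)" using A c(1) by (intro eq_matI) auto
  moreover have "vec nc b \<noteq> 0\<^sub>v nc"
  proof
    assume "vec nc b = 0\<^sub>v nc"
    then have "b j = 0" if "j < nc" for j using that by (metis index_vec index_zero_vec(1))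
    moreover obtain j where "j < nc" "c = col A j"
      using c(3) A by (metis carrier_matD(2) cols_length cols_nth in_set_conv_nth)
    ultimately have "c = 0 \<cdot>\<^sub>v c" using b by metis
    then have "c $ i = 0" if "i < n" for i
      using that c(1) by (metis carrier_vecD index_smult_vec(1) mult_zero_left)
    then have "c = 0\<^sub>v n" using c(1) by (intro eq_vecI) auto
    then show False using c(2) by simp
  qed
  ultimately show "\<exists>u v. u \<in> carrier_vec n \<and> v \<in> carrier_vec nc \<and> u \<noteq> 0\<^sub>v n \<and> v \<noteq> 0\<^sub>v nc \<and> A = outer u v"
    using c by (intro exI[of _ c] exI[of _ "vec nc b"]) auto
next
  interpret vec_space "TYPE(complex)" n .
  assume "\<exists>u v. u \<in> carrier_vec n \<and> v \<in> carrier_vec nc \<and> u \<noteq> 0\<^sub>v n \<and> v \<noteq> 0\<^sub>v nc \<and> A = outer u v"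
  then obtain u v where uv: "u \<in> carrier_vec n" "v \<in> carrier_vec nc" "u \<noteq> 0\<^sub>v n" "v \<noteq> 0\<^sub>v nc"
    "A = outer u v" by blast
  have "rank A \<le> 1"
    by (rule rank_le_1_product_entries[OF A, of "\<lambda>i. u $ i" "\<lambda>j. v $ j"]) (simp add: uv)
  obtain i where i: "i < n" "u $ i \<noteq> 0" using nonzero_vec_index[OF uv(1,3)] by blast
  obtain j where j: "j < nc" "v $ j \<noteq> 0" using nonzero_vec_index[OF uv(2,4)] by blast
  have "col A j $ i \<noteq> 0" using i j uv by auto
  then have "col A j \<noteq> 0\<^sub>v n" using i by auto
  then have "lin_indpt {col A j}" using A by (intro lin_indpt_singleton) auto
  moreover have "col A j \<in> set (cols A)" using A j by (metis carrier_matD(2) cols_length cols_nth nth_mem)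
  ultimately have "1 \<le> rank A" using rank_ge_card_indpt[OF A, of "{col A j}"] by simp
  then show "rank A = 1" using \<open>rank A \<le> 1\<close> by simp
qed

section \<open>Polynomial multiplication\<close>

lemma one_vec_carrier: "one_vec \<in> carrier_vec 1"
  by (rule carrier_vecI) (rule one_vec_simps)

text \<open>For the empty list of factors the kernel condition also ranges over the scalar multiples of
  the empty product.\<close>

lemma kernel_decomposable_trivial:
  assumes M: "M \<in> carrier_mat m (prod_list as)"
    and inj: "\<And>xs. map dim_vec xs = as \<Longrightarrow> (\<And>x. x \<in> set xs \<Longrightarrow> x \<noteq> 0\<^sub>v (dim_vec x)) \<Longrightarrow>
      M *\<^sub>v kron_vecs xs \<noteq> 0\<^sub>v m"
  shows "mat_kernel M \<inter> decomposable_vecs as = {0\<^sub>v (prod_list as)}"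
proof (intro equalityI subsetI)
  fix z assume "z \<in> mat_kernel M \<inter> decomposable_vecs as"
  then have z: "M *\<^sub>v z = 0\<^sub>v m" "z \<in> carrier_vec (prod_list as)" "z \<in> decomposable_vecs as"
    using mat_kernelD[OF M] by auto
  then obtain xs where xs: "z = kron_vecs xs" "map dim_vec xs = (if as = [] then [1] else as)"
    by (auto simp: decomposable_vecs_def)
  have "z = 0\<^sub>v (prod_list as)"
  proof (cases "as = []")
    case True
    then obtain x where x: "xs = [x]" "dim_vec x = 1" using xs(2) by (cases xs) auto
    then have zc: "z = x $ 0 \<cdot>\<^sub>v one_vec"
      by (intro eq_vecI) (auto simp: xs(1))
    have M1: "M \<in> carrier_mat m 1" using M True by simp
    have "M *\<^sub>v one_vec \<noteq> 0\<^sub>v m" using inj[of "[]"] True by simp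
    moreover have Mz: "M *\<^sub>v z = x $ 0 \<cdot>\<^sub>v (M *\<^sub>v one_vec)"
      unfolding zc by (rule mult_mat_vec[OF M1 one_vec_carrier])
    moreover have "M *\<^sub>v one_vec \<in> carrier_vec m" by (rule mult_mat_vec_carrier[OF M1 one_vec_carrier])
    ultimately obtain i where i: "i < m" "(M *\<^sub>v one_vec) $ i \<noteq> 0"
      using nonzero_vec_index by blast
    have "(x $ 0 \<cdot>\<^sub>v (M *\<^sub>v one_vec)) $ i = 0\<^sub>v m $ i"
      using z(1) Mz by simp
    then have "x $ 0 = 0" using i M by simp
    then show ?thesis using zc True by (intro eq_vecI) auto
  next
    case False
    then have d: "map dim_vec xs = as" using xs by simp
    have "\<exists>x\<in>set xs. x = 0\<^sub>v (dim_vec x)"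
    proof (rule ccontr)
      assume "\<not> ?thesis"
      then have "M *\<^sub>v kron_vecs xs \<noteq> 0\<^sub>v m" by (intro inj[OF d]) blast
      then show False using z(1) by (simp only: xs(1))
    qed
    then show ?thesis using kron_vecs_zero unfolding d[symmetric] xs(1) by blast
  qed
  then show "z \<in> {0\<^sub>v (prod_list as)}" by simp
next
  fix z :: "complex vec"
  assume "z \<in> {0\<^sub>v (prod_list as)}"
  then have z: "z = 0\<^sub>v (prod_list as)" by simp
  define bs where "bs = (if as = [] then [1] else as)"
  define zs :: "complex vec list" where "zs = map 0\<^sub>v bs"
  have "bs \<noteq> []" "prod_list bs = prod_list as" by (simp_all add: bs_def)
  have zs: "map dim_vec zs = bs" by (simp add: zs_def comp_def)
  have "0\<^sub>v (hd bs) \<in> set zs" using \<open>bs \<noteq> []\<close> by (simp add: zs_def)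
  then have "kron_vecs zs = z"
    using kron_vecs_zero[of "0\<^sub>v (hd bs)" zs] zs \<open>prod_list bs = _\<close> z by simp
  then have "z \<in> decomposable_vecs as"
    using zs unfolding decomposable_vecs_def bs_def by blast
  moreover have "z \<in> mat_kernel M"
    unfolding z
  proof (rule mat_kernelI[OF M])
    show "M *\<^sub>v 0\<^sub>v (prod_list as) = 0\<^sub>v m" using M by (intro eq_vecI) auto
  qed simp
  ultimately show "z \<in> mat_kernel M \<inter> decomposable_vecs as" by simp
qed

lemma kron_vecs_in_decomposable:
  assumes "map dim_vec xs = as"
  shows "kron_vecs xs \<in> decomposable_vecs as"
proof (cases "as = []")
  case True
  then have "kron_vecs xs = kron_vecs [one_vec]" using assms by simp
  then show ?thesis unfolding decomposable_vecs_def using True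
    by (intro CollectI exI[of _ "[one_vec]"]) simp
qed (use assms in \<open>auto simp: decomposable_vecs_def\<close>)

definition poly_of_vec :: "complex vec \<Rightarrow> complex poly" where
  "poly_of_vec x = (\<Sum>i<dim_vec x. monom (x $ i) i)"

lemma coeff_poly_of_vec: "coeff (poly_of_vec x) i = (if i < dim_vec x then x $ i else 0)"
  by (simp add: poly_of_vec_def coeff_sum)

lemma poly_of_vec_add: "dim_vec y = dim_vec x \<Longrightarrow> poly_of_vec (x + y) = poly_of_vec x + poly_of_vec y"
  by (rule poly_eqI) (simp add: coeff_poly_of_vec)

lemma poly_of_vec_smult: "poly_of_vec (c \<cdot>\<^sub>v x) = smult c (poly_of_vec x)"
  by (rule poly_eqI) (simp add: coeff_poly_of_vec)

lemma poly_of_vec_eq_0: "poly_of_vec x = 0 \<Longrightarrow> x = 0\<^sub>v (dim_vec x)"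
  by (intro eq_vecI) (metis coeff_0 coeff_poly_of_vec index_zero_vec, simp)

lemma degree_poly_of_vec: "degree (poly_of_vec x) \<le> dim_vec x - 1"
  by (intro degree_le) (auto simp: coeff_poly_of_vec)

text \<open>The matrix of polynomial multiplication: a product of nonzero polynomials is nonzero.\<close>

theorem decomposable_avoiding_matrix:
  assumes m: "1 + (\<Sum>a\<leftarrow>as. a - 1) \<le> m"
  shows "\<exists>M\<in>carrier_mat m (prod_list as). mat_kernel M \<inter> decomposable_vecs as = {0\<^sub>v (prod_list as)}"
proof -
  define G where "G xs p = coeff (\<Prod>x\<leftarrow>xs. poly_of_vec x) p" for xs p
  have "multilinear_list as (\<lambda>xs. G xs p)" for p
    unfolding multilinear_list_def G_def
    by (auto simp: poly_of_vec_add poly_of_vec_smult algebra_simps)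
  then obtain M where M: "M \<in> carrier_mat m (prod_list as)"
    "\<And>xs. map dim_vec xs = as \<Longrightarrow> M *\<^sub>v kron_vecs xs = vec m (G xs)"
    using kron_vecs_universal by blast
  have "M *\<^sub>v kron_vecs xs \<noteq> 0\<^sub>v m"
    if xs: "map dim_vec xs = as" and nz: "\<And>x. x \<in> set xs \<Longrightarrow> x \<noteq> 0\<^sub>v (dim_vec x)" for xs
  proof -
    let ?q = "\<Prod>x\<leftarrow>xs. poly_of_vec x"
    have "poly_of_vec x \<noteq> 0" if "x \<in> set xs" for x using nz[OF that] poly_of_vec_eq_0 by blast
    then have "?q \<noteq> 0" by (force simp: prod_list_zero_iff)
    have "degree ?q \<le> (\<Sum>x\<leftarrow>xs. degree (poly_of_vec x))"
      by (induction xs) (auto intro: order_trans[OF degree_mult_le])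
    also have "\<dots> \<le> (\<Sum>x\<leftarrow>xs. dim_vec x - 1)" by (intro sum_list_mono degree_poly_of_vec)
    also have "\<dots> = (\<Sum>a\<leftarrow>as. a - 1)" unfolding xs[symmetric] by (simp add: comp_def)
    \<comment> \<open>The summand 1 in the bound enters here: the leading coefficient must still be
      among the \<open>m\<close> recorded ones.\<close>
    finally have "degree ?q < m" using m by simp
    moreover have "coeff ?q (degree ?q) \<noteq> 0" using \<open>?q \<noteq> 0\<close> by simp
    ultimately have "vec m (G xs) $ degree ?q \<noteq> 0" by (simp add: G_def)
    then have "vec m (G xs) \<noteq> 0\<^sub>v m" using \<open>degree ?q < m\<close> by (metis index_zero_vec(1))
    then show ?thesis by (simp only: M(2)[OF xs] not_False_eq_True)
  qed
  then show ?thesis using kernel_decomposable_trivial M(1) by blast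
qed

section \<open>Kronecker products of matrices\<close>

lemma kron_outer: "outer a b \<otimes>\<^sub>K outer c d = outer (a \<otimes>\<^sub>v c) (b \<otimes>\<^sub>v d)"
  by (rule eq_matI) (auto simp: kron_def index_kron_vec div_less_prod mod_less_prod)

lemma one_mat_outer: "1\<^sub>m 1 = outer one_vec one_vec"
  by (rule eq_matI) auto

lemma kron_prod_outer:
  assumes "\<And>i. i \<in> P \<Longrightarrow> F i = outer (a i) (b i)" "finite P"
  shows "kron_prod P F = outer (kron_vecs (map a (sorted_list_of_set P))) (kron_vecs (map b (sorted_list_of_set P)))"
proof -
  have "foldr kron (map F l) (1\<^sub>m 1) = outer (kron_vecs (map a l)) (kron_vecs (map b l))"
    if "set l \<subseteq> P" for l
    using that by (induction l) (auto simp: one_mat_outer kron_outer assms(1))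
  then show ?thesis using assms(2) by (simp add: kron_prod_def)
qed

lemma vectorize_outer: "vectorize (outer x y) = outer (x \<otimes>\<^sub>v y) one_vec"
  by (rule eq_matI) (auto simp: vectorize_def index_kron_vec div_less_prod mod_less_prod)

lemma transpose_outer: "transpose_mat (outer x y) = outer y x"
  by (rule eq_matI) auto

lemma mult_outer_transpose:
  assumes "M \<in> carrier_mat m (dim_vec u)" "N \<in> carrier_mat m' (dim_vec v)"
  shows "M * outer u v * transpose_mat N = outer (M *\<^sub>v u) (N *\<^sub>v v)"
proof (rule eq_matI)
  fix i j assume "i < dim_row (outer (M *\<^sub>v u) (N *\<^sub>v v))" "j < dim_col (outer (M *\<^sub>v u) (N *\<^sub>v v))"
  then have ij: "i < m" "j < m'" using assms by auto
  have Mu: "(M * outer u v) $$ (i, b) = (\<Sum>a<dim_vec u. M $$ (i, a) * u $ a) * v $ b" if "b < dim_vec v" for b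
    using assms ij that by (simp add: scalar_prod_def atLeast0LessThan sum_distrib_right mult.assoc)
  have "(M * outer u v * transpose_mat N) $$ (i, j) = (\<Sum>b<dim_vec v. (M * outer u v) $$ (i, b) * N $$ (j, b))"
    using assms ij by (simp add: scalar_prod_def atLeast0LessThan)
  also have "\<dots> = (\<Sum>b<dim_vec v. (\<Sum>a<dim_vec u. M $$ (i, a) * u $ a) * (N $$ (j, b) * v $ b))"
    by (intro sum.cong) (simp_all add: Mu)
  also have "\<dots> = outer (M *\<^sub>v u) (N *\<^sub>v v) $$ (i, j)"
    using assms ij by (simp add: scalar_prod_def atLeast0LessThan sum_distrib_left)
  finally show "(M * outer u v * transpose_mat N) $$ (i, j) = outer (M *\<^sub>v u) (N *\<^sub>v v) $$ (i, j)" .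
qed (use assms in auto)

definition kron_arg :: "(nat \<Rightarrow> nat set) \<Rightarrow> (nat \<Rightarrow> complex mat) \<Rightarrow> complex mat" where
  "kron_arg P A = kron_prod (P 1) A \<otimes>\<^sub>K kron_prod (P 2) (\<lambda>i. transpose_mat (A i)) \<otimes>\<^sub>K
     kron_prod (P 3) (\<lambda>i. vectorize (A i)) \<otimes>\<^sub>K kron_prod (P 4) (\<lambda>i. transpose_mat (vectorize (A i)))"

text \<open>The tensor factors on which \<open>M\<close> (with \<open>Q = P 3\<close>) and, after exchanging \<open>x\<close> and \<open>y\<close>,
  \<open>N\<close> (with \<open>Q = P 4\<close>) act when \<open>A i = x i (y i)\<^sup>T\<close>.\<close>

definition factor_list :: "(nat \<Rightarrow> nat set) \<Rightarrow> nat set \<Rightarrow> (nat \<Rightarrow> 'a) \<Rightarrow> (nat \<Rightarrow> 'a) \<Rightarrow> (nat \<Rightarrow> 'a) \<Rightarrow> (nat \<Rightarrow> 'a) \<Rightarrow> 'a list" where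
  "factor_list P Q x y x' y' = map x (sorted_list_of_set (P 1)) @ map y (sorted_list_of_set (P 2)) @
     concat (map (\<lambda>j. [x' j, y' j]) (sorted_list_of_set Q))"

text \<open>\<open>vectorize\<close> puts both vectors on the left and \<open>one_vec\<close> on the
  right, and its transpose does the reverse, so \<open>P 3\<close> contributes only to the left
  vector and \<open>P 4\<close> only to the right one. Within such a pair the order is
  \<open>x\<close>, \<open>y\<close> on both sides, whereas the roles in \<open>P 1\<close> and
  \<open>P 2\<close> are exchanged on the right.\<close>

lemma kron_arg_outer:
  assumes "\<And>l. finite (P l)" "\<And>i l. i \<in> P l \<Longrightarrow> l \<in> {1..4} \<Longrightarrow> A i = outer (x i) (y i)"
  shows "kron_arg P A = outer (kron_vecs (factor_list P (P 3) x y x y)) (kron_vecs (factor_list P (P 4) y x x y))"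
proof -
  have "kron_prod (P 1) A = outer (kron_vecs (map x (sorted_list_of_set (P 1)))) (kron_vecs (map y (sorted_list_of_set (P 1))))"
    using assms by (intro kron_prod_outer) auto
  moreover have "kron_prod (P 2) (\<lambda>i. transpose_mat (A i)) =
      outer (kron_vecs (map y (sorted_list_of_set (P 2)))) (kron_vecs (map x (sorted_list_of_set (P 2))))"
    using assms(2)[of _ 2] assms(1) by (intro kron_prod_outer) (auto simp: transpose_outer)
  moreover have "kron_prod (P 3) (\<lambda>i. vectorize (A i)) =
      outer (kron_vecs (map (\<lambda>i. x i \<otimes>\<^sub>v y i) (sorted_list_of_set (P 3)))) (kron_vecs (map (\<lambda>_. one_vec) (sorted_list_of_set (P 3))))"
    using assms(2)[of _ 3] assms(1) by (intro kron_prod_outer) (auto simp: vectorize_outer)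
  moreover have "kron_prod (P 4) (\<lambda>i. transpose_mat (vectorize (A i))) =
      outer (kron_vecs (map (\<lambda>_. one_vec) (sorted_list_of_set (P 4)))) (kron_vecs (map (\<lambda>i. x i \<otimes>\<^sub>v y i) (sorted_list_of_set (P 4))))"
    using assms(2)[of _ 4] assms(1) by (intro kron_prod_outer) (auto simp: vectorize_outer transpose_outer)
  ultimately show ?thesis
    by (simp add: kron_arg_def kron_outer factor_list_def kron_vecs_append kron_vecs_concat_pairs kron_vecs_const_one)
qed

lemma dims_factor_list:
  assumes "\<And>i. i \<in> P 1 \<union> P 2 \<union> Q \<Longrightarrow> dim_vec (x i) = n i \<and> dim_vec (y i) = n i"
    "\<And>l. finite (P l)" "finite Q"
  shows "map dim_vec (factor_list P Q x y x y) = factor_dims n P Q"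
    "map dim_vec (factor_list P Q x y y x) = factor_dims n P Q"
  using assms by (auto simp: factor_list_def factor_dims_def map_concat comp_def intro!: arg_cong[of _ _ concat])

lemma set_factor_list:
  assumes "\<And>l. finite (P l)" "finite Q"
  shows "set (factor_list P Q x y x' y') = x ` P 1 \<union> y ` P 2 \<union> x' ` Q \<union> y' ` Q"
  using assms by (auto simp: factor_list_def)

lemma prod_list_pairs: "prod_list (concat (map (\<lambda>j. [n j, n j]) l)) = (prod_list (map n l))\<^sup>2" for n :: "'a \<Rightarrow> nat"
  by (induction l) (auto simp: power2_eq_square)

lemma sum_list_pairs: "sum_list (concat (map (\<lambda>j. [n j, n j]) l)) = 2 * sum_list (map n l)" for n :: "'a \<Rightarrow> nat"
  by (induction l) auto

lemma prod_list_factor_dims: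
  assumes "finite (P 1)" "finite (P 2)" "finite Q"
  shows "prod_list (factor_dims n P Q) = (\<Prod>i\<in>P 1. n i) * (\<Prod>i\<in>P 2. n i) * (\<Prod>i\<in>Q. n i)\<^sup>2"
proof -
  have "prod_list (map n (sorted_list_of_set R)) = (\<Prod>i\<in>R. n i)" if "finite R" for R
    using that prod.distinct_set_conv_list[of "sorted_list_of_set R" n] by simp
  then show ?thesis using assms by (simp add: factor_dims_def prod_list_pairs mult.assoc)
qed

lemma sum_list_factor_dims:
  assumes "finite (P 1)" "finite (P 2)" "finite Q"
  shows "(\<Sum>a\<leftarrow>factor_dims n P Q. a - 1) = (\<Sum>i\<in>P 1. n i - 1) + (\<Sum>i\<in>P 2. n i - 1) + 2 * (\<Sum>i\<in>Q. n i - 1)"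
proof -
  have "sum_list (map (\<lambda>i. n i - 1) (sorted_list_of_set R)) = (\<Sum>i\<in>R. n i - 1)" if "finite R" for R
    using that sum.distinct_set_conv_list[of "sorted_list_of_set R" "\<lambda>i. n i - 1"] by simp
  then show ?thesis
    using assms sum_list_pairs[of "\<lambda>i. n i - 1"]
    by (simp add: factor_dims_def map_concat comp_def)
qed

section \<open>Dimensions and additivity of Kronecker products of matrices\<close>

lemma kron_dims [simp]: "dim_row (A \<otimes>\<^sub>K B) = dim_row A * dim_row B" "dim_col (A \<otimes>\<^sub>K B) = dim_col A * dim_col B"
  by (simp_all add: kron_def)

lemma kron_add:
  assumes "dim_row A = dim_row A'" "dim_col A = dim_col A'"
  shows "(A + A') \<otimes>\<^sub>K B = A \<otimes>\<^sub>K B + A' \<otimes>\<^sub>K B" "B \<otimes>\<^sub>K (A + A') = B \<otimes>\<^sub>K A + B \<otimes>\<^sub>K A'"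
  using assms by (auto intro!: eq_matI simp: kron_def div_less_prod mod_less_prod distrib_left distrib_right)

lemma dim_kron_prod:
  assumes "finite P"
  shows "dim_row (kron_prod P F) = (\<Prod>i\<in>P. dim_row (F i))" "dim_col (kron_prod P F) = (\<Prod>i\<in>P. dim_col (F i))"
proof -
  have "dim_row (foldr kron (map F l) (1\<^sub>m 1)) = prod_list (map (\<lambda>i. dim_row (F i)) l)"
    "dim_col (foldr kron (map F l) (1\<^sub>m 1)) = prod_list (map (\<lambda>i. dim_col (F i)) l)" for l
    by (induction l) auto
  then show "dim_row (kron_prod P F) = (\<Prod>i\<in>P. dim_row (F i))" "dim_col (kron_prod P F) = (\<Prod>i\<in>P. dim_col (F i))"
    using assms prod.distinct_set_conv_list[of "sorted_list_of_set P" "\<lambda>i. dim_row (F i)"]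
      prod.distinct_set_conv_list[of "sorted_list_of_set P" "\<lambda>i. dim_col (F i)"]
    by (simp_all add: kron_prod_def)
qed

lemma kron_prod_cong: "finite P \<Longrightarrow> (\<And>i. i \<in> P \<Longrightarrow> F i = G i) \<Longrightarrow> kron_prod P F = kron_prod P G"
  unfolding kron_prod_def by (metis (mono_tags, lifting) map_cong set_sorted_list_of_set)

lemma kron_prod_upd_add:
  assumes "finite P" "i \<in> P" "dim_row X = dim_row Y" "dim_col X = dim_col Y"
  shows "kron_prod P (F(i := X + Y)) = kron_prod P (F(i := X)) + kron_prod P (F(i := Y))"
proof -
  have notin: "foldr kron (map (F(i := Z)) l) B = foldr kron (map F l) B" if "i \<notin> set l" for Z B l
    using that by (simp add: map_fun_upd)
  have dims: "dim_row (foldr kron (map (F(i := X)) l) (1\<^sub>m 1)) = dim_row (foldr kron (map (F(i := Y)) l) (1\<^sub>m 1))"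
    "dim_col (foldr kron (map (F(i := X)) l) (1\<^sub>m 1)) = dim_col (foldr kron (map (F(i := Y)) l) (1\<^sub>m 1))" for l
    using assms by (induction l) auto
  have "foldr kron (map (F(i := X + Y)) l) (1\<^sub>m 1)
      = foldr kron (map (F(i := X)) l) (1\<^sub>m 1) + foldr kron (map (F(i := Y)) l) (1\<^sub>m 1)"
    if "distinct l" "i \<in> set l" for l
    using that
  proof (induction l)
    case (Cons a l)
    have step: "foldr kron (map (F(i := Z)) (a # l)) (1\<^sub>m 1)
        = (F(i := Z)) a \<otimes>\<^sub>K foldr kron (map (F(i := Z)) l) (1\<^sub>m 1)" for Z by simp
    show ?case
    proof (cases "a = i")
      case True
      then have "i \<notin> set l" using Cons.prems by simp
      then show ?thesis unfolding step using True assms by (simp only: notin[OF \<open>i \<notin> set l\<close>] kron_add fun_upd_same)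
    next
      case False
      have ih: "foldr kron (map (F(i := X + Y)) l) (1\<^sub>m 1)
          = foldr kron (map (F(i := X)) l) (1\<^sub>m 1) + foldr kron (map (F(i := Y)) l) (1\<^sub>m 1)"
        by (rule Cons.IH) (use Cons.prems False in auto)
      have "(F(i := Z)) a = F a" for Z using False by simp
      then show ?thesis unfolding step ih by (simp only: kron_add dims)
    qed
  qed simp
  then show ?thesis using assms(1,2) by (simp add: kron_prod_def)
qed

lemma kron_prod_upd_notin: "finite P \<Longrightarrow> i \<notin> P \<Longrightarrow> kron_prod P (F(i := X)) = kron_prod P F"
  by (rule kron_prod_cong) auto

section \<open>Existence of admissible pairs\<close>

lemma two_mult_minus_one_le: "w \<le> 2 \<Longrightarrow> 2 \<le> p \<Longrightarrow> 2 \<le> a \<Longrightarrow> q \<le> p \<Longrightarrow> w * (a - 1) + q \<le> a * p"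
  for w p q a :: nat
proof -
  assume *: "w \<le> 2" "2 \<le> p" "2 \<le> a" "q \<le> p"
  have "w * (a - 1) \<le> p * (a - 1)" using * by (intro mult_right_mono) auto
  moreover have "p * (a - 1) + p = a * p" using * by (cases a) auto
  ultimately show ?thesis using *(4) by linarith
qed

text \<open>It is enough to check the bound on a nonempty subset: a further index adds at most
  \<open>2 * (n i - 1)\<close> on the left, while the product, already at least 2, grows by
  \<open>n i - 1\<close> times itself.\<close>

lemma weighted_sum_le_prod:
  fixes n w :: "'i \<Rightarrow> nat"
  assumes K: "finite K" "\<And>i. i \<in> K \<Longrightarrow> 2 \<le> n i" "\<And>i. i \<in> K \<Longrightarrow> w i \<le> 2"
    and S: "S \<subseteq> K" "S \<noteq> {}" "1 + (\<Sum>i\<in>S. w i * (n i - 1)) \<le> (\<Prod>i\<in>S. n i)"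
  shows "1 + (\<Sum>i\<in>K. w i * (n i - 1)) \<le> (\<Prod>i\<in>K. n i)"
proof -
  have finS: "finite S" using S K finite_subset by blast
  have "1 + (\<Sum>i\<in>S \<union> R. w i * (n i - 1)) \<le> (\<Prod>i\<in>S \<union> R. n i)" if "R \<subseteq> K - S" "finite R" for R
    using that(2,1)
  proof (induction R rule: finite_induct)
    case (insert i R)
    have fin: "finite (S \<union> R)" "i \<notin> S \<union> R" using finS insert by auto
    obtain j where j: "j \<in> S" using S(2) by blast
    have "2 \<le> n j" using j S K by blast
    also have "n j \<le> (\<Prod>i\<in>S \<union> R. n i)"
    proof (rule dvd_imp_le)
      show "n j dvd (\<Prod>i\<in>S \<union> R. n i)" using j fin by (intro dvd_prodI) auto
      have "0 < n i" if "i \<in> S \<union> R" for i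
        using that K(2)[of i] S(1) insert.prems by fastforce
      then show "0 < (\<Prod>i\<in>S \<union> R. n i)" by (intro prod_pos) blast
    qed
    finally have p: "2 \<le> (\<Prod>i\<in>S \<union> R. n i)" .
    have i: "2 \<le> n i" "w i \<le> 2" using insert.prems K by auto
    have "w i * (n i - 1) + (1 + (\<Sum>i\<in>S \<union> R. w i * (n i - 1))) \<le> n i * (\<Prod>i\<in>S \<union> R. n i)"
      using insert by (intro two_mult_minus_one_le p i) auto
    then show ?case using fin by simp
  qed (use S in simp)
  from this[of "K - S"] show ?thesis using K(1) S(1) by (simp add: Un_absorb1)
qed

text \<open>Three indices of weight 2 always fit, though tightly: for dimensions 2, 2, 2 the bound
  reads \<open>7 \<le> 8\<close>.\<close>

lemma three_factor_bound:
  fixes a b c :: nat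
  assumes "2 \<le> a" "2 \<le> b" "2 \<le> c"
  shows "1 + (2 * (a - 1) + (2 * (b - 1) + 2 * (c - 1))) \<le> a * (b * c)"
proof -
  obtain x y z where "a = 2 + x" "b = 2 + y" "c = 2 + z" using assms by (metis le_iff_add)
  then show ?thesis by (simp add: algebra_simps)
qed

text \<open>Right side minus left side is \<open>(a - 2) * (b - 2) - 1\<close>, so two indices of
  weight 2 fit as long as neither dimension is 2.\<close>

lemma two_factor_bound:
  fixes a b :: nat
  assumes "3 \<le> a" "3 \<le> b"
  shows "1 + (2 * (a - 1) + 2 * (b - 1)) \<le> a * b"
proof -
  obtain x y where "a = 3 + x" "b = 3 + y" using assms by (metis le_iff_add)
  then show ?thesis by (simp add: algebra_simps)
qed

text \<open>The weight of an index is the number of tensor factors it contributes: 1, 2 or 0. The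
  subset that starts \<open>weighted_sum_le_prod\<close> is a single index outside \<open>Q\<close>;
  if \<open>Q\<close> is everything, it is two indices of dimension at least 3 or any three
  indices.\<close>

lemma factor_dims_bound:
  fixes n :: "nat \<Rightarrow> nat"
  assumes k: "2 \<le> k" and n: "\<forall>i\<in>{1..k}. 2 \<le> n i"
    and R: "R1 \<subseteq> {1..k}" "R2 \<subseteq> {1..k}" "Q \<subseteq> {1..k}" "R1 \<inter> R2 = {}" "R1 \<inter> Q = {}" "R2 \<inter> Q = {}"
    and ne: "\<not> (k = 2 \<and> 2 \<in> {n 1, n 2} \<and> Q = {1..k})"
  shows "1 + ((\<Sum>i\<in>R1. n i - 1) + (\<Sum>i\<in>R2. n i - 1) + 2 * (\<Sum>i\<in>Q. n i - 1)) \<le> (\<Prod>i=1..k. n i)"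
proof -
  define w :: "nat \<Rightarrow> nat" where "w i = (if i \<in> R1 then 1 else if i \<in> R2 then 1 else if i \<in> Q then 2 else 0)" for i
  have "(\<Sum>i=1..k. w i * (n i - 1)) = (\<Sum>i=1..k. (if i \<in> R1 then n i - 1 else 0)
      + (if i \<in> R2 then n i - 1 else 0) + 2 * (if i \<in> Q then n i - 1 else 0))"
    using R by (intro sum.cong) (auto simp: w_def)
  also have "\<dots> = (\<Sum>i\<in>R1. n i - 1) + (\<Sum>i\<in>R2. n i - 1) + 2 * (\<Sum>i\<in>Q. n i - 1)"
    using R by (simp add: sum.distrib sum_distrib_left[symmetric] sum.inter_restrict[symmetric] Int_absorb1)
  finally have eq: "(\<Sum>i=1..k. w i * (n i - 1)) = (\<Sum>i\<in>R1. n i - 1) + (\<Sum>i\<in>R2. n i - 1) + 2 * (\<Sum>i\<in>Q. n i - 1)" .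
  have w2: "w i \<le> 2" for i by (simp add: w_def)
  have "\<exists>S. S \<subseteq> {1..k} \<and> S \<noteq> {} \<and> 1 + (\<Sum>i\<in>S. w i * (n i - 1)) \<le> (\<Prod>i\<in>S. n i)"
  proof (cases "Q = {1..k}")
    case False
    then obtain i where i: "i \<in> {1..k}" "i \<notin> Q" using R by blast
    then have "w i \<le> 1" "2 \<le> n i" using n by (auto simp: w_def)
    then have "w i * (n i - 1) \<le> 1 * (n i - 1)" by (intro mult_right_mono) auto
    then have "1 + w i * (n i - 1) \<le> n i" using \<open>2 \<le> n i\<close> by linarith
    then show ?thesis using i by (intro exI[of _ "{i}"]) auto
  next
    case True
    then have w: "w i = 2" if "i \<in> {1..k}" for i using that R by (auto simp: w_def)
    show ?thesis
    proof (cases "k = 2")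
      case True
      then have "n 1 \<noteq> 2" "n 2 \<noteq> 2" "2 \<le> n 1" "2 \<le> n 2" using ne n \<open>Q = _\<close> by auto
      then have "1 + (2 * (n 1 - 1) + 2 * (n 2 - 1)) \<le> n 1 * n 2" by (intro two_factor_bound) auto
      then show ?thesis using True w[of 1] w[of 2] by (intro exI[of _ "{1, 2}"]) auto
    next
      case False
      then have "1 + (2 * (n 1 - 1) + (2 * (n 2 - 1) + 2 * (n 3 - 1))) \<le> n 1 * (n 2 * n 3)"
        using n k by (intro three_factor_bound) auto
      then show ?thesis using False k w[of 1] w[of 2] w[of 3] by (intro exI[of _ "{1, 2, 3}"]) auto
    qed
  qed
  then obtain S where S: "S \<subseteq> {1..k}" "S \<noteq> {}" "1 + (\<Sum>i\<in>S. w i * (n i - 1)) \<le> (\<Prod>i\<in>S. n i)" by blast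
  have "1 + (\<Sum>i=1..k. w i * (n i - 1)) \<le> (\<Prod>i=1..k. n i)"
    by (rule weighted_sum_le_prod[OF _ _ _ S]) (use n w2 in auto)
  then show ?thesis unfolding eq .
qed

lemma indexed_partitionD:
  assumes "indexed_partition 4 K P"
  shows "P 1 \<union> P 2 \<union> P 3 \<union> P 4 = K" "\<And>l l'. l \<in> {1..4} \<Longrightarrow> l' \<in> {1..4} \<Longrightarrow> l \<noteq> l' \<Longrightarrow> P l \<inter> P l' = {}"
proof -
  have "{1..4::nat} = {1, 2, 3, 4}" by auto
  then show "P 1 \<union> P 2 \<union> P 3 \<union> P 4 = K" using assms by (auto simp: indexed_partition_def)
  show "\<And>l l'. l \<in> {1..4} \<Longrightarrow> l' \<in> {1..4} \<Longrightarrow> l \<noteq> l' \<Longrightarrow> P l \<inter> P l' = {}"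
    using assms by (auto simp: indexed_partition_def disjoint_family_on_def)
qed

lemma admissible_pair_exists:
  assumes k: "2 \<le> k" and n: "\<forall>i\<in>{1..k}. 2 \<le> n i" and m: "m = (\<Prod>i=1..k. n i)"
    and P: "indexed_partition 4 {1..k} P"
    and ne: "\<not> (k = 2 \<and> 2 \<in> {n 1, n 2} \<and> (P 3 = {1..k} \<or> P 4 = {1..k}))"
  shows "\<exists>M N. admissible_pair m n P M N"
proof -
  have U: "P 1 \<union> P 2 \<union> P 3 \<union> P 4 = {1..k}" by (rule indexed_partitionD(1)[OF P])
  have sub: "P 1 \<subseteq> {1..k}" "P 2 \<subseteq> {1..k}" "P 3 \<subseteq> {1..k}" "P 4 \<subseteq> {1..k}" using U by blast+
  have fin: "finite (P 1)" "finite (P 2)" "finite (P 3)" "finite (P 4)"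
    using sub by (meson finite_atLeastAtMost finite_subset)+
  note d = indexed_partitionD(2)[OF P]
  have "\<exists>M\<in>carrier_mat m (prod_list (factor_dims n P Q)).
      mat_kernel M \<inter> decomposable_vecs (factor_dims n P Q) = {0\<^sub>v (prod_list (factor_dims n P Q))}"
    if Q: "Q \<in> {P 3, P 4}" for Q
  proof (rule decomposable_avoiding_matrix)
    have "finite Q" "Q \<subseteq> {1..k}" "P 1 \<inter> Q = {}" "P 2 \<inter> Q = {}" "P 1 \<inter> P 2 = {}"
      using Q fin sub d[of 1 3] d[of 1 4] d[of 2 3] d[of 2 4] d[of 1 2] by auto
    moreover have "\<not> (k = 2 \<and> 2 \<in> {n 1, n 2} \<and> Q = {1..k})" using ne Q by blast
    ultimately show "1 + (\<Sum>a\<leftarrow>factor_dims n P Q. a - 1) \<le> m"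
      unfolding m using sum_list_factor_dims[of P Q n] fin factor_dims_bound[OF k n sub(1,2), of Q] by simp
  qed
  from this[of "P 3"] this[of "P 4"] show ?thesis
    unfolding admissible_pair_def Let_def using prod_list_factor_dims[of P _ n] fin by auto
qed

text \<open>When one of the dimensions is 2, \<open>n 1 * n 2\<close> equals
  \<open>2 * (n 1 - 1) + 2 * (n 2 - 1)\<close>. So \<open>m\<close> is exactly the dimension of the
  Segre variety of the four factors, one row short of what is needed. Depending on \<open>P\<close>,
  the impossible matrix is \<open>M\<close> or \<open>N\<close>.\<close>

lemma no_admissible_pair:
  assumes k: "k = 2" and n: "\<forall>i\<in>{1..k}. 2 \<le> n i" and m: "m = (\<Prod>i=1..k. n i)" and n2: "2 \<in> {n 1, n 2}"
    and P: "(P 1, P 2, P 3, P 4) = ({}, {}, {1..k}, {}) \<or> (P 1, P 2, P 3, P 4) = ({}, {}, {}, {1..k})"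
  shows "\<not> admissible_pair m n P M N"
proof
  assume adm: "admissible_pair m n P M N"
  have K: "{1..k} = {1, 2}" using k by auto
  have n12: "2 \<le> n 1" "2 \<le> n 2" using n K by auto
  have m12: "m = n 1 * n 2" using m K by simp
  define as where "as = [n 1, n 1, n 2, n 2]"
  have sl: "sorted_list_of_set {1, 2} = [1, 2 :: nat]"
    using sorted_list_of_set.idem_if_sorted_distinct[of "[1, 2 :: nat]"] by simp
  have "\<exists>M. M \<in> carrier_mat m (prod_list as) \<and>
      mat_kernel M \<inter> decomposable_vecs as = {0\<^sub>v (prod_list as)}"
    using P
  proof
    assume P: "(P 1, P 2, P 3, P 4) = ({}, {}, {1..k}, {})"
    then have P': "P 1 = {}" "P 2 = {}" "P 3 = {1, 2}" using K by simp_all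
    then have "factor_dims n P (P 3) = as" by (simp only: factor_dims_def as_def sl) simp
    moreover have "prod_list as = (\<Prod>i\<in>P 3. n i)\<^sup>2" using P' by (simp add: as_def power2_eq_square)
    ultimately show ?thesis using adm P unfolding admissible_pair_def Let_def by (intro exI[of _ M]) auto
  next
    assume P: "(P 1, P 2, P 3, P 4) = ({}, {}, {}, {1..k})"
    then have P': "P 1 = {}" "P 2 = {}" "P 4 = {1, 2}" using K by simp_all
    then have "factor_dims n P (P 4) = as" by (simp only: factor_dims_def as_def sl) simp
    moreover have "prod_list as = (\<Prod>i\<in>P 4. n i)\<^sup>2" using P' by (simp add: as_def power2_eq_square)
    ultimately show ?thesis using adm P unfolding admissible_pair_def Let_def by (intro exI[of _ N]) auto
  qed
  then obtain M where M: "M \<in> carrier_mat m (prod_list as)"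
    "mat_kernel M \<inter> decomposable_vecs as = {0\<^sub>v (prod_list as)}" by blast
  have "(\<Sum>j<length as. as ! j - 1) = 2 * (n 1 - 1) + 2 * (n 2 - 1)"
    by (simp add: as_def eval_nat_numeral lessThan_Suc)
  moreover have "n 1 * n 2 = 2 * (n 1 - 1) + 2 * (n 2 - 1)"
  proof -
    obtain x y where "n 1 = 2 + x" "n 2 = 2 + y" using n12 by (metis le_iff_add)
    then show ?thesis using n2 by auto
  qed
  ultimately have "m \<le> (\<Sum>j<length as. as ! j - 1)" using m12 by simp
  then obtain xs where xs: "map dim_vec xs = as" "kron_vecs xs \<noteq> 0\<^sub>v (prod_list as)" "M *\<^sub>v kron_vecs xs = 0\<^sub>v m"
    using decomposable_kernel_vector[OF _ M(1)] n12 m12 by (force simp: as_def)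
  have "kron_vecs xs \<in> mat_kernel M"
    by (rule mat_kernelI[OF M(1) _ xs(3)]) (auto simp: xs(1) intro: carrier_vecI)
  then show False using M(2) kron_vecs_in_decomposable[OF xs(1)] xs(2) by blast
qed

section \<open>Preservers of rank one\<close>

lemma index_kron:
  assumes "p < dim_row A" "q < dim_col A" "r < dim_row B" "s < dim_col B"
  shows "(A \<otimes>\<^sub>K B) $$ (p * dim_row B + r, q * dim_col B + s) = A $$ (p, q) * B $$ (r, s)"
  using assms by (simp add: kron_def mult_add_less mult_add_div)

text \<open>A nonzero entry of one factor exhibits the other factor, up to a scalar, as a submatrix
  of the given outer product.\<close>

lemma kron_eq_outerD:
  assumes eq: "A \<otimes>\<^sub>K B = outer u v" and nz: "u \<noteq> 0\<^sub>v (dim_vec u)" "v \<noteq> 0\<^sub>v (dim_vec v)"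
  shows "\<exists>a b. A = outer a b \<and> a \<noteq> 0\<^sub>v (dim_vec a) \<and> b \<noteq> 0\<^sub>v (dim_vec b)"
    "\<exists>c d. B = outer c d \<and> c \<noteq> 0\<^sub>v (dim_vec c) \<and> d \<noteq> 0\<^sub>v (dim_vec d)"
proof -
  have dims: "dim_vec u = dim_row A * dim_row B" "dim_vec v = dim_col A * dim_col B"
    using arg_cong[OF eq, of dim_row] arg_cong[OF eq, of dim_col] by simp_all
  obtain i where i: "i < dim_row A * dim_row B" "u $ i \<noteq> 0"
    using nonzero_vec_index[OF carrier_vec_dim_vec nz(1)] dims by auto
  obtain j where j: "j < dim_col A * dim_col B" "v $ j \<noteq> 0"
    using nonzero_vec_index[OF carrier_vec_dim_vec nz(2)] dims by auto
  define p0 q0 r0 s0 where "p0 = i div dim_row B" "q0 = j div dim_col B" "r0 = i mod dim_row B" "s0 = j mod dim_col B"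
  note defs = this
  have lt: "p0 < dim_row A" "q0 < dim_col A" "r0 < dim_row B" "s0 < dim_col B"
    using i(1) j(1) by (auto simp: defs div_less_prod mod_less_prod)
  have entry: "A $$ (p, q) * B $$ (r, s) = u $ (p * dim_row B + r) * v $ (q * dim_col B + s)"
    if "p < dim_row A" "q < dim_col A" "r < dim_row B" "s < dim_col B" for p q r s
  proof -
    have "p * dim_row B + r < dim_vec u" "q * dim_col B + s < dim_vec v"
      using that by (simp_all add: dims mult_add_less)
    then show ?thesis using index_kron[OF that] eq by simp
  qed
  have "A $$ (p0, q0) * B $$ (r0, s0) \<noteq> 0"
    using entry[OF lt] i(2) j(2) by (simp add: defs)
  then have nzAB: "A $$ (p0, q0) \<noteq> 0" "B $$ (r0, s0) \<noteq> 0" by auto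
  define a where "a = vec (dim_row A) (\<lambda>p. u $ (p * dim_row B + r0) / B $$ (r0, s0))"
  define b where "b = vec (dim_col A) (\<lambda>q. v $ (q * dim_col B + s0))"
  have "A $$ (p, q) = a $ p * b $ q" if "p < dim_row A" "q < dim_col A" for p q
    using entry[OF that lt(3,4)] nzAB that by (simp add: a_def b_def field_simps)
  then have A: "A = outer a b" by (intro eq_matI) (auto simp: a_def b_def)
  have "a $ p0 * b $ q0 \<noteq> 0" using nzAB(1) lt unfolding A by (simp add: a_def b_def)
  then have "a \<noteq> 0\<^sub>v (dim_vec a)" "b \<noteq> 0\<^sub>v (dim_vec b)"
    using lt by (metis a_def dim_vec index_zero_vec(1) mult_zero_left, metis b_def dim_vec index_zero_vec(1) mult_zero_right)
  with A show "\<exists>a b. A = outer a b \<and> a \<noteq> 0\<^sub>v (dim_vec a) \<and> b \<noteq> 0\<^sub>v (dim_vec b)" by blast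
  define c where "c = vec (dim_row B) (\<lambda>r. u $ (p0 * dim_row B + r) / A $$ (p0, q0))"
  define d where "d = vec (dim_col B) (\<lambda>s. v $ (q0 * dim_col B + s))"
  have "B $$ (r, s) = c $ r * d $ s" if "r < dim_row B" "s < dim_col B" for r s
    using entry[OF lt(1,2) that] nzAB that by (simp add: c_def d_def field_simps)
  then have B: "B = outer c d" by (intro eq_matI) (auto simp: c_def d_def)
  have "c $ r0 * d $ s0 \<noteq> 0" using nzAB(2) lt unfolding B by (simp add: c_def d_def)
  then have "c \<noteq> 0\<^sub>v (dim_vec c)" "d \<noteq> 0\<^sub>v (dim_vec d)"
    using lt by (metis c_def dim_vec index_zero_vec(1) mult_zero_left, metis d_def dim_vec index_zero_vec(1) mult_zero_right)
  with B show "\<exists>c d. B = outer c d \<and> c \<noteq> 0\<^sub>v (dim_vec c) \<and> d \<noteq> 0\<^sub>v (dim_vec d)" by blast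
qed

lemma kron_prod_eq_outerD:
  assumes "finite K" "kron_prod K A = outer u v" "u \<noteq> 0\<^sub>v (dim_vec u)" "v \<noteq> 0\<^sub>v (dim_vec v)" "i \<in> K"
  shows "\<exists>x y. A i = outer x y \<and> x \<noteq> 0\<^sub>v (dim_vec x) \<and> y \<noteq> 0\<^sub>v (dim_vec y)"
proof -
  have "\<exists>x y. A i = outer x y \<and> x \<noteq> 0\<^sub>v (dim_vec x) \<and> y \<noteq> 0\<^sub>v (dim_vec y)"
    if "foldr kron (map A l) (1\<^sub>m 1) = outer u v" "u \<noteq> 0\<^sub>v (dim_vec u)" "v \<noteq> 0\<^sub>v (dim_vec v)" "i \<in> set l" for l u v
    using that
  proof (induction l arbitrary: u v)
    case (Cons a l)
    then have eq: "A a \<otimes>\<^sub>K foldr kron (map A l) (1\<^sub>m 1) = outer u v" by simp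
    note D = kron_eq_outerD[OF eq Cons.prems(2,3)]
    show ?case
    proof (cases "i = a")
      case True
      then show ?thesis using D(1) by simp
    next
      case False
      then have "i \<in> set l" using Cons.prems by simp
      with D(2) Cons.IH show ?thesis by blast
    qed
  qed simp
  then show ?thesis using assms by (simp add: kron_prod_def)
qed

lemma mult_kernel_nonzero:
  assumes "M \<in> carrier_mat m (prod_list as)" "mat_kernel M \<inter> decomposable_vecs as = {0\<^sub>v (prod_list as)}"
    and xs: "map dim_vec xs = as" "\<And>x. x \<in> set xs \<Longrightarrow> x \<noteq> 0\<^sub>v (dim_vec x)"
  shows "M *\<^sub>v kron_vecs xs \<noteq> 0\<^sub>v m"
proof
  assume 0: "M *\<^sub>v kron_vecs xs = 0\<^sub>v m"
  have "kron_vecs xs \<in> mat_kernel M"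
    by (rule mat_kernelI[OF assms(1) _ 0]) (auto simp: xs(1) intro: carrier_vecI)
  then have "kron_vecs xs = 0\<^sub>v (prod_list as)"
    using assms(2) kron_vecs_in_decomposable[OF xs(1)] by blast
  then show False using kron_vecs_nonzero[of xs, OF xs(2)] xs(1) by simp
qed

lemma admissible_pairD:
  assumes "admissible_pair m n P M N" "\<And>l. l \<in> {1..4} \<Longrightarrow> finite (P l)"
  shows "M \<in> carrier_mat m (prod_list (factor_dims n P (P 3)))"
    "N \<in> carrier_mat m (prod_list (factor_dims n P (P 4)))"
    "mat_kernel M \<inter> decomposable_vecs (factor_dims n P (P 3)) = {0\<^sub>v (prod_list (factor_dims n P (P 3)))}"
    "mat_kernel N \<inter> decomposable_vecs (factor_dims n P (P 4)) = {0\<^sub>v (prod_list (factor_dims n P (P 4)))}"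
  using assms(1) prod_list_factor_dims[of P _ n] assms(2) unfolding admissible_pair_def Let_def by auto

lemma indexed_partition_subset: "indexed_partition r K P \<Longrightarrow> l \<in> {1..r} \<Longrightarrow> P l \<subseteq> K"
  by (auto simp: indexed_partition_def)

lemma kron_arg_outer_admissible:
  assumes P: "indexed_partition 4 K P" and K: "finite K"
    and xy: "\<And>i. i \<in> K \<Longrightarrow> x i \<in> carrier_vec (n i) \<and> y i \<in> carrier_vec (n i)"
    and M: "M \<in> carrier_mat m (prod_list (factor_dims n P (P 3)))"
    and N: "N \<in> carrier_mat m' (prod_list (factor_dims n P (P 4)))"
    and A: "\<And>i. i \<in> K \<Longrightarrow> A i = outer (x i) (y i)"
  shows "M * kron_arg P A * transpose_mat N
    = outer (M *\<^sub>v kron_vecs (factor_list P (P 3) x y x y)) (N *\<^sub>v kron_vecs (factor_list P (P 4) y x x y))"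
    "map dim_vec (factor_list P (P 3) x y x y) = factor_dims n P (P 3)"
    "map dim_vec (factor_list P (P 4) y x x y) = factor_dims n P (P 4)"
proof -
  \<comment> \<open>\<open>P\<close> is constrained only on \<open>{1..4}\<close> and may be
    infinite elsewhere; emptying it there makes the lemmas applicable that ask for finiteness of
    every \<open>P l\<close>.\<close>
  define P' where "P' l = (if l \<in> {1..4::nat} then P l else {})" for l
  have P'[simp]: "P' 1 = P 1" "P' 2 = P 2" "P' 3 = P 3" "P' 4 = P 4" by (simp_all add: P'_def)
  note P'1 = P'(1)[unfolded One_nat_def]
  have sub: "P' l \<subseteq> K" for l using indexed_partition_subset[OF P] by (auto simp: P'_def)
  have fin: "finite (P' l)" for l using sub K finite_subset by blast
  have fl: "factor_list P' Q f g f' g' = factor_list P Q f g f' g'" "factor_dims n P' Q = factor_dims n P Q"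
    "kron_arg P' A = kron_arg P A" for Q and f g f' g' :: "nat \<Rightarrow> complex vec"
    by (simp_all add: factor_list_def factor_dims_def kron_arg_def P'1)
  have fin34: "finite (P 3)" "finite (P 4)" using fin[of 3] fin[of 4] by simp_all
  have in3: "i \<in> K" if "i \<in> P' 1 \<union> P' 2 \<union> P' 3 \<or> i \<in> P' 1 \<union> P' 2 \<union> P' 4" for i using that sub by blast
  have dim: "dim_vec (x i) = n i \<and> dim_vec (y i) = n i" if "i \<in> K" for i using xy[OF that] by auto
  show d3: "map dim_vec (factor_list P (P 3) x y x y) = factor_dims n P (P 3)"
    using dims_factor_list(1)[of P' "P' 3" x n y] in3 dim fin fin34 by (simp add: fl P'1)
  show d4: "map dim_vec (factor_list P (P 4) y x x y) = factor_dims n P (P 4)"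
    using dims_factor_list(2)[of P' "P' 4" y n x] in3 dim fin fin34 by (simp add: fl P'1)
  have "kron_arg P' A = outer (kron_vecs (factor_list P' (P' 3) x y x y)) (kron_vecs (factor_list P' (P' 4) y x x y))"
    using sub by (intro kron_arg_outer fin A) blast
  then have "kron_arg P A = outer (kron_vecs (factor_list P (P 3) x y x y)) (kron_vecs (factor_list P (P 4) y x x y))"
    by (simp add: fl)
  then show "M * kron_arg P A * transpose_mat N
    = outer (M *\<^sub>v kron_vecs (factor_list P (P 3) x y x y)) (N *\<^sub>v kron_vecs (factor_list P (P 4) y x x y))"
    using M N by (simp add: mult_outer_transpose d3 d4)
qed

text \<open>The direction from the normal form to preservation: each \<open>A i\<close> is an outer
  product of nonzero vectors, so the image is an outer product of images of decomposable vectors,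
  which the kernel conditions keep nonzero.\<close>

lemma rank_one_preserved:
  assumes K: "finite K" and P: "indexed_partition 4 K P" and adm: "admissible_pair m n P M N"
    and A: "\<And>i. i \<in> K \<Longrightarrow> A i \<in> carrier_mat (n i) (n i)"
    and m: "m = (\<Prod>i\<in>K. n i)" and rank: "vec_space.rank m (kron_prod K A) = 1"
  shows "vec_space.rank m (M * kron_arg P A * transpose_mat N) = 1"
proof -
  have fin: "finite (P l)" if "l \<in> {1..4}" for l
    using indexed_partition_subset[OF P that] K finite_subset by blast
  note adm = admissible_pairD[OF adm fin]
  have car: "kron_prod K A \<in> carrier_mat m m"
    using A by (intro carrier_matI) (auto simp: dim_kron_prod[OF K] m intro!: prod.cong)
  then obtain u v where uv: "kron_prod K A = outer u v" "u \<noteq> 0\<^sub>v m" "v \<noteq> 0\<^sub>v m"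
    "u \<in> carrier_vec m" "v \<in> carrier_vec m"
    using rank rank_eq_1_iff_outer[OF car] by blast
  have "\<forall>i\<in>K. \<exists>x y. A i = outer x y \<and> x \<noteq> 0\<^sub>v (dim_vec x) \<and> y \<noteq> 0\<^sub>v (dim_vec y)"
    using kron_prod_eq_outerD[OF K uv(1)] uv(2-5) by auto
  then obtain x y where xy: "\<And>i. i \<in> K \<Longrightarrow> A i = outer (x i) (y i)"
    "\<And>i. i \<in> K \<Longrightarrow> x i \<noteq> 0\<^sub>v (dim_vec (x i)) \<and> y i \<noteq> 0\<^sub>v (dim_vec (y i))"
    unfolding bchoice_iff by blast
  have dim: "x i \<in> carrier_vec (n i) \<and> y i \<in> carrier_vec (n i)" if "i \<in> K" for i
    using carrier_matD[OF A[OF that]] xy(1)[OF that] by (intro conjI carrier_vecI) simp_all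
  note ka = kron_arg_outer_admissible[OF P K dim adm(1,2) xy(1)]
  have sub: "P 1 \<subseteq> K" "P 2 \<subseteq> K" "P 3 \<subseteq> K" "P 4 \<subseteq> K"
    using indexed_partition_subset[OF P] by auto
  have fin4: "finite (P 1)" "finite (P 2)" "finite (P 3)" "finite (P 4)" using fin by auto
  have set3: "z \<noteq> 0\<^sub>v (dim_vec z)" if "z \<in> set (factor_list P (P 3) x y x y)" for z
    using that sub fin4 xy(2) by (fastforce simp: factor_list_def)
  have set4: "z \<noteq> 0\<^sub>v (dim_vec z)" if "z \<in> set (factor_list P (P 4) y x x y)" for z
    using that sub fin4 xy(2) by (fastforce simp: factor_list_def)
  let ?u = "M *\<^sub>v kron_vecs (factor_list P (P 3) x y x y)" and ?v = "N *\<^sub>v kron_vecs (factor_list P (P 4) y x x y)"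
  have nz: "?u \<noteq> 0\<^sub>v m" "?v \<noteq> 0\<^sub>v m"
    using mult_kernel_nonzero[OF adm(1,3) ka(2) set3] mult_kernel_nonzero[OF adm(2,4) ka(3) set4] by auto
  have c: "?u \<in> carrier_vec m" "?v \<in> carrier_vec m" using adm(1,2) by (auto intro: carrier_vecI)
  then have "outer ?u ?v \<in> carrier_mat m m" using outer_simps(3)[of ?u ?v] carrier_vecD[OF c(1)] carrier_vecD[OF c(2)] by (simp only:)
  from rank_eq_1_iff_outer[OF this] have "vec_space.rank m (outer ?u ?v) = 1" using nz c by blast
  moreover have "M * kron_arg P A * transpose_mat N = outer ?u ?v" by (rule ka(1))
  ultimately show ?thesis by (simp only:)
qed

section \<open>From multilinear maps on labelled tuples to matrices\<close>

lemma assignment_exists: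
  assumes "distinct L" "length xs = length L"
  shows "map (\<lambda>j. case map_of (zip L xs) j of Some x \<Rightarrow> x | None \<Rightarrow> w j) L = xs"
  using assms by (intro nth_equalityI) (simp_all add: map_of_zip_nth)

text \<open>\<open>L\<close> fixes the order of the tensor factors. A list is read as the tuple that
  puts \<open>xs ! i\<close> at the label \<open>L ! i\<close>; the other labels receive zero
  vectors, which \<open>G\<close> does not see.\<close>

lemma multilinear_to_matrix:
  assumes TJ: "T \<subseteq> J" and L: "distinct L" "set L = T" and G: "multilinear J T d G"
  shows "\<exists>M\<in>carrier_mat m (prod_list (map d L)). \<forall>v. (\<forall>j\<in>J. v j \<in> carrier_vec (d j)) \<longrightarrow>
    M *\<^sub>v kron_vecs (map v L) = vec m (G v)"
proof -
  define asg where "asg xs = (\<lambda>j. case map_of (zip L xs) j of Some x \<Rightarrow> x | None \<Rightarrow> 0\<^sub>v (d j))"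
    for xs :: "complex vec list"
  have asg_nth: "asg xs (L ! i) = xs ! i" if "length xs = length L" "i < length L" for xs i
    using that L by (simp add: asg_def map_of_zip_nth)
  have ml: "multilinear_list (map d L) (\<lambda>xs. G (asg xs) p)" for p
    unfolding multilinear_list_def
  proof (intro allI impI)
    fix ys zs :: "complex vec list" and x y :: "complex vec" and c
    assume dims: "map dim_vec (ys @ x # zs) = map d L" and y: "dim_vec y = dim_vec x"
    define i where "i = length ys"
    have len: "length (ys @ x # zs) = length L" using arg_cong[OF dims, of length] by simp
    then have i: "i < length L" by (auto simp: i_def)
    define w where "w = asg (ys @ x # zs)"
    have wc: "w j \<in> carrier_vec (d j)" for j
    proof (cases "j \<in> T")
      case True
      then obtain l where l: "l < length L" "j = L ! l" using L by (metis in_set_conv_nth)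
      then have "dim_vec ((ys @ x # zs) ! l) = d (L ! l)"
        using arg_cong[OF dims, of "\<lambda>l'. l' ! l"] len by (simp del: map_append list.map)
      then show ?thesis using asg_nth[OF len l(1)] by (intro carrier_vecI) (simp add: w_def l)
    next
      case False
      then have "map_of (zip L (ys @ x # zs)) j = None" using L len by (simp add: map_of_zip_is_None)
      then show ?thesis by (simp add: w_def asg_def)
    qed
    have upd: "G (asg (ys @ z # zs)) = G (w(L ! i := z))" for z
    proof (rule multilinear_cong[OF G])
      fix j assume "j \<in> T"
      then obtain l where l: "l < length L" "j = L ! l" using L by (metis in_set_conv_nth)
      have "asg (ys @ z # zs) j = (ys @ z # zs) ! l" using asg_nth len l by simp
      moreover have "w j = (ys @ x # zs) ! l" using asg_nth len l by (simp add: w_def)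
      moreover have "j = L ! i \<longleftrightarrow> l = i" using l i L by (simp add: nth_eq_iff_index_eq)
      ultimately show "asg (ys @ z # zs) j = (w(L ! i := z)) j"
        by (auto simp: i_def nth_append nth_Cons split: nat.splits)
    qed
    have "dim_vec x = d (L ! i)"
      using arg_cong[OF dims, of "\<lambda>l'. l' ! i"] i by (simp add: i_def nth_append)
    then have xy: "x \<in> carrier_vec (d (L ! i))" "y \<in> carrier_vec (d (L ! i))"
      using y by (auto intro: carrier_vecI)
    have LT: "L ! i \<in> T" using i L by auto
    show "G (asg (ys @ (x + y) # zs)) p = G (asg (ys @ x # zs)) p + G (asg (ys @ y # zs)) p \<and>
        G (asg (ys @ (c \<cdot>\<^sub>v x) # zs)) p = c * G (asg (ys @ x # zs)) p"
      unfolding upd using multilinear_add[OF G wc LT xy] multilinear_smult[OF G wc LT xy(1)] by blast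
  qed
  obtain M where M: "M \<in> carrier_mat m (prod_list (map d L))"
    "\<forall>xs. map dim_vec xs = map d L \<longrightarrow> M *\<^sub>v kron_vecs xs = vec m (G (asg xs))"
    using kron_vecs_universal[of m "map d L" "\<lambda>xs. G (asg xs)", OF ml] by blast
  have "M *\<^sub>v kron_vecs (map v L) = vec m (G v)" if v: "\<forall>j\<in>J. v j \<in> carrier_vec (d j)" for v
  proof -
    have "map dim_vec (map v L) = map d L" using v TJ L by auto
    moreover have "G (asg (map v L)) = G v"
    proof (rule multilinear_cong[OF G])
      fix j assume "j \<in> T"
      then obtain l where l: "l < length L" "j = L ! l" using L by (metis in_set_conv_nth)
      then show "asg (map v L) j = v j" using asg_nth[of "map v L" l] by simp
    qed
    ultimately show ?thesis using M(2)[rule_format, of "map v L"] by simp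
  qed
  then show ?thesis using M(1) by blast
qed

lemma outer_add:
  "dim_vec u = dim_vec u' \<Longrightarrow> outer (u + u') v = outer u v + outer u' v"
  "dim_vec v = dim_vec v' \<Longrightarrow> outer u (v + v') = outer u v + outer u v'"
  by (auto intro!: eq_matI simp: distrib_left distrib_right)

lemma outer_smult: "outer (c \<cdot>\<^sub>v u) v = c \<cdot>\<^sub>m outer u v" "outer u (c \<cdot>\<^sub>v v) = c \<cdot>\<^sub>m outer u v"
  by (auto intro!: eq_matI)

lemma linear_map_mat:
  assumes "linear_map class_ring (module_mat TYPE(complex) m m) (module_mat TYPE(complex) m m) \<phi>"
  shows "X \<in> carrier_mat m m \<Longrightarrow> \<phi> X \<in> carrier_mat m m"
    "X \<in> carrier_mat m m \<Longrightarrow> Y \<in> carrier_mat m m \<Longrightarrow> \<phi> (X + Y) = \<phi> X + \<phi> Y"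
    "X \<in> carrier_mat m m \<Longrightarrow> \<phi> (c \<cdot>\<^sub>m X) = c \<cdot>\<^sub>m \<phi> X"
proof -
  interpret linear_map class_ring "module_mat TYPE(complex) m m" "module_mat TYPE(complex) m m" \<phi>
    by (rule assms)
  show "X \<in> carrier_mat m m \<Longrightarrow> \<phi> X \<in> carrier_mat m m"
    using T_im[of X] by (simp add: module_mat_simps)
  show "X \<in> carrier_mat m m \<Longrightarrow> Y \<in> carrier_mat m m \<Longrightarrow> \<phi> (X + Y) = \<phi> X + \<phi> Y"
    using T_add[of X Y] by (simp add: module_mat_simps)
  show "X \<in> carrier_mat m m \<Longrightarrow> \<phi> (c \<cdot>\<^sub>m X) = c \<cdot>\<^sub>m \<phi> X"
    using T_smult[of c X] by (simp add: module_mat_simps class_ring_simps)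
qed

text \<open>The arguments are freed from outer product form one at a time, each being built up row
  by row. A matrix with a single nonzero row is an outer product with a unit vector, so additivity
  alone transfers the equality.\<close>

lemma eq_if_eq_on_outer:
  fixes f g :: "(nat \<Rightarrow> complex mat) \<Rightarrow> complex mat"
  assumes K: "finite K"
    and f: "\<And>A i X Y. (\<And>j. j \<in> K \<Longrightarrow> A j \<in> carrier_mat (n j) (n j)) \<Longrightarrow> i \<in> K \<Longrightarrow> X \<in> carrier_mat (n i) (n i) \<Longrightarrow>
      Y \<in> carrier_mat (n i) (n i) \<Longrightarrow> f (A(i := X + Y)) = f (A(i := X)) + f (A(i := Y))"
    and g: "\<And>A i X Y. (\<And>j. j \<in> K \<Longrightarrow> A j \<in> carrier_mat (n j) (n j)) \<Longrightarrow> i \<in> K \<Longrightarrow> X \<in> carrier_mat (n i) (n i) \<Longrightarrow>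
      Y \<in> carrier_mat (n i) (n i) \<Longrightarrow> g (A(i := X + Y)) = g (A(i := X)) + g (A(i := Y))"
    and eq: "\<And>A. (\<And>i. i \<in> K \<Longrightarrow> \<exists>x\<in>carrier_vec (n i). \<exists>y\<in>carrier_vec (n i). A i = outer x y) \<Longrightarrow> f A = g A"
    and A: "\<And>j. j \<in> K \<Longrightarrow> A j \<in> carrier_mat (n j) (n j)"
  shows "f A = g A"
proof -
  let ?O = "\<lambda>i B. \<exists>x\<in>carrier_vec (n i). \<exists>y\<in>carrier_vec (n i). B = outer x y"
  have "f A = g A" if "S \<subseteq> K" "finite S" "\<And>j. j \<in> K \<Longrightarrow> A j \<in> carrier_mat (n j) (n j)"
    "\<And>j. j \<in> K - S \<Longrightarrow> ?O j (A j)" for S A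
    using that(2,1,3,4)
  proof (induction S arbitrary: A rule: finite_induct)
    case empty
    then show ?case by (intro eq) auto
  next
    case (insert i S)
    have i: "i \<in> K" using insert.prems by simp
    define B where "B k = mat (n i) (n i) (\<lambda>(p, q). if p < k then A i $$ (p, q) else 0)" for k
    have IH: "f (A(i := C)) = g (A(i := C))" if C: "?O i C" for C
    proof (rule insert.IH)
      show "S \<subseteq> K" using insert.prems by simp
      obtain x y where "x \<in> carrier_vec (n i)" "y \<in> carrier_vec (n i)" "C = outer x y" using C by blast
      then have "C \<in> carrier_mat (n i) (n i)" using outer_simps(3)[of x y] by auto
      then show "(A(i := C)) j \<in> carrier_mat (n j) (n j)" if "j \<in> K" for j
        using insert.prems that by simp
      show "?O j ((A(i := C)) j)" if "j \<in> K - S" for j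
        using insert.prems(3)[of j] that C by (cases "j = i") auto
    qed
    have "f (A(i := B k)) = g (A(i := B k))" if "k \<le> n i" for k
      using that
    proof (induction k)
      case 0
      have "B 0 = outer (0\<^sub>v (n i)) (0\<^sub>v (n i))" by (intro eq_matI) (auto simp: B_def)
      then have "?O i (B 0)" using zero_carrier_vec by blast
      then show ?case by (rule IH)
    next
      case (Suc k)
      let ?C = "outer (unit_vec (n i) k) (vec (n i) (\<lambda>q. A i $$ (k, q)))"
      have "?C \<in> carrier_mat (n i) (n i)" "B k \<in> carrier_mat (n i) (n i)" by (simp_all add: outer_def B_def)
      moreover have "B (Suc k) = B k + ?C"
        using Suc.prems by (intro eq_matI) (auto simp: B_def less_Suc_eq)
      moreover have "f (A(i := ?C)) = g (A(i := ?C))"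
        by (rule IH, rule bexI[of _ "unit_vec (n i) k"], rule bexI[of _ "vec (n i) (\<lambda>q. A i $$ (k, q))"]) auto
      ultimately show ?case
        using Suc.IH Suc.prems f[of A i "B k" ?C] g[of A i "B k" ?C] insert.prems(2) i
        by (simp del: fun_upd_apply)
    qed
    moreover have "B (n i) = A i" using insert.prems(2)[OF i] by (intro eq_matI) (auto simp: B_def)
    ultimately have "f (A(i := A i)) = g (A(i := A i))" by force
    then show ?case by simp
  qed
  from this[of K A] show ?thesis using K A by simp
qed

lemma indexed_partition_finite:
  assumes "indexed_partition r K P" "finite K" "l \<in> {1..r}"
  shows "finite (P l)"
  using finite_subset[OF indexed_partition_subset[OF assms(1,3)] assms(2)] .

text \<open>Since \<open>i\<close> lies in exactly one block, exactly one of the four Kronecker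
  factors changes, and it changes additively.\<close>

lemma kron_arg_add:
  assumes P: "indexed_partition 4 K P" and K: "finite K" and i: "i \<in> K"
    and X: "X \<in> carrier_mat a b" and Y: "Y \<in> carrier_mat a b"
  shows "kron_arg P (A(i := X + Y)) = kron_arg P (A(i := X)) + kron_arg P (A(i := Y))"
proof -
  have fin: "finite (P 1)" "finite (P 2)" "finite (P 3)" "finite (P 4)"
    by (auto intro: indexed_partition_finite[OF P K])
  note d = indexed_partitionD[OF P]
  have upd: "(\<lambda>j. h ((A(i := Z)) j)) = (\<lambda>j. h (A j))(i := h Z)" for h :: "complex mat \<Rightarrow> complex mat" and Z by auto
  have h: "transpose_mat (X + Y) = transpose_mat X + transpose_mat Y"
    "vectorize (X + Y) = vectorize X + vectorize Y"
    "transpose_mat (vectorize X + vectorize Y) = transpose_mat (vectorize X) + transpose_mat (vectorize Y)"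
    using X Y by (auto intro!: eq_matI simp: vectorize_def div_less_prod mod_less_prod)
  have dims: "dim_row X = a" "dim_row Y = a" "dim_col X = b" "dim_col Y = b" using X Y by auto
  have dkr: "dim_row (kron_prod R (F(i := Z))) = dim_row (kron_prod R (F(i := Z')))"
    "dim_col (kron_prod R (F(i := Z))) = dim_col (kron_prod R (F(i := Z')))"
    if "dim_row Z = dim_row Z'" "dim_col Z = dim_col Z'" "finite R" for R F and Z Z' :: "complex mat"
    using that by (auto simp: dim_kron_prod intro!: prod.cong)
  have dd: "dim_row X = dim_row Y" "dim_col X = dim_col Y"
    "dim_row (transpose_mat X) = dim_row (transpose_mat Y)" "dim_col (transpose_mat X) = dim_col (transpose_mat Y)"
    "dim_row (vectorize X) = dim_row (vectorize Y)" "dim_col (vectorize X) = dim_col (vectorize Y)"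
    "dim_row (transpose_mat (vectorize X)) = dim_row (transpose_mat (vectorize Y))"
    "dim_col (transpose_mat (vectorize X)) = dim_col (transpose_mat (vectorize Y))"
    using dims by (simp_all add: vectorize_def)
  have iU: "i \<in> P 1 \<union> P 2 \<union> P 3 \<union> P 4" using i by (simp only: d(1))
  have disj: "P 1 \<inter> P 2 = {}" "P 1 \<inter> P 3 = {}" "P 1 \<inter> P 4 = {}" "P 2 \<inter> P 3 = {}" "P 2 \<inter> P 4 = {}" "P 3 \<inter> P 4 = {}"
    by (rule d(2); simp)+
  consider "i \<in> P 1" "i \<notin> P 2" "i \<notin> P 3" "i \<notin> P 4" | "i \<notin> P 1" "i \<in> P 2" "i \<notin> P 3" "i \<notin> P 4"
    | "i \<notin> P 1" "i \<notin> P 2" "i \<in> P 3" "i \<notin> P 4" | "i \<notin> P 1" "i \<notin> P 2" "i \<notin> P 3" "i \<in> P 4"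
    using iU disj by blast
  then show ?thesis
    unfolding kron_arg_def upd[of transpose_mat] upd[of vectorize] upd[of "\<lambda>B. transpose_mat (vectorize B)"] h
    by cases (simp_all add: kron_prod_upd_notin[OF fin(1)] kron_prod_upd_notin[OF fin(2)]
      kron_prod_upd_notin[OF fin(3)] kron_prod_upd_notin[OF fin(4)] kron_add
      kron_prod_upd_add[OF fin(1) _ dd(1,2)] dkr[OF dd(1,2) fin(1)]
      kron_prod_upd_add[OF fin(2) _ dd(3,4)] dkr[OF dd(3,4) fin(2)]
      kron_prod_upd_add[OF fin(3) _ dd(5,6)] dkr[OF dd(5,6) fin(3)]
      kron_prod_upd_add[OF fin(4) _ dd(7,8)] dkr[OF dd(7,8) fin(4)] del: fun_upd_apply One_nat_def)
qed

lemma dim_kron_arg: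
  assumes P: "indexed_partition 4 K P" and K: "finite K"
    and A: "\<And>i. i \<in> K \<Longrightarrow> A i \<in> carrier_mat (n i) (n i)"
  shows "kron_arg P A \<in> carrier_mat (prod_list (factor_dims n P (P 3))) (prod_list (factor_dims n P (P 4)))"
proof -
  have sub: "P 1 \<subseteq> K" "P 2 \<subseteq> K" "P 3 \<subseteq> K" "P 4 \<subseteq> K"
    using indexed_partition_subset[OF P] by auto
  have fin: "finite (P 1)" "finite (P 2)" "finite (P 3)" "finite (P 4)"
    by (auto intro: indexed_partition_finite[OF P K])
  have dA: "dim_row (A i) = n i" "dim_col (A i) = n i" if "i \<in> K" for i using A[OF that] by auto
  have "prod (\<lambda>i. dim_row (A i)) R = prod n R" "prod (\<lambda>i. dim_col (A i)) R = prod n R"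
    "prod (\<lambda>i. dim_row (A i) * dim_col (A i)) R = (prod n R)\<^sup>2"
    if "R \<subseteq> K" for R using that dA by (auto simp: power2_eq_square prod.distrib[symmetric] intro!: prod.cong)
  then show ?thesis
    using sub by (intro carrier_matI) (simp_all add: kron_arg_def dim_kron_prod fin vectorize_def prod_list_factor_dims mult.assoc
      del: One_nat_def)
qed

lemma map_factor_list: "map f (factor_list P Q x y x' y') = factor_list P Q (f \<circ> x) (f \<circ> y) (f \<circ> x') (f \<circ> y')"
  by (simp add: factor_list_def map_concat comp_def)

lemma distinct_factor_list:
  assumes fin: "finite (P 1)" "finite (P 2)" "finite Q"
    and disj: "P 1 \<inter> P 2 = {}" "P 1 \<inter> Q = {}" "P 2 \<inter> Q = {}"
  shows "distinct (factor_list P Q (\<lambda>i. (i, b)) (\<lambda>i. (i, \<not> b)) (\<lambda>i. (i, b')) (\<lambda>i. (i, \<not> b')))"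
proof -
  have pairs: "distinct (concat (map (\<lambda>j. [(j, b'), (j, \<not> b')]) l))" if "distinct l" for l :: "nat list"
    using that by (induction l) auto
  have "distinct (map (\<lambda>i. (i, b)) l)" "distinct (map (\<lambda>i. (i, \<not> b)) l)" if "distinct l" for l :: "nat list"
    using that by (simp_all add: distinct_map inj_on_def)
  then show ?thesis
    using fin disj pairs[of "sorted_list_of_set Q"] unfolding factor_list_def distinct_append by auto
qed

lemma kron_vecs_carrier:
  assumes "finite K" "\<And>i. i \<in> K \<Longrightarrow> f i \<in> carrier_vec (n i)"
  shows "kron_vecs (map f (sorted_list_of_set K)) \<in> carrier_vec (\<Prod>i\<in>K. n i)"
proof -
  have "map dim_vec (map f (sorted_list_of_set K)) = map n (sorted_list_of_set K)"
    using assms by auto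
  then have "dim_vec (kron_vecs (map f (sorted_list_of_set K))) = prod_list (map n (sorted_list_of_set K))"
    by (simp only: dim_kron_vecs)
  also have "\<dots> = (\<Prod>i\<in>K. n i)"
    using prod.distinct_set_conv_list[of "sorted_list_of_set K" n] assms(1) by simp
  finally show ?thesis by (rule carrier_vecI)
qed

text \<open>A list of nonzero vectors for the labels in \<open>T\<close> has to be completed to a
  tuple to which \<open>nz\<close> applies, so the remaining labels receive unit vectors and not
  zero vectors.\<close>

lemma kernel_trivial_of_multilinear:
  assumes TJ: "T \<subseteq> J" and L: "distinct L" "set L = T" and as: "map d L = as"
    and M: "M \<in> carrier_mat m (prod_list as)"
      "\<And>v. \<forall>j\<in>J. v j \<in> carrier_vec (d j) \<Longrightarrow> M *\<^sub>v kron_vecs (map v L) = vec m (G v)"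
    and d: "\<And>j. j \<in> J \<Longrightarrow> 0 < d j"
    and nz: "\<And>v. \<forall>j\<in>J. v j \<in> carrier_vec (d j) \<and> v j \<noteq> 0\<^sub>v (d j) \<Longrightarrow> \<exists>p<m. G v p \<noteq> 0"
  shows "mat_kernel M \<inter> decomposable_vecs as = {0\<^sub>v (prod_list as)}"
proof (rule kernel_decomposable_trivial[OF M(1)])
  fix xs :: "complex vec list"
  assume dims: "map dim_vec xs = as" and xs: "\<And>x. x \<in> set xs \<Longrightarrow> x \<noteq> 0\<^sub>v (dim_vec x)"
  have len: "length xs = length L" using arg_cong[OF dims, of length] as by auto
  define v where "v = (\<lambda>j. case map_of (zip L xs) j of Some x \<Rightarrow> x | None \<Rightarrow> unit_vec (d j) 0)"
  have vL: "map v L = xs" unfolding v_def by (rule assignment_exists[OF L(1) len])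
  have v: "v j \<in> carrier_vec (d j) \<and> v j \<noteq> 0\<^sub>v (d j)" if "j \<in> J" for j
  proof (cases "j \<in> T")
    case True
    then obtain l where l: "l < length L" "j = L ! l" using L by (metis in_set_conv_nth)
    have "v j = xs ! l" using arg_cong[OF vL, of "\<lambda>l'. l' ! l"] l by simp
    moreover have "dim_vec (xs ! l) = d j"
      using arg_cong[OF dims[folded as], of "\<lambda>l'. l' ! l"] l len by simp
    moreover have "xs ! l \<noteq> 0\<^sub>v (dim_vec (xs ! l))" using xs l len by simp
    ultimately show ?thesis by (auto intro: carrier_vecI)
  next
    case False
    then have "v j = unit_vec (d j) 0"
      using L len by (simp add: v_def map_of_zip_is_None[THEN iffD2])
    then show ?thesis using d[OF that] unit_vec_nonzero[of 0 "d j"] by simp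
  qed
  then obtain p where p: "p < m" "G v p \<noteq> 0" using nz by blast
  have "vec m (G v) $ p \<noteq> 0" using p by simp
  then have "vec m (G v) \<noteq> 0\<^sub>v m" using p(1) by (metis index_zero_vec(1))
  moreover have "M *\<^sub>v kron_vecs xs = vec m (G v)" using M(2)[of v] v vL by simp
  ultimately show "M *\<^sub>v kron_vecs xs \<noteq> 0\<^sub>v m" by simp
qed

text \<open>The label \<open>(i, True)\<close> stands for \<open>x i\<close> and
  \<open>(i, False)\<close> for \<open>y i\<close>, where \<open>A i\<close> is the outer product of
  \<open>x i\<close> and \<open>y i\<close>; in these \<open>2 * card K\<close> vectors the
  preserver is a rank one multilinear map.\<close>

lemma preserver_factorization:
  assumes K: "finite K" and n: "\<And>i. i \<in> K \<Longrightarrow> 2 \<le> n i" and m: "m = (\<Prod>i\<in>K. n i)"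
    and \<phi>: "linear_map class_ring (module_mat TYPE(complex) m m) (module_mat TYPE(complex) m m) \<phi>"
    and pres: "\<And>A. (\<And>i. i \<in> K \<Longrightarrow> A i \<in> carrier_mat (n i) (n i)) \<Longrightarrow>
      vec_space.rank m (kron_prod K A) = 1 \<Longrightarrow> vec_space.rank m (\<phi> (kron_prod K A)) = 1"
  shows "\<exists>T G H. T \<subseteq> K \<times> UNIV \<and> multilinear (K \<times> UNIV) T (n \<circ> fst) G \<and>
    multilinear (K \<times> UNIV) (K \<times> UNIV - T) (n \<circ> fst) H \<and>
    (\<forall>v. (\<forall>j\<in>K \<times> UNIV. v j \<in> carrier_vec (n (fst j))) \<longrightarrow>
      \<phi> (kron_prod K (\<lambda>i. outer (v (i, True)) (v (i, False)))) = outer (vec m (G v)) (vec m (H v))) \<and>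
    (\<forall>v. (\<forall>j\<in>K \<times> UNIV. v j \<in> carrier_vec (n (fst j)) \<and> v j \<noteq> 0\<^sub>v (n (fst j))) \<longrightarrow>
      (\<exists>p<m. G v p \<noteq> 0) \<and> (\<exists>q<m. H v q \<noteq> 0))"
proof -
  define J where "J = K \<times> (UNIV :: bool set)"
  define d where "d = n \<circ> (fst :: nat \<times> bool \<Rightarrow> nat)"
  define X where "X b v = kron_vecs (map (\<lambda>i. v (i, b)) (sorted_list_of_set K))" for b and v :: "nat \<times> bool \<Rightarrow> complex vec"
  define \<Phi> where "\<Phi> v = \<phi> (outer (X True v) (X False v))" for v
  \<comment> \<open>Extension by zero to all indices, as \<open>rank_one_multilinear\<close> works
    over whole types. It does not affect minors, and it ensures that nonzero entries have indices
    below \<open>m\<close>.\<close>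
  define F where "F v p q = (if p < m \<and> q < m then \<Phi> v $$ (p, q) else 0)" for v p q
  note lin = linear_map_mat[OF \<phi>]
  have Xc: "X b v \<in> carrier_vec m" if "\<And>j. j \<in> J \<Longrightarrow> v j \<in> carrier_vec (d j)" for b v
    unfolding X_def m using that by (intro kron_vecs_carrier K) (auto simp: J_def d_def)
  have oc: "outer u w \<in> carrier_mat m m" if "u \<in> carrier_vec m" "w \<in> carrier_vec m" for u w
    using that outer_simps(3)[of u w] by auto
  have upd: "X b (v((i, b) := x)) = kron_vecs (map ((\<lambda>i. v (i, b))(i := x)) (sorted_list_of_set K))"
    "X (\<not> b) (v((i, b) := x)) = X (\<not> b) v" for b v i x
    by (auto simp: X_def fun_upd_def intro!: arg_cong[of _ _ kron_vecs])
  have dX: "dim_vec x = dim_vec y \<Longrightarrow> i \<in> K \<Longrightarrow>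
      X b (v((i, b) := x + y)) = X b (v((i, b) := x)) + X b (v((i, b) := y))"
    "i \<in> K \<Longrightarrow> X b (v((i, b) := c \<cdot>\<^sub>v x)) = c \<cdot>\<^sub>v X b (v((i, b) := x))" for b v i x y c
    unfolding upd using K by (auto simp del: fun_upd_apply intro!: kron_vecs_upd_add kron_vecs_upd_smult)
  have kp: "kron_prod K (\<lambda>i. outer (v (i, True)) (v (i, False))) = outer (X True v) (X False v)" for v
    unfolding X_def by (rule kron_prod_outer) (auto simp: K)
  have \<Phi>c: "\<Phi> v \<in> carrier_mat m m" if "\<And>j. j \<in> J \<Longrightarrow> v j \<in> carrier_vec (d j)" for v
    unfolding \<Phi>_def using that by (intro lin(1) oc Xc)
  have add: "\<Phi> (v(j := x + y)) = \<Phi> (v(j := x)) + \<Phi> (v(j := y))"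
    if v: "\<And>i. i \<in> J \<Longrightarrow> v i \<in> carrier_vec (d i)" and j: "j \<in> J"
      and x: "x \<in> carrier_vec (d j)" and y: "y \<in> carrier_vec (d j)" for v j x y
  proof -
    obtain i b where ib: "j = (i, b)" "i \<in> K" using j by (auto simp: J_def)
    have c: "X b' (v(j := x)) \<in> carrier_vec m" "X b' (v(j := y)) \<in> carrier_vec m" for b'
      using v x y by (auto intro!: Xc)
    have dm: "dim_vec (X b' (v(j := x))) = dim_vec (X b' (v(j := y)))" for b' using c by (metis carrier_vecD)
    have s: "X b (v(j := x + y)) = X b (v(j := x)) + X b (v(j := y))"
      using dX(1)[of x y i b v] x y ib by simp
    have o: "X (\<not> b) (v(j := z)) = X (\<not> b) v" for z using upd(2) ib by simp
    have "outer (X True (v(j := x + y))) (X False (v(j := x + y)))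
        = outer (X True (v(j := x))) (X False (v(j := x))) + outer (X True (v(j := y))) (X False (v(j := y)))"
    proof (cases b)
      case True
      then show ?thesis using s o dm[of True] by (simp add: outer_add)
    next
      case False
      then show ?thesis using s o dm[of False] by (simp add: outer_add)
    qed
    then show ?thesis unfolding \<Phi>_def using lin(2)[OF oc oc] c by simp
  qed
  have smult: "\<Phi> (v(j := c \<cdot>\<^sub>v x)) = c \<cdot>\<^sub>m \<Phi> (v(j := x))"
    if v: "\<And>i. i \<in> J \<Longrightarrow> v i \<in> carrier_vec (d i)" and j: "j \<in> J"
      and x: "x \<in> carrier_vec (d j)" for v j x c
  proof -
    obtain i b where ib: "j = (i, b)" "i \<in> K" using j by (auto simp: J_def)
    have cc: "X b' (v(j := x)) \<in> carrier_vec m" for b' using v x by (auto intro!: Xc)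
    have s: "X b (v(j := c \<cdot>\<^sub>v x)) = c \<cdot>\<^sub>v X b (v(j := x))" using dX(2)[of i b v c x] ib by simp
    have o: "X (\<not> b) (v(j := z)) = X (\<not> b) v" for z using upd(2) ib by simp
    have "outer (X True (v(j := c \<cdot>\<^sub>v x))) (X False (v(j := c \<cdot>\<^sub>v x)))
        = c \<cdot>\<^sub>m outer (X True (v(j := x))) (X False (v(j := x)))"
      using s o by (cases b) (simp_all add: outer_smult)
    then show ?thesis unfolding \<Phi>_def using lin(3)[OF oc] cc by simp
  qed
  have pure: "\<exists>g h. g \<in> carrier_vec m \<and> h \<in> carrier_vec m \<and> g \<noteq> 0\<^sub>v m \<and> h \<noteq> 0\<^sub>v m \<and> \<Phi> v = outer g h"
    if v: "\<And>j. j \<in> J \<Longrightarrow> v j \<in> carrier_vec (d j) \<and> v j \<noteq> 0\<^sub>v (d j)" for v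
  proof -
    have c: "X b v \<in> carrier_vec m" for b using v by (intro Xc) auto
    have nzX: "X b v \<noteq> 0\<^sub>v m" for b
    proof -
      have "X b v \<noteq> 0\<^sub>v (prod_list (map dim_vec (map (\<lambda>i. v (i, b)) (sorted_list_of_set K))))"
        unfolding X_def
      proof (rule kron_vecs_nonzero)
        fix x assume "x \<in> set (map (\<lambda>i. v (i, b)) (sorted_list_of_set K))"
        then obtain i where i: "i \<in> K" "x = v (i, b)" using K by auto
        then show "x \<noteq> 0\<^sub>v (dim_vec x)" using v[of "(i, b)"] by (auto simp: J_def)
      qed
      moreover have "prod_list (map dim_vec (map (\<lambda>i. v (i, b)) (sorted_list_of_set K))) = m"
        using carrier_vecD[OF c[of b]] unfolding X_def dim_kron_vecs .
      ultimately show ?thesis by simp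
    qed
    have "vec_space.rank m (outer (X True v) (X False v)) = 1"
      using rank_eq_1_iff_outer[OF oc[OF c c]] c nzX by blast
    then have "vec_space.rank m (\<Phi> v) = 1"
      unfolding \<Phi>_def kp[symmetric]
    proof (intro pres)
      fix i assume "i \<in> K"
      then show "outer (v (i, True)) (v (i, False)) \<in> carrier_mat (n i) (n i)"
        using v[of "(i, True)"] v[of "(i, False)"] outer_simps(3)[of "v (i, True)" "v (i, False)"]
        by (auto simp: J_def d_def)
    qed
    then show ?thesis using rank_eq_1_iff_outer[OF \<Phi>c, of v] v by blast
  qed
  interpret rank_one_multilinear J d F
  proof
    show "finite J" using K by (simp add: J_def)
    show "2 \<le> d j" if "j \<in> J" for j using that n by (auto simp: J_def d_def)
    show "multilinear J J d (\<lambda>v p. F v p q)" for q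
      unfolding multilinear_def
    proof (intro conjI allI impI ballI)
      fix v w :: "nat \<times> bool \<Rightarrow> complex vec" assume "\<forall>j\<in>J. v j = w j"
      then have "X b v = X b w" for b
        unfolding X_def using K by (intro arg_cong[of _ _ kron_vecs] map_cong) (auto simp: J_def)
      then have "\<Phi> v = \<Phi> w" by (simp only: \<Phi>_def)
      then show "(\<lambda>p. F v p q) = (\<lambda>p. F w p q)" by (simp only: F_def)
    next
      fix v :: "nat \<times> bool \<Rightarrow> complex vec" and j and x y :: "complex vec" and p
      assume v: "\<forall>j\<in>J. v j \<in> carrier_vec (d j)" and j: "j \<in> J" and xy: "x \<in> carrier_vec (d j)" "y \<in> carrier_vec (d j)"
      have "\<Phi> (v(j := x)) \<in> carrier_mat m m" "\<Phi> (v(j := y)) \<in> carrier_mat m m"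
        using v xy by (auto intro!: \<Phi>c)
      then show "F (v(j := x + y)) p q = F (v(j := x)) p q + F (v(j := y)) p q"
        using add[of v j x y] v j xy by (simp add: F_def del: fun_upd_apply)
    next
      fix v :: "nat \<times> bool \<Rightarrow> complex vec" and j and x :: "complex vec" and c p
      assume v: "\<forall>j\<in>J. v j \<in> carrier_vec (d j)" and j: "j \<in> J" and x: "x \<in> carrier_vec (d j)"
      have "\<Phi> (v(j := x)) \<in> carrier_mat m m" using v x by (auto intro!: \<Phi>c)
      then show "F (v(j := c \<cdot>\<^sub>v x)) p q = c * F (v(j := x)) p q"
        using smult[of v j x c] v j x by (simp add: F_def del: fun_upd_apply)
    qed
    show "same_cols (F v) (F v)" if v: "\<And>j. j \<in> J \<Longrightarrow> v j \<in> carrier_vec (d j)" for v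
    proof (cases "\<forall>j\<in>J. v j \<noteq> 0\<^sub>v (d j)")
      case True
      then obtain g h where gh: "g \<in> carrier_vec m" "h \<in> carrier_vec m" "\<Phi> v = outer g h"
        using pure[of v] v by blast
      then have "F v = (\<lambda>p q. (if p < m then g $ p else 0) * (if q < m then h $ q else 0))"
        by (intro ext) (auto simp: F_def)
      then show ?thesis by (simp add: same_cols_def)
    next
      \<comment> \<open>The preservation hypothesis says nothing about tuples with a zero vector;
        there the image is zero by linearity.\<close>
      case False
      then obtain j where j: "j \<in> J" "v j = 0\<^sub>v (d j)" by blast
      have "v(j := 0 \<cdot>\<^sub>v v j) = v" using j by (intro fun_upd_idem) (auto intro!: eq_vecI)
      moreover have "\<Phi> (v(j := 0 \<cdot>\<^sub>v v j)) = 0 \<cdot>\<^sub>m \<Phi> (v(j := v j))"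
        using v j(1) by (intro smult) auto
      ultimately have eq: "\<Phi> v = 0 \<cdot>\<^sub>m \<Phi> v" by (simp only: fun_upd_triv)
      have dim: "\<Phi> v \<in> carrier_mat m m" using v by (rule \<Phi>c)
      have "\<Phi> v $$ (p, q) = 0" if "p < m" "q < m" for p q
      proof -
        have "\<Phi> v $$ (p, q) = (0 \<cdot>\<^sub>m \<Phi> v) $$ (p, q)" by (rule arg_cong[OF eq])
        also have "\<dots> = 0" using that dim by simp
        finally show ?thesis .
      qed
      then show ?thesis by (simp add: same_cols_def F_def)
    qed
    show "\<exists>p q. F v p q \<noteq> 0" if v: "\<And>j. j \<in> J \<Longrightarrow> v j \<in> carrier_vec (d j) \<and> v j \<noteq> 0\<^sub>v (d j)" for v
    proof -
      obtain g h where gh: "g \<in> carrier_vec m" "h \<in> carrier_vec m" "g \<noteq> 0\<^sub>v m" "h \<noteq> 0\<^sub>v m" "\<Phi> v = outer g h"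
        using pure[of v] v by blast
      obtain p q where "p < m" "g $ p \<noteq> 0" "q < m" "h $ q \<noteq> 0"
        using nonzero_vec_index[OF gh(1,3)] nonzero_vec_index[OF gh(2,4)] by blast
      then have "F v p q \<noteq> 0" using gh by (simp add: F_def)
      then show ?thesis by blast
    qed
  qed
  obtain T G H where fac: "T \<subseteq> J" "multilinear J T d G" "multilinear J (J - T) d H"
    "\<forall>v\<in>tuples. \<forall>p q. F v p q = G v p * H v q"
    "\<forall>v\<in>pure_tuples. (\<exists>p. G v p \<noteq> 0) \<and> (\<exists>q. H v q \<noteq> 0)" using factorization by blast
  have "\<Phi> v = outer (vec m (G v)) (vec m (H v))" if v: "\<forall>j\<in>J. v j \<in> carrier_vec (d j)" for v
  proof (rule eq_matI)
    fix p q assume "p < dim_row (outer (vec m (G v)) (vec m (H v)))" "q < dim_col (outer (vec m (G v)) (vec m (H v)))"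
    then have pq: "p < m" "q < m" by auto
    have "F v p q = G v p * H v q" using fac(4) v by (simp add: tuples_def)
    then show "\<Phi> v $$ (p, q) = outer (vec m (G v)) (vec m (H v)) $$ (p, q)" using pq by (simp add: F_def)
  qed (use \<Phi>c[of v] v in auto)
  moreover have "(\<exists>p<m. G v p \<noteq> 0) \<and> (\<exists>q<m. H v q \<noteq> 0)"
    if v: "\<forall>j\<in>J. v j \<in> carrier_vec (d j) \<and> v j \<noteq> 0\<^sub>v (d j)" for v
  proof -
    have vp: "v \<in> pure_tuples" "v \<in> tuples" using v by (auto simp: pure_tuples_def tuples_def)
    obtain p q where pq: "G v p \<noteq> 0" "H v q \<noteq> 0" using fac(5) vp by blast
    then have "F v p q \<noteq> 0" using fac(4) vp by simp
    then have "p < m" "q < m" by (auto simp: F_def split: if_splits)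
    then show ?thesis using pq by blast
  qed
  ultimately show ?thesis
    using fac(1-3) unfolding kp \<Phi>_def[symmetric] J_def[symmetric] d_def[symmetric]
    by (intro exI[of _ T] exI[of _ G] exI[of _ H]) (simp add: d_def)
qed

lemma kron_prod_carrier:
  assumes "finite K" "\<And>i. i \<in> K \<Longrightarrow> A i \<in> carrier_mat (n i) (n i)"
  shows "kron_prod K A \<in> carrier_mat (\<Prod>i\<in>K. n i) (\<Prod>i\<in>K. n i)"
  using assms(2) by (intro carrier_matI) (auto simp: dim_kron_prod[OF assms(1)] intro!: prod.cong)

text \<open>The type of the row variable \<open>x i\<close> and of the column variable \<open>y i\<close> of \<open>A i = x i (y i)\<^sup>T\<close>
  (whether it moves the column or the row space of the image) determines the block of \<open>i\<close>.\<close>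

lemma preserver_normal_form:
  assumes K: "finite K" and n: "\<And>i. i \<in> K \<Longrightarrow> 2 \<le> n i" and m: "m = (\<Prod>i\<in>K. n i)"
    and \<phi>: "linear_map class_ring (module_mat TYPE(complex) m m) (module_mat TYPE(complex) m m) \<phi>"
    and pres: "\<And>A. (\<And>i. i \<in> K \<Longrightarrow> A i \<in> carrier_mat (n i) (n i)) \<Longrightarrow>
      vec_space.rank m (kron_prod K A) = 1 \<Longrightarrow> vec_space.rank m (\<phi> (kron_prod K A)) = 1"
  shows "\<exists>P M N. indexed_partition 4 K P \<and> admissible_pair m n P M N \<and>
    (\<forall>A. (\<forall>i\<in>K. A i \<in> carrier_mat (n i) (n i)) \<longrightarrow> \<phi> (kron_prod K A) = M * kron_arg P A * transpose_mat N)"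
proof -
  define J where "J = K \<times> (UNIV :: bool set)"
  define d where "d = n \<circ> (fst :: nat \<times> bool \<Rightarrow> nat)"
  obtain T G H where T: "T \<subseteq> J" and G: "multilinear J T d G" and H: "multilinear J (J - T) d H"
    and GH: "\<And>v. \<forall>j\<in>J. v j \<in> carrier_vec (d j) \<Longrightarrow>
      \<phi> (kron_prod K (\<lambda>i. outer (v (i, True)) (v (i, False)))) = outer (vec m (G v)) (vec m (H v))"
    and nz: "\<And>v. \<forall>j\<in>J. v j \<in> carrier_vec (d j) \<and> v j \<noteq> 0\<^sub>v (d j) \<Longrightarrow>
      (\<exists>p<m. G v p \<noteq> 0) \<and> (\<exists>q<m. H v q \<noteq> 0)"
    using preserver_factorization[OF K n m \<phi> pres] unfolding J_def d_def o_def by blast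
  \<comment> \<open>The last branch also serves all indices outside \<open>{1..4}\<close>, so that
    every \<open>P l\<close> is finite.\<close>
  define P :: "nat \<Rightarrow> nat set" where "P l = (if l = 1 then {i \<in> K. (i, True) \<in> T \<and> (i, False) \<notin> T}
    else if l = 2 then {i \<in> K. (i, True) \<notin> T \<and> (i, False) \<in> T}
    else if l = 3 then {i \<in> K. (i, True) \<in> T \<and> (i, False) \<in> T}
    else {i \<in> K. (i, True) \<notin> T \<and> (i, False) \<notin> T})" for l
  have P1: "P 1 = {i \<in> K. (i, True) \<in> T \<and> (i, False) \<notin> T}"
    and P2: "P 2 = {i \<in> K. (i, True) \<notin> T \<and> (i, False) \<in> T}"
    and P3: "P 3 = {i \<in> K. (i, True) \<in> T \<and> (i, False) \<in> T}"
    and P4: "P 4 = {i \<in> K. (i, True) \<notin> T \<and> (i, False) \<notin> T}" by (simp_all add: P_def)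
  have part: "indexed_partition 4 K P"
  proof -
    have "{1..4::nat} = {1, 2, 3, 4}" by auto
    then have "(\<Union>l\<in>{1..4}. P l) = P 1 \<union> P 2 \<union> P 3 \<union> P 4" by auto
    also have "\<dots> = K" unfolding P1 P2 P3 P4 by blast
    finally show ?thesis
      unfolding indexed_partition_def disjoint_family_on_def by (auto simp: P_def split: if_splits)
  qed
  have finP: "finite (P l)" for l using K by (auto simp: P_def)
  \<comment> \<open>\<open>L3\<close> and \<open>L4\<close> arrange the labels in the order in which
    \<open>M\<close> and \<open>N\<close> take their tensor factors; mapping \<open>d\<close> or a
    tuple over them produces dimensions or vectors in the same layout. The unsimplified negations
    match \<open>distinct_factor_list\<close>.\<close>
  define L3 where "L3 = factor_list P (P 3) (\<lambda>i. (i, True)) (\<lambda>i. (i, \<not> True)) (\<lambda>i. (i, True)) (\<lambda>i. (i, \<not> True))"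
  define L4 where "L4 = factor_list P (P 4) (\<lambda>i. (i, False)) (\<lambda>i. (i, \<not> False)) (\<lambda>i. (i, True)) (\<lambda>i. (i, \<not> True))"
  have dd: "P 1 \<inter> P 2 = {}" "P 1 \<inter> P 3 = {}" "P 2 \<inter> P 3 = {}" "P 1 \<inter> P 4 = {}" "P 2 \<inter> P 4 = {}"
    unfolding P1 P2 P3 P4 by blast+
  have dist: "distinct L3" "distinct L4"
    unfolding L3_def L4_def by (rule distinct_factor_list finP dd)+
  have setL: "set L3 = T" "set L4 = J - T"
  proof -
    have "(i, b) \<in> set L3 \<longleftrightarrow> (i, b) \<in> T" for i b
      using T unfolding L3_def set_factor_list[OF finP finP] unfolding P1 P2 P3 by (cases b) (auto simp: J_def image_iff)
    then show "set L3 = T" by auto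
    have "(i, b) \<in> set L4 \<longleftrightarrow> (i, b) \<in> J - T" for i b
      using T unfolding L4_def set_factor_list[OF finP finP] unfolding P1 P2 P4 by (cases b) (auto simp: J_def image_iff)
    then show "set L4 = J - T" by auto
  qed
  have fd: "factor_list P Q n n n n = factor_dims n P Q" for Q by (simp add: factor_list_def factor_dims_def)
  have mapL: "map d L3 = factor_dims n P (P 3)" "map d L4 = factor_dims n P (P 4)"
    unfolding L3_def L4_def map_factor_list by (simp_all add: fd d_def o_def)
  obtain M where M: "M \<in> carrier_mat m (prod_list (factor_dims n P (P 3)))"
    "\<And>v. \<forall>j\<in>J. v j \<in> carrier_vec (d j) \<Longrightarrow> M *\<^sub>v kron_vecs (map v L3) = vec m (G v)"
    using multilinear_to_matrix[OF T dist(1) setL(1) G, of m] unfolding mapL by blast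
  obtain N where N: "N \<in> carrier_mat m (prod_list (factor_dims n P (P 4)))"
    "\<And>v. \<forall>j\<in>J. v j \<in> carrier_vec (d j) \<Longrightarrow> N *\<^sub>v kron_vecs (map v L4) = vec m (H v)"
    using multilinear_to_matrix[OF Diff_subset dist(2) setL(2) H, of m] unfolding mapL by blast
  have d0: "0 < d j" if "j \<in> J" for j using n that by (fastforce simp: J_def d_def)
  have "mat_kernel M \<inter> decomposable_vecs (factor_dims n P (P 3)) = {0\<^sub>v (prod_list (factor_dims n P (P 3)))}"
    by (rule kernel_trivial_of_multilinear[OF T dist(1) setL(1) mapL(1) M d0]) (use nz in blast)+
  moreover have "mat_kernel N \<inter> decomposable_vecs (factor_dims n P (P 4)) = {0\<^sub>v (prod_list (factor_dims n P (P 4)))}"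
    by (rule kernel_trivial_of_multilinear[OF Diff_subset dist(2) setL(2) mapL(2) N d0]) (use nz in blast)+
  ultimately have adm: "admissible_pair m n P M N"
    using M(1) N(1) unfolding admissible_pair_def Let_def prod_list_factor_dims[OF finP finP finP] by blast
  note lin = linear_map_mat[OF \<phi>]
  have "\<phi> (kron_prod K A) = M * kron_arg P A * transpose_mat N"
    if A: "\<forall>i\<in>K. A i \<in> carrier_mat (n i) (n i)" for A
  proof (rule eq_if_eq_on_outer[OF K, where n = n and f = "\<lambda>A. \<phi> (kron_prod K A)"
        and g = "\<lambda>A. M * kron_arg P A * transpose_mat N"])
    show "A j \<in> carrier_mat (n j) (n j)" if "j \<in> K" for j using A that by blast
  next
    fix A :: "nat \<Rightarrow> complex mat" and i and X Y :: "complex mat"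
    assume A: "\<And>j. j \<in> K \<Longrightarrow> A j \<in> carrier_mat (n j) (n j)" and i: "i \<in> K"
      and X: "X \<in> carrier_mat (n i) (n i)" and Y: "Y \<in> carrier_mat (n i) (n i)"
    have c: "(A(i := Z)) j \<in> carrier_mat (n j) (n j)" if "Z \<in> carrier_mat (n i) (n i)" "j \<in> K" for Z j
      using A that by auto
    have cX: "kron_prod K (A(i := X)) \<in> carrier_mat m m"
      unfolding m by (rule kron_prod_carrier[OF K c[OF X]])
    have cY: "kron_prod K (A(i := Y)) \<in> carrier_mat m m"
      unfolding m by (rule kron_prod_carrier[OF K c[OF Y]])
    have "kron_prod K (A(i := X + Y)) = kron_prod K (A(i := X)) + kron_prod K (A(i := Y))"
      using X Y by (intro kron_prod_upd_add K i) auto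
    then show "\<phi> (kron_prod K (A(i := X + Y))) = \<phi> (kron_prod K (A(i := X))) + \<phi> (kron_prod K (A(i := Y)))"
      by (simp only: lin(2)[OF cX cY])
    note kX = dim_kron_arg[OF part K c[OF X]] and kY = dim_kron_arg[OF part K c[OF Y]]
    have "M * kron_arg P (A(i := X + Y)) = M * kron_arg P (A(i := X)) + M * kron_arg P (A(i := Y))"
      unfolding kron_arg_add[OF part K i X Y] by (rule mult_add_distrib_mat[OF M(1) kX kY])
    moreover have Nt: "transpose_mat N \<in> carrier_mat (prod_list (factor_dims n P (P 4))) m" using N(1) by simp
    ultimately show "M * kron_arg P (A(i := X + Y)) * transpose_mat N =
        M * kron_arg P (A(i := X)) * transpose_mat N + M * kron_arg P (A(i := Y)) * transpose_mat N"
      by (simp only: add_mult_distrib_mat[OF mult_carrier_mat[OF M(1) kX] mult_carrier_mat[OF M(1) kY] Nt])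
  next
    fix A :: "nat \<Rightarrow> complex mat"
    assume A: "\<And>i. i \<in> K \<Longrightarrow> \<exists>x\<in>carrier_vec (n i). \<exists>y\<in>carrier_vec (n i). A i = outer x y"
    then have "\<forall>i\<in>K. \<exists>x y. x \<in> carrier_vec (n i) \<and> y \<in> carrier_vec (n i) \<and> A i = outer x y" by blast
    then obtain a b where z: "\<And>i. i \<in> K \<Longrightarrow> a i \<in> carrier_vec (n i) \<and> b i \<in> carrier_vec (n i) \<and> A i = outer (a i) (b i)"
      unfolding bchoice_iff by blast
    define v where "v j = (if snd j then a (fst j) else b (fst j))" for j :: "nat \<times> bool"
    define x y where "x i = v (i, True)" and "y i = v (i, False)" for i
    have vc: "\<forall>j\<in>J. v j \<in> carrier_vec (d j)" using z by (auto simp: v_def J_def d_def)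
    have xy: "x i \<in> carrier_vec (n i) \<and> y i \<in> carrier_vec (n i)" and Axy: "A i = outer (x i) (y i)" if "i \<in> K" for i
      using z[OF that] by (simp_all add: x_def y_def v_def)
    have "kron_prod K A = kron_prod K (\<lambda>i. outer (v (i, True)) (v (i, False)))"
      using Axy by (intro kron_prod_cong K) (simp add: x_def y_def)
    then have "\<phi> (kron_prod K A) = outer (vec m (G v)) (vec m (H v))" using GH[OF vc] by simp
    also have "\<dots> = outer (M *\<^sub>v kron_vecs (map v L3)) (N *\<^sub>v kron_vecs (map v L4))"
      by (simp only: M(2)[OF vc] N(2)[OF vc])
    also have "map v L3 = factor_list P (P 3) x y x y"
      unfolding L3_def map_factor_list by (simp add: o_def x_def[abs_def] y_def[abs_def])
    also have "map v L4 = factor_list P (P 4) y x x y"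
      unfolding L4_def map_factor_list by (simp add: o_def x_def[abs_def] y_def[abs_def])
    also have "outer (M *\<^sub>v kron_vecs (factor_list P (P 3) x y x y)) (N *\<^sub>v kron_vecs (factor_list P (P 4) y x x y))
        = M * kron_arg P A * transpose_mat N"
      by (rule kron_arg_outer_admissible(1)[symmetric, OF part K xy M(1) N(1) Axy])
    finally show "\<phi> (kron_prod K A) = M * kron_arg P A * transpose_mat N" .
  qed
  then show ?thesis using part adm by blast
qed

theorem theorem1p1:
  fixes k m :: nat and n :: "nat \<Rightarrow> nat" and K :: "nat set"
  assumes "k \<ge> 2"
    and "\<forall>i\<in>{1..k}. n i \<ge> 2"
    and "m = (\<Prod>i=1..k. n i)"
    and "K = {1..k}"
  shows
    "(\<forall>\<phi>. linear_map class_ring (module_mat TYPE(complex) m m) (module_mat TYPE(complex) m m) \<phi> \<longrightarrow>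
       ((\<forall>A. (\<forall>i\<in>K. A i \<in> carrier_mat (n i) (n i)) \<and> vec_space.rank m (kron_prod K A) = 1
              \<longrightarrow> vec_space.rank m (\<phi> (kron_prod K A)) = 1)
        \<longleftrightarrow>
        (\<exists>P M N. indexed_partition 4 K P \<and> admissible_pair m n P M N \<and>
           (\<forall>A. (\<forall>i\<in>K. A i \<in> carrier_mat (n i) (n i)) \<longrightarrow>
              \<phi> (kron_prod K A) =
                M * (kron_prod (P 1) A \<otimes>\<^sub>K
                     kron_prod (P 2) (\<lambda>i. transpose_mat (A i)) \<otimes>\<^sub>K
                     kron_prod (P 3) (\<lambda>i. vectorize (A i)) \<otimes>\<^sub>K
                     kron_prod (P 4) (\<lambda>i. transpose_mat (vectorize (A i)))) * transpose_mat N))))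
     \<and>
     (\<forall>P. indexed_partition 4 K P \<longrightarrow>
        (if k = 2 \<and> 2 \<in> {n 1, n 2} \<and>
            ((P 1, P 2, P 3, P 4) = ({}, {}, K, {}) \<or> (P 1, P 2, P 3, P 4) = ({}, {}, {}, K))
         then \<not> (\<exists>M N. admissible_pair m n P M N)
         else (\<exists>M N. admissible_pair m n P M N)))"
proof -
  have K: "finite K" and n: "\<And>i. i \<in> K \<Longrightarrow> 2 \<le> n i" and m: "m = (\<Prod>i\<in>K. n i)"
    using assms by auto
  have equivalence: "(\<forall>A. (\<forall>i\<in>K. A i \<in> carrier_mat (n i) (n i)) \<and> vec_space.rank m (kron_prod K A) = 1
              \<longrightarrow> vec_space.rank m (\<phi> (kron_prod K A)) = 1)
        \<longleftrightarrow> (\<exists>P M N. indexed_partition 4 K P \<and> admissible_pair m n P M N \<and>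
           (\<forall>A. (\<forall>i\<in>K. A i \<in> carrier_mat (n i) (n i)) \<longrightarrow> \<phi> (kron_prod K A) = M * kron_arg P A * transpose_mat N))"
    (is "?L \<longleftrightarrow> ?R")
    if \<phi>: "linear_map class_ring (module_mat TYPE(complex) m m) (module_mat TYPE(complex) m m) \<phi>" for \<phi>
  proof
    assume L: ?L
    show ?R by (rule preserver_normal_form[OF K n m \<phi>]) (use L in blast)+
  next
    assume ?R
    then obtain P M N where R: "indexed_partition 4 K P" "admissible_pair m n P M N"
      "\<And>A. \<forall>i\<in>K. A i \<in> carrier_mat (n i) (n i) \<Longrightarrow> \<phi> (kron_prod K A) = M * kron_arg P A * transpose_mat N"
      by blast
    show ?L
    proof (intro allI impI, elim conjE)
      fix A assume A: "\<forall>i\<in>K. A i \<in> carrier_mat (n i) (n i)" and rk: "vec_space.rank m (kron_prod K A) = 1"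
      show "vec_space.rank m (\<phi> (kron_prod K A)) = 1"
        unfolding R(3)[OF A] by (rule rank_one_preserved[OF K R(1,2) _ m rk]) (use A in blast)
    qed
  qed
  have existence: "if k = 2 \<and> 2 \<in> {n 1, n 2} \<and>
      ((P 1, P 2, P 3, P 4) = ({}, {}, K, {}) \<or> (P 1, P 2, P 3, P 4) = ({}, {}, {}, K))
    then \<not> (\<exists>M N. admissible_pair m n P M N) else (\<exists>M N. admissible_pair m n P M N)" (is "if ?E then _ else _")
    if P: "indexed_partition 4 K P" for P
  proof (cases ?E)
    case True
    then have E: "k = 2" "2 \<in> {n 1, n 2}"
      "(P 1, P 2, P 3, P 4) = ({}, {}, {1..k}, {}) \<or> (P 1, P 2, P 3, P 4) = ({}, {}, {}, {1..k})"
      unfolding assms(4) by blast+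
    have "\<not> admissible_pair m n P M N" for M N
      by (rule no_admissible_pair[OF E(1) assms(2,3) E(2,3)])
    then show ?thesis using True by simp
  next
    case False
    \<comment> \<open>By disjointness, one block being all of \<open>K\<close> forces the other
      three to be empty, which brings the exception into the form used by
      \<open>admissible_pair_exists\<close>.\<close>
    have ne: "\<not> (k = 2 \<and> 2 \<in> {n 1, n 2} \<and> (P 3 = {1..k} \<or> P 4 = {1..k}))"
    proof
      assume *: "k = 2 \<and> 2 \<in> {n 1, n 2} \<and> (P 3 = {1..k} \<or> P 4 = {1..k})"
      have U: "P 1 \<union> P 2 \<union> P 3 \<union> P 4 = K" by (rule indexed_partitionD(1)[OF P])
      have dd: "P 1 \<inter> P 3 = {}" "P 1 \<inter> P 4 = {}" "P 2 \<inter> P 3 = {}" "P 2 \<inter> P 4 = {}" "P 3 \<inter> P 4 = {}"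
        by (rule indexed_partitionD(2)[OF P]; simp)+
      have "P 3 = K \<or> P 4 = K" using * unfolding assms(4) by blast
      then have "(P 1, P 2, P 3, P 4) = ({}, {}, K, {}) \<or> (P 1, P 2, P 3, P 4) = ({}, {}, {}, K)"
      proof
        assume 3: "P 3 = K"
        have "P 1 = {}" using dd(1) U 3 by blast
        moreover have "P 2 = {}" using dd(3) U 3 by blast
        moreover have "P 4 = {}" using dd(5) U 3 by blast
        ultimately show ?thesis using 3 by simp
      next
        assume 4: "P 4 = K"
        have "P 1 = {}" using dd(2) U 4 by blast
        moreover have "P 2 = {}" using dd(4) U 4 by blast
        moreover have "P 3 = {}" using dd(5) U 4 by blast
        ultimately show ?thesis using 4 by simp
      qed
      then show False using * False by blast
    qed
    show ?thesis
      unfolding if_not_P[OF False]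
      by (rule admissible_pair_exists[OF assms(1,2,3) P[unfolded assms(4)] ne])
  qed
  show ?thesis
    by (intro conjI allI impI, rule equivalence[unfolded kron_arg_def], assumption, rule existence, assumption)
qed

end
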